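(* The theory $\mathbf{PrA}$ is not interpretable (by an $m$-dimensional interpretation, for any $m\ge 1$) in any of its finitely axiomatizable subtheories.
   Context: $\mathbb{N}$ includes $0$. Presburger Arithmetic $\mathbf{PrA}$ is the elementary (first-order) theory of the model $(\mathbb{N},+)$, i.e. the set of all first-order sentences true in $(\mathbb{N},+)$. An $m$-dimensional interpretation $\iota$ ($m\ge 1$) of a first-order language $\mathcal{K}$ in a model $\mathfrak{M}$ consists of (parameter-free) first-order formulas of the language of $\mathfrak{M}$: $D_\iota(\overline{y})$ defining a set $\mathbf{D}_\iota\subseteq\mathfrak{M}^m$ (the domain); $P_\iota(\overline{x}_1,\ldots,\overline{x}_n)$ for each predicate symbol $P(x_1,\ldots,x_n)$ of $\mathcal{K}$, including equality; $f_\iota(\overline{x}_1,\ldots,\overline{x}_n,\overline{y})$ for each function symbol $f(x_1,\ldots,x_n)$ of $\mathcal{K}$. All vectors of variables have length $m$, and each $f_\iota$ defines the graph of a function modulo the interpretation of equality. This yields a $\mathcal{K}$-structure (the internal model) with domain $\mathbf{D}_\iota/{\sim_\iota}$, where $\sim_\iota$ is the equivalence relation given by the formula $=_\iota(\overline{x}_1,\overline{x}_2)$. If the internal model satisfies a theory $\mathbf{T}$, then $\iota$ is an interpretation of $\mathbf{T}$ in $\mathfrak{M}$. If $\iota$ (a fixed tuple of formulas) is an interpretation of $\mathbf{T}$ in $\mathfrak{M}$ for every model $\mathfrak{M}\models\mathbf{U}$ of a first-order theory $\mathbf{U}$, then $\iota$ is an interpretation of $\mathbf{T}$ in $\mathbf{U}$.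 $\mathbf{T}$ is interpretable in $\mathbf{U}$ if there is an interpretation of $\mathbf{T}$ in $\mathbf{U}$ of some dimension $m\ge1$. *)

theory Defs
  imports Main
begin

section \<open>First-order languages and structures\<close>

text \<open>
  A language assigns arities to the function and predicate symbols it contains; \<open>None\<close> means
  that the symbol does not belong to the language. Equality is a logical symbol and always denotes
  true equality.
\<close>

record ('f, 'p) lang =
  fun_ar :: "'f \<Rightarrow> nat option"
  pred_ar :: "'p \<Rightarrow> nat option"

datatype 'f tm = Var nat | Fun 'f "'f tm list"

datatype ('f, 'p) fm =
    Eq "'f tm" "'f tm"
  | Pred 'p "'f tm list"
  | Neg "('f, 'p) fm"
  | Conj "('f, 'p) fm" "('f, 'p) fm"
  | Exi nat "('f, 'p) fm"

primrec tm_vars :: "'f tm \<Rightarrow> nat set" where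
  "tm_vars (Var x) = {x}"
| "tm_vars (Fun f ts) = \<Union> (set (map tm_vars ts))"

primrec fm_vars :: "('f, 'p) fm \<Rightarrow> nat set" where
  "fm_vars (Eq s t) = tm_vars s \<union> tm_vars t"
| "fm_vars (Pred p ts) = \<Union> (set (map tm_vars ts))"
| "fm_vars (Neg \<phi>) = fm_vars \<phi>"
| "fm_vars (Conj \<phi> \<psi>) = fm_vars \<phi> \<union> fm_vars \<psi>"
| "fm_vars (Exi x \<phi>) = fm_vars \<phi> - {x}"

primrec wf_tm :: "('f, 'p, 'z) lang_scheme \<Rightarrow> 'f tm \<Rightarrow> bool" where
  "wf_tm L (Var x) \<longleftrightarrow> True"
| "wf_tm L (Fun f ts) \<longleftrightarrow> fun_ar L f = Some (length ts) \<and> list_all id (map (wf_tm L) ts)"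

primrec wf_fm :: "('f, 'p, 'z) lang_scheme \<Rightarrow> ('f, 'p) fm \<Rightarrow> bool" where
  "wf_fm L (Eq s t) \<longleftrightarrow> wf_tm L s \<and> wf_tm L t"
| "wf_fm L (Pred p ts) \<longleftrightarrow> pred_ar L p = Some (length ts) \<and> list_all (wf_tm L) ts"
| "wf_fm L (Neg \<phi>) \<longleftrightarrow> wf_fm L \<phi>"
| "wf_fm L (Conj \<phi> \<psi>) \<longleftrightarrow> wf_fm L \<phi> \<and> wf_fm L \<psi>"
| "wf_fm L (Exi x \<phi>) \<longleftrightarrow> wf_fm L \<phi>"

definition sentences :: "('f, 'p) lang \<Rightarrow> ('f, 'p) fm set" where
  "sentences L = {\<phi>. wf_fm L \<phi> \<and> fm_vars \<phi> = {}}"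

text \<open>
  The carrier of a structure is a nonempty subset of the universe type \<open>'a\<close>, so finite structures
  and structures of any cardinality up to that of \<open>'a\<close> are included.
\<close>

record ('f, 'p, 'a) fo_struct =
  carr :: "'a set"
  fun_in :: "'f \<Rightarrow> 'a list \<Rightarrow> 'a"
  pred_in :: "'p \<Rightarrow> 'a list \<Rightarrow> bool"

definition is_struct :: "('f, 'p) lang \<Rightarrow> ('f, 'p, 'a) fo_struct \<Rightarrow> bool" where
  "is_struct L M \<longleftrightarrow> carr M \<noteq> {} \<and>
     (\<forall>f n xs. fun_ar L f = Some n \<longrightarrow> length xs = n \<longrightarrow> set xs \<subseteq> carr M \<longrightarrow> fun_in M f xs \<in> carr M)"

primrec tm_val :: "('f, 'p, 'a) fo_struct \<Rightarrow> (nat \<Rightarrow> 'a) \<Rightarrow> 'f tm \<Rightarrow> 'a" where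
  "tm_val M e (Var x) = e x"
| "tm_val M e (Fun f ts) = fun_in M f (map (tm_val M e) ts)"

primrec sat :: "('f, 'p, 'a) fo_struct \<Rightarrow> (nat \<Rightarrow> 'a) \<Rightarrow> ('f, 'p) fm \<Rightarrow> bool" where
  "sat M e (Eq s t) \<longleftrightarrow> tm_val M e s = tm_val M e t"
| "sat M e (Pred p ts) \<longleftrightarrow> pred_in M p (map (tm_val M e) ts)"
| "sat M e (Neg \<phi>) \<longleftrightarrow> \<not> sat M e \<phi>"
| "sat M e (Conj \<phi> \<psi>) \<longleftrightarrow> sat M e \<phi> \<and> sat M e \<psi>"
| "sat M e (Exi x \<phi>) \<longleftrightarrow> (\<exists>a\<in>carr M. sat M (e(x := a)) \<phi>)"

definition true_in :: "('f, 'p, 'a) fo_struct \<Rightarrow> ('f, 'p) fm \<Rightarrow> bool" where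
  "true_in M \<phi> \<longleftrightarrow> (\<forall>e. range e \<subseteq> carr M \<longrightarrow> sat M e \<phi>)"

definition is_model :: "('f, 'p) lang \<Rightarrow> ('f, 'p) fm set \<Rightarrow> ('f, 'p, 'a) fo_struct \<Rightarrow> bool" where
  "is_model L T M \<longleftrightarrow> is_struct L M \<and> (\<forall>\<phi>\<in>T. true_in M \<phi>)"

definition elem_theory :: "('f, 'p) lang \<Rightarrow> ('f, 'p, 'a) fo_struct \<Rightarrow> ('f, 'p) fm set" where
  "elem_theory L M = {\<phi> \<in> sentences L. true_in M \<phi>}"

text \<open>
  Quantification over all models of a theory cannot range over all types at once; it is
  quantification over all models whose carrier is a subset of a universe type \<open>'a\<close>, which is
  passed explicitly. For a countable language and infinite \<open>'a\<close>, the notions below do not depend on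
  \<open>'a\<close> and agree with those over arbitrary models, by the downward Loewenheim-Skolem theorem.
\<close>

definition finitely_axiomatizable ::
    "'a itself \<Rightarrow> ('f, 'p) lang \<Rightarrow> ('f, 'p) fm set \<Rightarrow> bool" where
  "finitely_axiomatizable (_ :: 'a itself) L U \<longleftrightarrow>
     (\<exists>F. finite F \<and> F \<subseteq> sentences L \<and>
        (\<forall>M :: ('f, 'p, 'a) fo_struct. is_model L F M \<longleftrightarrow> is_model L U M))"

section \<open>Multi-dimensional interpretations\<close>

text \<open>
  An interpretation of a language with symbols in \<open>'f, 'p\<close> by formulas over the symbols \<open>'g, 'q\<close>.
  A formula with \<open>k\<close> vector arguments of length \<open>m\<close> uses the variables \<open>0, \<dots>, k * m - 1\<close>; the
  \<open>i\<close>-th entry of the \<open>j\<close>-th vector (both counted from \<open>0\<close>) is the variable \<open>j * m + i\<close>.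
  For a function symbol the last vector is the value.
\<close>

record ('f, 'p, 'g, 'q) interp =
  int_dim :: nat
  int_dom :: "('g, 'q) fm"
  int_eq :: "('g, 'q) fm"
  int_fun :: "'f \<Rightarrow> ('g, 'q) fm"
  int_pred :: "'p \<Rightarrow> ('g, 'q) fm"

definition fm_in_vars :: "('g, 'q) lang \<Rightarrow> nat \<Rightarrow> ('g, 'q) fm \<Rightarrow> bool" where
  "fm_in_vars L k \<phi> \<longleftrightarrow> wf_fm L \<phi> \<and> fm_vars \<phi> \<subseteq> {..<k}"

definition wf_interp ::
    "('f, 'p) lang \<Rightarrow> ('g, 'q) lang \<Rightarrow> ('f, 'p, 'g, 'q) interp \<Rightarrow> bool" where
  "wf_interp K L \<iota> \<longleftrightarrow>
     int_dim \<iota> \<ge> 1 \<and>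
     fm_in_vars L (int_dim \<iota>) (int_dom \<iota>) \<and>
     fm_in_vars L (2 * int_dim \<iota>) (int_eq \<iota>) \<and>
     (\<forall>f n. fun_ar K f = Some n \<longrightarrow> fm_in_vars L ((n + 1) * int_dim \<iota>) (int_fun \<iota> f)) \<and>
     (\<forall>p n. pred_ar K p = Some n \<longrightarrow> fm_in_vars L (n * int_dim \<iota>) (int_pred \<iota> p))"

text \<open>
  \<open>holds M \<phi> xss\<close>: the formula is true of the given vectors. The list index is unspecified beyond
  the length of the list, but such variables are not free in the formulas of a well-formed
  interpretation.
\<close>

definition holds :: "('g, 'q, 'a) fo_struct \<Rightarrow> ('g, 'q) fm \<Rightarrow> 'a list list \<Rightarrow> bool" where
  "holds M \<phi> xss \<longleftrightarrow> sat M (\<lambda>i. concat xss ! i) \<phi>"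

definition dom_set :: "('f, 'p, 'g, 'q) interp \<Rightarrow> ('g, 'q, 'a) fo_struct \<Rightarrow> 'a list set" where
  "dom_set \<iota> M =
     {xs. length xs = int_dim \<iota> \<and> set xs \<subseteq> carr M \<and> holds M (int_dom \<iota>) [xs]}"

definition eq_rel ::
    "('f, 'p, 'g, 'q) interp \<Rightarrow> ('g, 'q, 'a) fo_struct \<Rightarrow> ('a list \<times> 'a list) set" where
  "eq_rel \<iota> M = {(xs, ys). xs \<in> dom_set \<iota> M \<and> ys \<in> dom_set \<iota> M \<and> holds M (int_eq \<iota>) [xs, ys]}"

abbreviation eq_lists ::
    "('f, 'p, 'g, 'q) interp \<Rightarrow> ('g, 'q, 'a) fo_struct \<Rightarrow> 'a list list \<Rightarrow> 'a list list \<Rightarrow> bool" where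
  "eq_lists \<iota> M \<equiv> list_all2 (\<lambda>xs ys. (xs, ys) \<in> eq_rel \<iota> M)"

text \<open>
  The formula for a function symbol has to define the graph of a function modulo \<open>eq_rel\<close>. It is
  not required that this graph be closed under \<open>eq_rel\<close> in the value argument.
\<close>

definition interp_in ::
    "('f, 'p) lang \<Rightarrow> ('f, 'p, 'g, 'q) interp \<Rightarrow> ('g, 'q, 'a) fo_struct \<Rightarrow> bool" where
  "interp_in K \<iota> M \<longleftrightarrow>
     dom_set \<iota> M \<noteq> {} \<and>
     equiv (dom_set \<iota> M) (eq_rel \<iota> M) \<and>
     (\<forall>p n xss yss. pred_ar K p = Some n \<longrightarrow> length xss = n \<longrightarrow> eq_lists \<iota> M xss yss \<longrightarrow>
        holds M (int_pred \<iota> p) xss = holds M (int_pred \<iota> p) yss) \<and>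
     (\<forall>f n xss. fun_ar K f = Some n \<longrightarrow> length xss = n \<longrightarrow> set xss \<subseteq> dom_set \<iota> M \<longrightarrow>
        (\<exists>y\<in>dom_set \<iota> M. holds M (int_fun \<iota> f) (xss @ [y]))) \<and>
     (\<forall>f n xss yss. fun_ar K f = Some n \<longrightarrow> length xss = n \<longrightarrow> eq_lists \<iota> M xss yss \<longrightarrow>
        (\<forall>x\<in>dom_set \<iota> M. \<forall>y\<in>dom_set \<iota> M.
           holds M (int_fun \<iota> f) (xss @ [x]) \<longrightarrow> holds M (int_fun \<iota> f) (yss @ [y]) \<longrightarrow>
           (x, y) \<in> eq_rel \<iota> M))"

text \<open>
  The elements of the internal model are the \<open>eq_rel\<close>-classes of \<open>dom_set\<close>; the value of a function
  is the set of vectors that are \<open>eq_rel\<close>-equivalent to some value vector.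
\<close>

definition internal_model ::
    "('f, 'p, 'g, 'q) interp \<Rightarrow> ('g, 'q, 'a) fo_struct \<Rightarrow> ('f, 'p, 'a list set) fo_struct" where
  "internal_model \<iota> M =
     \<lparr>carr = dom_set \<iota> M // eq_rel \<iota> M,
      fun_in = (\<lambda>f Xs. {z. \<exists>xss. list_all2 (\<in>) xss Xs \<and>
                          (\<exists>y\<in>dom_set \<iota> M. holds M (int_fun \<iota> f) (xss @ [y]) \<and> (y, z) \<in> eq_rel \<iota> M)}),
      pred_in = (\<lambda>p Xs. \<exists>xss. list_all2 (\<in>) xss Xs \<and> holds M (int_pred \<iota> p) xss)\<rparr>"

definition interprets_in_model ::
    "('f, 'p) lang \<Rightarrow> ('f, 'p) fm set \<Rightarrow> ('f, 'p, 'g, 'q) interp \<Rightarrow> ('g, 'q, 'a) fo_struct \<Rightarrow> bool" where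
  "interprets_in_model K T \<iota> M \<longleftrightarrow> interp_in K \<iota> M \<and> is_model K T (internal_model \<iota> M)"

definition interpretable_in ::
    "'a itself \<Rightarrow> ('f, 'p) lang \<Rightarrow> ('f, 'p) fm set \<Rightarrow> ('g, 'q) lang \<Rightarrow> ('g, 'q) fm set \<Rightarrow> bool" where
  "interpretable_in (_ :: 'a itself) K T L U \<longleftrightarrow>
     (\<exists>\<iota> :: ('f, 'p, 'g, 'q) interp. wf_interp K L \<iota> \<and>
        (\<forall>M :: ('g, 'q, 'a) fo_struct. is_model L U M \<longrightarrow> interprets_in_model K T \<iota> M))"

section \<open>Presburger Arithmetic\<close>

datatype presb_fun = Plus

text \<open>
  The language has no predicate symbols besides equality; as types are nonempty, the symbol type is
  \<open>unit\<close> and its only element is not in the language.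
\<close>

definition presb_lang :: "(presb_fun, unit) lang" where
  "presb_lang = \<lparr>fun_ar = (\<lambda>_. Some 2), pred_ar = (\<lambda>_. None)\<rparr>"

definition nat_struct :: "(presb_fun, unit, nat) fo_struct" where
  "nat_struct =
     \<lparr>carr = UNIV, fun_in = (\<lambda>_ xs. xs ! 0 + xs ! 1), pred_in = (\<lambda>_ _. False)\<rparr>"

definition PrA :: "(presb_fun, unit) fm set" where
  "PrA = elem_theory presb_lang nat_struct"

end

(*
  Let F be a finite subtheory of PrA and suppose that an interpretation works in every model of F.
  Cooper's elimination works uniformly for the nonnegative parts of all discrete ordered groups with
  division by n <= K, where K depends on the formula only; so a sentence true in N holds in all such
  structures for large K. In N the elements of the internal model with finitely many predecessors form
  a copy of N. Let G(R) be the largest number represented in the ball of radius R. Definable functions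
  on N are eventually linear on residue classes, so if the norm of a representative of G(R+1) - G(R)
  were unbounded, G would grow superpolynomially, although a ball contains only polynomially many
  vectors. Hence the differences G(R+1) - G(R) take finitely many values and are eventually periodic,
  G is linear along an arithmetic progression, and the numbering of the standard part is definable.
  That this numbering embeds the structure as an initial segment, closed under addition, of its internal
  model of PrA is then a single sentence, which carries over to the group {n + a X : n integral,
  a rational with denominator prime to p} for a large prime p. In N, if a
  prime p does not divide u, it divides x + i u for some i < p; this would carry over from the internal
  model to the group, where it fails for x = X and u = 1.
*)
theory Submission
  imports Defs "HOL-Computational_Algebra.Polynomial" "HOL-Library.Countable" "HOL-Number_Theory.Cong"
begin

section \<open>Discrete ordered groups and quantifier elimination\<close>

text \<open>A fixed formula mentions finitely many divisors, so eliminating its quantifiers needs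
  division only up to a bound. \<open>zgroup K\<close> records that bound; a finite set of axioms
  true in N therefore cannot enforce division by every prime. Predicates take the group
  \<open>H\<close> together with the environment, so that one predicate is the same formula in all
  groups at once. The obstacle is that an m-dimensional interpretation may arrange its numbers among
  the vectors in any order: neither being a standard element nor the numbering itself is given by a
  formula. Finiteness is replaced by boundedness, since over N a set of vectors is finite iff it
  lies in a ball; the numbering is recovered from the largest number of each ball, and counting is
  what controls these maxima. A definable numbering is needed because only formulas transfer. In
  another group the same formula numbers elements of the internal model by all of
  \<open>nonneg H\<close>, nonstandard elements included. The image must be an initial segment so
  that a quotient found in the internal model is again numbered by an element of the group.\<close>

definition zgroup :: "nat \<Rightarrow> 'r::linordered_idom set \<Rightarrow> bool" where
  "zgroup K H \<longleftrightarrow> 1 \<in> H \<and> (\<forall>x\<in>H. \<forall>y\<in>H. x - y \<in> H) \<and> (\<forall>x\<in>H. 0 < x \<longrightarrow> 1 \<le> x) \<and>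
     (\<forall>n. 0 < n \<longrightarrow> n \<le> K \<longrightarrow> (\<forall>x\<in>H. \<exists>q\<in>H. \<exists>r::int. x = of_nat n * q + of_int r))"

definition nonneg :: "'r::linordered_idom set \<Rightarrow> 'r set" where
  "nonneg H = {x\<in>H. 0 \<le> x}"

lemma zgroup_mono: "zgroup K H \<Longrightarrow> L \<le> K \<Longrightarrow> zgroup L H"
  unfolding zgroup_def by auto

lemma zgroup_diff: "zgroup K H \<Longrightarrow> x \<in> H \<Longrightarrow> y \<in> H \<Longrightarrow> x - y \<in> H"
  unfolding zgroup_def by blast

lemma zgroup_one: "zgroup K H \<Longrightarrow> 1 \<in> H"
  unfolding zgroup_def by blast

lemma zgroup_zero: "zgroup K H \<Longrightarrow> 0 \<in> H"
  using zgroup_diff[of K H 1 1] zgroup_one[of K H] by simp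

lemma zgroup_minus: "zgroup K H \<Longrightarrow> x \<in> H \<Longrightarrow> - x \<in> H"
  using zgroup_diff[of K H 0 x] zgroup_zero[of K H] by simp

lemma zgroup_add: "zgroup K H \<Longrightarrow> x \<in> H \<Longrightarrow> y \<in> H \<Longrightarrow> x + y \<in> H"
  using zgroup_diff[of K H x "- y"] zgroup_minus[of K H y] by simp

lemma zgroup_discrete: "zgroup K H \<Longrightarrow> x \<in> H \<Longrightarrow> 0 < x \<Longrightarrow> 1 \<le> x"
  unfolding zgroup_def by blast

lemma zgroup_of_nat_mult: "zgroup K H \<Longrightarrow> x \<in> H \<Longrightarrow> of_nat n * x \<in> H"
  by (induction n) (auto simp: algebra_simps zgroup_zero intro: zgroup_add)

lemma zgroup_of_int_mult:
  assumes "zgroup K H" "x \<in> H"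
  shows "of_int c * x \<in> H"
  using zgroup_of_nat_mult[OF assms] zgroup_minus[OF assms(1) zgroup_of_nat_mult[OF assms]]
  by (cases c rule: int_cases2) auto

lemma zgroup_of_int: "zgroup K H \<Longrightarrow> of_int c \<in> H"
  using zgroup_of_int_mult[of K H 1 c] zgroup_one[of K H] by simp

text \<open>The remainder is taken from 1..n instead of 0..n-1 because in Cooper's step it is the
  distance from a strict lower bound.\<close>

lemma zgroup_div:
  assumes H: "zgroup K H" and n: "0 < n" "n \<le> K" and x: "x \<in> H"
  obtains q r where "q \<in> H" "1 \<le> r" "r \<le> int n" "x = of_nat n * q + of_int r"
proof -
  from assms obtain q r where q: "q \<in> H" "x = of_nat n * q + of_int r"
    unfolding zgroup_def by blast
  define r' where "r' = (r - 1) mod int n + 1"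
  define t where "t = (r - 1) div int n"
  have "r = int n * t + r'"
    unfolding r'_def t_def by simp
  then have "x = of_nat n * (q + of_int t) + of_int r'"
    using q by (simp add: algebra_simps)
  moreover have "q + of_int t \<in> H"
    using q H by (intro zgroup_add zgroup_of_int)
  moreover have "1 \<le> r'" "r' \<le> int n"
    using n pos_mod_bound[of "int n" "r - 1"] pos_mod_sign[of "int n" "r - 1"]
    unfolding r'_def by linarith+
  ultimately show ?thesis
    using that by blast
qed

lemma zgroup_Ints: "zgroup K (\<int> :: 'r::linordered_idom set)"
  unfolding zgroup_def
proof (intro conjI ballI allI impI)
  show "1 \<le> x" if "x \<in> \<int>" "0 < x" for x :: 'r
    using that by (elim Ints_cases) auto
  fix n :: nat and x :: 'r assume "x \<in> \<int>"
  then obtain r where "x = of_int r" by (rule Ints_cases)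
  then show "\<exists>q\<in>\<int>. \<exists>r. x = of_nat n * q + of_int r" by (intro bexI[of _ 0]) auto
qed auto

lemma nonneg_Ints: "nonneg \<int> = range (of_nat :: nat \<Rightarrow> 'r::linordered_idom)"
proof -
  have "x \<in> range of_nat" if "x \<in> \<int>" "0 \<le> x" for x :: 'r
    using that by (elim Ints_cases) (metis of_int_0_le_iff of_int_of_nat_eq rangeI zero_le_imp_eq_int)
  then show ?thesis by (auto simp: nonneg_def)
qed

lemma nonneg_zero: "zgroup K H \<Longrightarrow> 0 \<in> nonneg H"
  and nonneg_one: "zgroup K H \<Longrightarrow> 1 \<in> nonneg H"
  and nonneg_add: "zgroup K H \<Longrightarrow> x \<in> nonneg H \<Longrightarrow> y \<in> nonneg H \<Longrightarrow> x + y \<in> nonneg H"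
  by (auto simp: nonneg_def zgroup_zero zgroup_one zgroup_add)

section \<open>Affine forms, and quantifier-free predicates built from them\<close>

inductive linform :: "(('i \<Rightarrow> 'r::linordered_idom) \<Rightarrow> 'r) \<Rightarrow> bool" where
  linform_var: "linform (\<lambda>e. e i)"
| linform_one: "linform (\<lambda>e. 1)"
| linform_diff: "linform s \<Longrightarrow> linform t \<Longrightarrow> linform (\<lambda>e. s e - t e)"

lemma linform_zero: "linform (\<lambda>e. 0)"
  using linform_diff[OF linform_one linform_one] by simp

lemma linform_minus: "linform s \<Longrightarrow> linform (\<lambda>e. - s e)"
  using linform_diff[OF linform_zero] by simp

lemma linform_add: "linform s \<Longrightarrow> linform t \<Longrightarrow> linform (\<lambda>e. s e + t e)"
  using linform_diff[OF _ linform_minus] by simp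

lemma linform_of_nat_mult: "linform s \<Longrightarrow> linform (\<lambda>e. of_nat n * s e)"
  by (induction n) (auto simp: algebra_simps linform_zero intro: linform_add)

lemma linform_of_int_mult:
  assumes "linform s"
  shows "linform (\<lambda>e. of_int c * s e)"
  using linform_of_nat_mult[OF assms] linform_minus[OF linform_of_nat_mult[OF assms]]
  by (cases c rule: int_cases2) auto

lemma linform_of_int: "linform (\<lambda>e. of_int c)"
  using linform_of_int_mult[OF linform_one, of c] by simp

lemma linform_in_zgroup: "linform s \<Longrightarrow> zgroup K H \<Longrightarrow> range e \<subseteq> H \<Longrightarrow> s e \<in> H"
  by (induction rule: linform.induct) (auto intro: zgroup_one zgroup_diff)

lemma linform_subst:
  "linform s \<Longrightarrow> (\<And>j. linform (t j)) \<Longrightarrow> linform (\<lambda>e. s (\<lambda>j. t j e))"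
  by (induction rule: linform.induct) (auto intro: linform.intros)

lemma linform_fun_upd:
  assumes "linform s"
  shows "\<exists>c s'. linform s' \<and> (\<forall>e x. s (e(v := x)) = of_int c * x + s' e)"
  using assms
proof (induction rule: linform.induct)
  case (linform_var i)
  show ?case
  proof (cases "i = v")
    case True
    then show ?thesis by (intro exI[of _ 1] exI[of _ "\<lambda>e. 0"]) (auto intro: linform_zero)
  next
    case False
    then show ?thesis
      by (intro exI[of _ 0] exI[of _ "\<lambda>e. e i"]) (auto intro: linform.linform_var)
  qed
next
  case linform_one
  show ?case by (intro exI[of _ 0] exI[of _ "\<lambda>e. 1"]) (auto intro: linform.linform_one)
next
  case (linform_diff s t)
  then obtain c s' d t' where s: "linform s'" "\<forall>e x. s (e(v := x)) = of_int c * x + s' e"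
    and t: "linform t'" "\<forall>e x. t (e(v := x)) = of_int d * x + t' e"
    by blast
  have "linform (\<lambda>e. s' e - t' e)"
    using s(1) t(1) by (rule linform.linform_diff)
  then show ?case
    by (intro exI[of _ "c - d"] exI[of _ "\<lambda>e. s' e - t' e"])
      (simp add: s t algebra_simps del: fun_upd_apply)
qed

text \<open>The group enters only through the divisibility atoms; the quotient has to be sought in
  \<open>H\<close>, not in the surrounding ring.\<close>

inductive qfree :: "('r::linordered_idom set \<Rightarrow> ('i \<Rightarrow> 'r) \<Rightarrow> bool) \<Rightarrow> bool" where
  qfree_pos: "linform s \<Longrightarrow> qfree (\<lambda>H e. 0 < s e)"
| qfree_dvd: "linform s \<Longrightarrow> 0 < n \<Longrightarrow> qfree (\<lambda>H e. \<exists>q\<in>H. s e = of_nat n * q)"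
| qfree_neg: "qfree P \<Longrightarrow> qfree (\<lambda>H e. \<not> P H e)"
| qfree_conj: "qfree P \<Longrightarrow> qfree Q \<Longrightarrow> qfree (\<lambda>H e. P H e \<and> Q H e)"

lemma qfree_disj: "qfree P \<Longrightarrow> qfree Q \<Longrightarrow> qfree (\<lambda>H e. P H e \<or> Q H e)"
  using qfree_neg[OF qfree_conj[OF qfree_neg qfree_neg]] by simp

lemma qfree_False: "qfree (\<lambda>H e. False)"
  using qfree_pos[OF linform_zero] by simp

lemma qfree_nonneg: "linform s \<Longrightarrow> qfree (\<lambda>H e. 0 \<le> s e)"
  using qfree_neg[OF qfree_pos[OF linform_minus]] by (simp add: not_less)

lemma qfree_bex: "finite B \<Longrightarrow> (\<And>b. b \<in> B \<Longrightarrow> qfree (P b)) \<Longrightarrow> qfree (\<lambda>H e. \<exists>b\<in>B. P b H e)"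
  by (induction rule: finite_induct) (auto simp: qfree_False intro: qfree_disj)

lemma qfree_subst:
  "qfree P \<Longrightarrow> (\<And>j. linform (t j)) \<Longrightarrow> qfree (\<lambda>H e. P H (\<lambda>j. t j e))"
proof (induction rule: qfree.induct)
  case (qfree_pos s)
  then show ?case using qfree.qfree_pos[OF linform_subst[of s t]] by blast
next
  case (qfree_dvd s n)
  then show ?case using qfree.qfree_dvd[OF linform_subst[of s t], of n] by blast
next
  case (qfree_neg P)
  then show ?case using qfree.qfree_neg[of "\<lambda>H e. P H (\<lambda>j. t j e)"] by blast
next
  case (qfree_conj P Q)
  then show ?case using qfree.qfree_conj[of "\<lambda>H e. P H (\<lambda>j. t j e)" "\<lambda>H e. Q H (\<lambda>j. t j e)"] by blast
qed

text \<open>Since \<open>s e / d\<close> need not exist as a term, each atom is multiplied by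
  \<open>d\<close> instead: signs are unaffected because \<open>d\<close> is positive, and a modulus
  \<open>n\<close> becomes \<open>d * n\<close>.\<close>

lemma qfree_subst_quotient:
  assumes "qfree P" "0 < d" and s: "linform s"
  shows "\<exists>Q. qfree Q \<and> (\<forall>H e x. of_nat d * x = s e \<longrightarrow> P H (e(v := x)) = Q H e)"
  using assms(1)
proof (induction rule: qfree.induct)
  case (qfree_pos t)
  then obtain c t' where t: "linform t'" "\<And>e x. t (e(v := x)) = of_int c * x + t' e"
    using linform_fun_upd[of t v] by blast
  have "0 < t (e(v := x)) \<longleftrightarrow> 0 < of_int c * s e + of_nat d * t' e" if "of_nat d * x = s e" for e x
  proof -
    have "of_int c * s e + of_nat d * t' e = of_nat d * t (e(v := x))"
      by (simp add: t algebra_simps flip: that)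
    then show ?thesis using \<open>0 < d\<close> by (simp add: zero_less_mult_iff)
  qed
  moreover have "qfree (\<lambda>H e. 0 < of_int c * s e + of_nat d * t' e)"
    using s t by (intro qfree.qfree_pos linform_add linform_of_int_mult linform_of_nat_mult)
  ultimately show ?case by (intro exI[of _ "\<lambda>H e. 0 < of_int c * s e + of_nat d * t' e"]) blast
next
  case (qfree_dvd t n)
  then obtain c t' where t: "linform t'" "\<And>e x. t (e(v := x)) = of_int c * x + t' e"
    using linform_fun_upd[of t v] by blast
  let ?Q = "\<lambda>H e. \<exists>q\<in>H. of_int c * s e + of_nat d * t' e = of_nat (d * n) * q"
  have "(\<exists>q\<in>H. t (e(v := x)) = of_nat n * q) \<longleftrightarrow> ?Q H e" if "of_nat d * x = s e" for H e x
  proof -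
    have "of_int c * s e + of_nat d * t' e = of_nat d * t (e(v := x))"
      by (simp add: t algebra_simps flip: that)
    then show ?thesis using \<open>0 < d\<close> by (simp add: mult.assoc)
  qed
  moreover have "qfree ?Q"
    using s t \<open>0 < d\<close> \<open>0 < n\<close>
    by (intro qfree.qfree_dvd linform_add linform_of_int_mult linform_of_nat_mult) auto
  ultimately show ?case by (intro exI[of _ ?Q]) blast
next
  case (qfree_neg P)
  then obtain Q where "qfree Q" "\<forall>H e x. of_nat d * x = s e \<longrightarrow> P H (e(v := x)) = Q H e" by blast
  then show ?case by (intro exI[of _ "\<lambda>H e. \<not> Q H e"]) (simp add: qfree.qfree_neg del: fun_upd_apply)
next
  case (qfree_conj P1 P2)
  then obtain Q1 Q2 where "qfree Q1" "\<forall>H e x. of_nat d * x = s e \<longrightarrow> P1 H (e(v := x)) = Q1 H e"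
    "qfree Q2" "\<forall>H e x. of_nat d * x = s e \<longrightarrow> P2 H (e(v := x)) = Q2 H e" by blast
  then show ?case by (intro exI[of _ "\<lambda>H e. Q1 H e \<and> Q2 H e"]) (simp add: qfree.qfree_conj del: fun_upd_apply)
qed

text \<open>As a condition on the single variable \<open>v\<close>, a quantifier-free predicate sees
  only the position of \<open>d * x\<close> among finitely many bounds and the residue of
  \<open>x\<close> modulo \<open>N\<close>. The multiplier \<open>d\<close> collects the
  coefficients of \<open>v\<close>, and \<open>N\<close> the moduli.\<close>

lemma qfree_invariance:
  assumes "qfree P"
  shows "\<exists>d N B. 0 < d \<and> 0 < N \<and> finite B \<and> (\<forall>b\<in>B. linform b) \<and>
    (\<forall>H e x y. zgroup 0 H \<longrightarrow> range e \<subseteq> H \<longrightarrow> x \<in> H \<longrightarrow> y \<in> H \<longrightarrow>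
       (\<forall>b\<in>B. b e < of_nat d * x \<longleftrightarrow> b e < of_nat d * y) \<longrightarrow>
       (\<exists>q\<in>H. x - y = of_nat N * q) \<longrightarrow> P H (e(v := x)) = P H (e(v := y)))"
    (is "\<exists>d N B. ?I P d N B")
  using assms
proof (induction rule: qfree.induct)
  case (qfree_pos t)
  then obtain c t' where t: "linform t'" "\<And>e x. t (e(v := x)) = of_int c * x + t' e"
    using linform_fun_upd[of t v] by blast
  consider "c = 0" | "c > 0" | "c < 0" by linarith
  then show ?case
  proof cases
    case 1
    then show ?thesis by (intro exI[of _ 1] exI[of _ "{}"]) (simp add: t del: fun_upd_apply)
  next
    case 2
    define d where "d = nat c"
    have "0 < t (e(v := x)) \<longleftrightarrow> - t' e < of_nat d * x" for e x
      using 2 by (simp add: t d_def) linarith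
    then show ?thesis
      using 2 t by (intro exI[of _ d] exI[of _ 1] exI[of _ "{\<lambda>e. - t' e}"])
        (simp add: d_def linform_minus del: fun_upd_apply)
  next
    case 3
    define d where "d = nat (- c)"
    have c: "of_int c = - of_nat d" using 3 by (simp add: d_def)
    \<comment> \<open>Discreteness turns the upper bound \<open>d * x < t'\<close> into the negation
      of the strict lower bound \<open>t' - 1 < d * x\<close>, so that bounds of one shape
      suffice.\<close>
    have eq: "0 < t (e(v := x)) \<longleftrightarrow> \<not> t' e - 1 < of_nat d * x" if "zgroup 0 H" "range e \<subseteq> H" "x \<in> H"
      for H e x
    proof -
      have "t' e - of_nat d * x \<in> H"
        using zgroup_diff[OF that(1) linform_in_zgroup[OF t(1) that(1,2)] zgroup_of_nat_mult[OF that(1,3)]] .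
      with that have "0 < t' e - of_nat d * x \<longleftrightarrow> 1 \<le> t' e - of_nat d * x"
        using zgroup_discrete by (meson less_le_trans zero_less_one)
      then show ?thesis by (simp add: t c not_less algebra_simps)
    qed
    show ?thesis
      using 3 t eq by (intro exI[of _ d] exI[of _ 1] exI[of _ "{\<lambda>e. t' e - 1}"])
        (simp add: d_def linform_diff linform_one del: fun_upd_apply)
  qed
next
  case (qfree_dvd t n)
  then obtain c t' where t: "linform t'" "\<And>e x. t (e(v := x)) = of_int c * x + t' e"
    using linform_fun_upd[of t v] by blast
  have eq: "(\<exists>q\<in>H. t (e(v := x)) = of_nat n * q) = (\<exists>q\<in>H. t (e(v := y)) = of_nat n * q)"
    if H: "zgroup 0 H" and q: "q \<in> H" "x - y = of_nat n * q" for H e x y q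
  proof -
    have "t (e(v := x)) = of_int c * (y + of_nat n * q) + t' e"
      unfolding t q(2)[symmetric] by simp
    then have tx: "t (e(v := x)) = t (e(v := y)) + of_nat n * (of_int c * q)"
      unfolding t by (simp add: algebra_simps)
    have cq: "of_int c * q \<in> H"
      using H q(1) by (rule zgroup_of_int_mult)
    show ?thesis
    proof safe
      fix q' assume "q' \<in> H" "t (e(v := x)) = of_nat n * q'"
      with tx have "t (e(v := y)) = of_nat n * (q' - of_int c * q)"
        by (simp add: right_diff_distrib)
      then show "\<exists>q\<in>H. t (e(v := y)) = of_nat n * q"
        using zgroup_diff[OF H \<open>q' \<in> H\<close> cq] by blast
    next
      fix q' assume "q' \<in> H" "t (e(v := y)) = of_nat n * q'"
      with tx have "t (e(v := x)) = of_nat n * (q' + of_int c * q)"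
        by (simp add: distrib_left)
      then show "\<exists>q\<in>H. t (e(v := x)) = of_nat n * q"
        using zgroup_add[OF H \<open>q' \<in> H\<close> cq] by blast
    qed
  qed
  show ?case
    by (rule exI[of _ 1], rule exI[of _ n], rule exI[of _ "{}"]) (use qfree_dvd eq in blast)
next
  case (qfree_neg P)
  then show ?case by (simp only: Not_eq_iff)
next
  case (qfree_conj P1 P2)
  from qfree_conj.IH(1) obtain d1 N1 B1 where 1: "0 < d1" "0 < N1" "finite B1" "\<forall>b\<in>B1. linform b"
    and inv1: "\<forall>H e x y. zgroup 0 H \<longrightarrow> range e \<subseteq> H \<longrightarrow> x \<in> H \<longrightarrow> y \<in> H \<longrightarrow>
       (\<forall>b\<in>B1. b e < of_nat d1 * x \<longleftrightarrow> b e < of_nat d1 * y) \<longrightarrow>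
       (\<exists>q\<in>H. x - y = of_nat N1 * q) \<longrightarrow> P1 H (e(v := x)) = P1 H (e(v := y))"
    by (elim exE conjE)
  from qfree_conj.IH(2) obtain d2 N2 B2 where 2: "0 < d2" "0 < N2" "finite B2" "\<forall>b\<in>B2. linform b"
    and inv2: "\<forall>H e x y. zgroup 0 H \<longrightarrow> range e \<subseteq> H \<longrightarrow> x \<in> H \<longrightarrow> y \<in> H \<longrightarrow>
       (\<forall>b\<in>B2. b e < of_nat d2 * x \<longleftrightarrow> b e < of_nat d2 * y) \<longrightarrow>
       (\<exists>q\<in>H. x - y = of_nat N2 * q) \<longrightarrow> P2 H (e(v := x)) = P2 H (e(v := y))"
    by (elim exE conjE)
  \<comment> \<open>Each set of bounds is scaled by the other multiplier, which gives both the
    common multiplier \<open>d1 * d2\<close>.\<close>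
  define B where "B = (\<lambda>b e. of_nat d2 * b e) ` B1 \<union> (\<lambda>b e. of_nat d1 * b e) ` B2"
  show ?case
  proof (rule exI[of _ "d1 * d2"], rule exI[of _ "N1 * N2"], rule exI[of _ B], intro conjI allI impI)
    fix H e x y
    assume H: "zgroup 0 H" "range e \<subseteq> H" "x \<in> H" "y \<in> H"
      and B: "\<forall>b\<in>B. b e < of_nat (d1 * d2) * x \<longleftrightarrow> b e < of_nat (d1 * d2) * y"
      and "\<exists>q\<in>H. x - y = of_nat (N1 * N2) * q"
    then obtain q where q: "q \<in> H" "x - y = of_nat (N1 * N2) * q" by blast
    have "x - y = of_nat N1 * (of_nat N2 * q)" "x - y = of_nat N2 * (of_nat N1 * q)"
      using q(2) by (simp_all only: of_nat_mult mult.assoc mult.left_commute[of "of_nat N1"])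
    then have "\<exists>q\<in>H. x - y = of_nat N1 * q" "\<exists>q\<in>H. x - y = of_nat N2 * q"
      using zgroup_of_nat_mult[OF H(1) q(1)] by blast+
    moreover have "\<forall>b\<in>B1. b e < of_nat d1 * x \<longleftrightarrow> b e < of_nat d1 * y"
    proof
      fix b assume b: "b \<in> B1"
      have "of_nat d2 * b e < of_nat (d1 * d2) * z \<longleftrightarrow> b e < of_nat d1 * z" for z
        using 2(1) mult_less_cancel_left_pos[of "of_nat d2" "b e" "of_nat d1 * z"]
        by (simp only: of_nat_mult of_nat_0_less_iff mult.assoc mult.left_commute[of "of_nat d2"])
      then show "b e < of_nat d1 * x \<longleftrightarrow> b e < of_nat d1 * y" using B b unfolding B_def by blast
    qed
    moreover have "\<forall>b\<in>B2. b e < of_nat d2 * x \<longleftrightarrow> b e < of_nat d2 * y"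
    proof
      fix b assume b: "b \<in> B2"
      have "of_nat d1 * b e < of_nat (d1 * d2) * z \<longleftrightarrow> b e < of_nat d2 * z" for z
        using 1(1) mult_less_cancel_left_pos[of "of_nat d1" "b e" "of_nat d2 * z"]
        by (simp only: of_nat_mult of_nat_0_less_iff mult.assoc)
      then show "b e < of_nat d2 * x \<longleftrightarrow> b e < of_nat d2 * y" using B b unfolding B_def by blast
    qed
    ultimately have "P1 H (e(v := x)) = P1 H (e(v := y))" "P2 H (e(v := x)) = P2 H (e(v := y))"
      using inv1[rule_format, OF H] inv2[rule_format, OF H] by simp_all
    then show "(P1 H (e(v := x)) \<and> P2 H (e(v := x))) = (P1 H (e(v := y)) \<and> P2 H (e(v := y)))"
      by simp
  next
    show "0 < d1 * d2" "0 < N1 * N2" "finite B" using 1 2 by (simp_all add: B_def)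
  next
    have "linform (\<lambda>e. of_nat d2 * b e)" if "b \<in> B1" for b
      using that 1(4) linform_of_nat_mult by blast
    moreover have "linform (\<lambda>e. of_nat d1 * b e)" if "b \<in> B2" for b
      using that 2(4) linform_of_nat_mult by blast
    ultimately show "\<forall>b\<in>B. linform b" by (simp add: B_def ball_Un)
  qed
qed

text \<open>Cooper's argument: a witness may slide down in steps of \<open>N\<close> as long as
  \<open>d * x\<close> stays above the largest bound below it. It ends within distance
  \<open>d * N\<close> of that bound, which leaves finitely many candidates, and division by
  \<open>d * N\<close> is all that the group has to provide.\<close>

lemma qfree_witness:
  assumes "qfree P"
  shows "\<exists>d K C. 0 < d \<and> finite C \<and> (\<forall>b\<in>C. linform b) \<and>
    (\<forall>H e. zgroup K H \<longrightarrow> range e \<subseteq> H \<longrightarrow> (\<exists>x\<in>nonneg H. P H (e(v := x))) \<longrightarrow>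
       (\<exists>b\<in>C. \<exists>x\<in>nonneg H. of_nat d * x = b e \<and> P H (e(v := x))))"
proof -
  from qfree_invariance[OF assms, of v]
  obtain d N B where d: "0 < d" "0 < N" and B: "finite B" "\<forall>b\<in>B. linform b"
    and inv: "\<And>H e x y. zgroup 0 H \<Longrightarrow> range e \<subseteq> H \<Longrightarrow> x \<in> H \<Longrightarrow> y \<in> H \<Longrightarrow>
       (\<And>b. b \<in> B \<Longrightarrow> b e < of_nat d * x \<longleftrightarrow> b e < of_nat d * y) \<Longrightarrow>
       (\<exists>q\<in>H. x - y = of_nat N * q) \<Longrightarrow> P H (e(v := x)) = P H (e(v := y))"
    by metis
  \<comment> \<open>The extra bound -1 lies below every \<open>d * x\<close>, so a largest bound
    exists; it also keeps the new witness nonnegative, since the remainder is at least 1.\<close>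
  define B' where "B' = insert (\<lambda>e. - 1) B"
  define C where "C = (\<lambda>(b, r) e. b e + of_int r) ` (B' \<times> {1..int (d * N)})"
  have lin: "linform b" if "b \<in> B'" for b
    using that B linform_minus[OF linform_one] by (auto simp: B'_def)
  have "\<exists>b\<in>C. \<exists>x\<in>nonneg H. of_nat d * x = b e \<and> P H (e(v := x))"
    if H: "zgroup (d * N) H" "range e \<subseteq> H" and x: "x \<in> nonneg H" "P H (e(v := x))" for H e x
  proof -
    have x0: "x \<in> H" "0 \<le> x" using x by (auto simp: nonneg_def)
    define L where "L = Max ((\<lambda>b. b e) ` {b\<in>B'. b e < of_nat d * x})"
    have fin: "finite ((\<lambda>b. b e) ` {b\<in>B'. b e < of_nat d * x})"
      using B by (simp add: B'_def)
    have "- 1 < of_nat d * x"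
      using x0 by (meson less_le_trans mult_nonneg_nonneg neg_less_0_iff_less of_nat_0_le_iff zero_less_one)
    then have mem: "-1 \<in> (\<lambda>b. b e) ` {b\<in>B'. b e < of_nat d * x}"
      by (force simp: B'_def)
    have "L \<in> (\<lambda>b. b e) ` {b\<in>B'. b e < of_nat d * x}"
      unfolding L_def using mem by (intro Max_in[OF fin]) auto
    then obtain b0 where b0: "b0 \<in> B'" "b0 e = L" "L < of_nat d * x" by auto
    have L1: "-1 \<le> L" unfolding L_def by (rule Max_ge[OF fin mem])
    have Lmax: "b e \<le> L" if "b \<in> B'" "b e < of_nat d * x" for b
      unfolding L_def using that by (intro Max_ge[OF fin]) auto
    have LH: "L \<in> H"
      using linform_in_zgroup[OF lin[OF b0(1)] H] b0(2) by simp
    have dxH: "of_nat d * x \<in> H" using H(1) x0(1) by (rule zgroup_of_nat_mult)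
    have "of_nat d * x - L \<in> H" using zgroup_diff[OF H(1) dxH LH] .
    then obtain q r where q: "q \<in> H" "1 \<le> r" "r \<le> int (d * N)"
      "of_nat d * x - L = of_nat (d * N) * q + of_int r"
      using zgroup_div[OF H(1), of "d * N"] d by (metis le_refl mult_pos_pos)
    \<comment> \<open>Here \<open>q\<close> is the number of steps of length \<open>N\<close>; by
      the division above, \<open>d * y\<close> is exactly the bound plus the remainder.\<close>
    define y where "y = x - of_nat N * q"
    have dy: "of_nat d * y = L + of_int r"
      using q(4) by (simp add: y_def algebra_simps)
    have q0: "0 \<le> q"
    proof (rule ccontr)
      assume "\<not> 0 \<le> q"
      then have "q \<le> - 1"
        using zgroup_discrete[OF H(1) zgroup_minus[OF H(1) q(1)]] by simp
      then have "of_nat (d * N) * q \<le> - of_nat (d * N)"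
        using mult_left_mono[of q "- 1" "of_nat (d * N)"] by (simp del: of_nat_mult)
      moreover have "(of_int r :: 'a) \<le> of_int (int (d * N))"
        using q(3) by (simp only: of_int_le_iff)
      ultimately have "of_nat d * x - L \<le> 0"
        using q(4) by (simp del: of_nat_mult)
      with b0(3) show False by simp
    qed
    have yH: "y \<in> H"
      unfolding y_def using zgroup_diff[OF H(1) x0(1) zgroup_of_nat_mult[OF H(1) q(1)]] .
    have "0 \<le> of_nat d * y"
      using L1 q(2) unfolding dy by (smt (verit) add_mono le_add_same_cancel2 of_int_1_le_iff add.right_inverse add.commute)
    then have y: "y \<in> nonneg H"
      using yH d by (auto simp: nonneg_def zero_le_mult_iff)
    have Ly: "L < of_nat d * y"
      using q(2) unfolding dy by simp
    have yx: "of_nat d * y \<le> of_nat d * x"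
      using q0 by (intro mult_left_mono) (auto simp: y_def)
    have "P H (e(v := x)) = P H (e(v := y))"
    proof (rule inv)
      fix b assume "b \<in> B"
      then have "b \<in> B'" by (simp add: B'_def)
      then show "b e < of_nat d * x \<longleftrightarrow> b e < of_nat d * y"
        using Lmax[of b] Ly yx by auto
    next
      show "\<exists>q\<in>H. x - y = of_nat N * q" using q(1) by (auto simp: y_def)
    qed (use zgroup_mono[OF H(1)] H x0 yH in auto)
    moreover have "(\<lambda>e. b0 e + of_int r) \<in> C"
      using b0(1) q(2,3) by (force simp: C_def)
    ultimately show ?thesis
      using x(2) y dy b0(2) by (intro bexI[of _ "\<lambda>e. b0 e + of_int r"] bexI[of _ y]) auto
  qed
  moreover have "finite C" using B by (simp add: C_def B'_def)
  moreover have "linform b" if "b \<in> C" for b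
    using that lin linform_add[OF _ linform_of_int] by (auto simp: C_def)
  ultimately show ?thesis using d(1)
    by (intro exI[of _ d] exI[of _ "d * N"] exI[of _ C] conjI ballI allI impI) (simp | elim bexE)+
qed

lemma nonneg_dvd_iff:
  assumes "0 < d"
  shows "(\<exists>x\<in>nonneg H. of_nat d * x = b) \<longleftrightarrow> 0 \<le> b \<and> (\<exists>q\<in>H. b = of_nat d * q)"
  using assms by (auto simp: nonneg_def zero_le_mult_iff)

text \<open>The quantifier becomes a finite disjunction over the candidates \<open>b e / d\<close>;
  that such a quotient exists in \<open>nonneg H\<close> is a sign condition and a divisibility
  atom.\<close>

lemma qfree_eliminate:
  assumes "qfree P"
  shows "\<exists>K Q. qfree Q \<and> (\<forall>H e. zgroup K H \<longrightarrow> range e \<subseteq> H \<longrightarrow>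
    Q H e = (\<exists>x\<in>nonneg H. P H (e(v := x))))"
proof -
  obtain d K C where d: "0 < d" and C: "finite C" "\<And>b. b \<in> C \<Longrightarrow> linform b"
    and wit: "\<And>H e. zgroup K H \<Longrightarrow> range e \<subseteq> H \<Longrightarrow> (\<exists>x\<in>nonneg H. P H (e(v := x))) \<Longrightarrow>
       (\<exists>b\<in>C. \<exists>x\<in>nonneg H. of_nat d * x = b e \<and> P H (e(v := x)))"
    using qfree_witness[OF assms, of v] by metis
  have "\<forall>b\<in>C. \<exists>Q. qfree Q \<and> (\<forall>H e x. of_nat d * x = b e \<longrightarrow> P H (e(v := x)) = Q H e)"
    using qfree_subst_quotient[OF assms d C(2)] by blast
  then obtain S where S: "\<And>b. b \<in> C \<Longrightarrow> qfree (S b)"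
      "\<And>b H e x. b \<in> C \<Longrightarrow> of_nat d * x = b e \<Longrightarrow> P H (e(v := x)) = S b H e"
    by metis
  define Q where "Q = (\<lambda>H e. \<exists>b\<in>C. (0 \<le> b e \<and> (\<exists>q\<in>H. b e = of_nat d * q)) \<and> S b H e)"
  have "qfree Q"
    unfolding Q_def using C(2) d S(1) by (intro qfree_bex[OF C(1)] qfree_conj[OF qfree_conj[OF qfree_nonneg qfree_dvd] S(1)])
  moreover have "Q H e = (\<exists>x\<in>nonneg H. P H (e(v := x)))"
    if He: "zgroup K H" "range e \<subseteq> H" for H e
  proof
    assume "Q H e"
    then obtain b where b: "b \<in> C" "0 \<le> b e \<and> (\<exists>q\<in>H. b e = of_nat d * q)" "S b H e"
      unfolding Q_def by blast
    then obtain x where "x \<in> nonneg H" "of_nat d * x = b e"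
      using nonneg_dvd_iff[OF d] by blast
    with b show "\<exists>x\<in>nonneg H. P H (e(v := x))" using S(2) by blast
  next
    assume "\<exists>x\<in>nonneg H. P H (e(v := x))"
    then obtain b x where b: "b \<in> C" "x \<in> nonneg H" "of_nat d * x = b e" "P H (e(v := x))"
      using wit[OF He] by blast
    then show "Q H e"
      unfolding Q_def using nonneg_dvd_iff[OF d, of H "b e"] S(2) by blast
  qed
  ultimately show ?thesis by blast
qed

section \<open>Uniformly definable relations\<close>

text \<open>The threshold \<open>K\<close> belongs to the predicate, so every logical operation may
  raise it; a formula has finitely many operations, so some finite threshold always
  suffices.\<close>

definition definable :: "('r::linordered_idom set \<Rightarrow> ('i \<Rightarrow> 'r) \<Rightarrow> bool) \<Rightarrow> bool" where
  "definable P \<longleftrightarrow> (\<exists>K Q. qfree Q \<and>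
     (\<forall>H e. zgroup K H \<longrightarrow> range e \<subseteq> nonneg H \<longrightarrow> P H e = Q H e))"

lemma definableI:
  assumes "qfree Q" "\<And>H e. zgroup K H \<Longrightarrow> range e \<subseteq> nonneg H \<Longrightarrow> P H e = Q H e"
  shows "definable P"
  unfolding definable_def using assms by blast

lemma definableE:
  assumes "definable P"
  obtains K Q where "qfree Q" "\<And>H e. zgroup K H \<Longrightarrow> range e \<subseteq> nonneg H \<Longrightarrow> P H e = Q H e"
  using assms unfolding definable_def by metis

lemma definable_cong:
  assumes "definable P" "\<And>H e. zgroup K H \<Longrightarrow> range e \<subseteq> nonneg H \<Longrightarrow> Q H e = P H e"
  shows "definable Q"
  using assms(1)
proof (rule definableE)
  fix L R assume R: "qfree R" "\<And>H e. zgroup L H \<Longrightarrow> range e \<subseteq> nonneg H \<Longrightarrow> P H e = R H e"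
  show ?thesis
  proof (rule definableI[OF R(1)])
    fix H :: "'a set" and e :: "'b \<Rightarrow> 'a"
    assume z: "zgroup (max K L) H" and e: "range e \<subseteq> nonneg H"
    show "Q H e = R H e"
      using assms(2)[OF zgroup_mono[OF z max.cobounded1] e] R(2)[OF zgroup_mono[OF z max.cobounded2] e]
      by simp
  qed
qed

lemma definable_neg: "definable P \<Longrightarrow> definable (\<lambda>H e. \<not> P H e)"
  by (erule definableE, rule definableI, erule qfree_neg) auto

lemma definable_conj:
  assumes "definable P" "definable Q"
  shows "definable (\<lambda>H e. P H e \<and> Q H e)"
  using assms(1)
proof (rule definableE)
  fix K R assume R: "qfree R" "\<And>H e. zgroup K H \<Longrightarrow> range e \<subseteq> nonneg H \<Longrightarrow> P H e = R H e"
  show ?thesis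
    using assms(2)
  proof (rule definableE)
    fix L S assume S: "qfree S" "\<And>H e. zgroup L H \<Longrightarrow> range e \<subseteq> nonneg H \<Longrightarrow> Q H e = S H e"
    show ?thesis
    proof (rule definableI[OF qfree_conj[OF R(1) S(1)]])
      fix H :: "'a set" and e :: "'b \<Rightarrow> 'a"
    assume z: "zgroup (max K L) H" and e: "range e \<subseteq> nonneg H"
      show "(P H e \<and> Q H e) = (R H e \<and> S H e)"
        using R(2)[OF zgroup_mono[OF z max.cobounded1] e] S(2)[OF zgroup_mono[OF z max.cobounded2] e]
        by simp
    qed
  qed
qed

lemma definable_imp: "definable P \<Longrightarrow> definable Q \<Longrightarrow> definable (\<lambda>H e. P H e \<longrightarrow> Q H e)"
  using definable_neg[OF definable_conj[OF _ definable_neg], of P Q] by simp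

lemma definable_ex_upd:
  assumes "definable P"
  shows "definable (\<lambda>H e. \<exists>x\<in>nonneg H. P H (e(v := x)))"
  using assms
proof (rule definableE)
  fix K R assume R: "qfree R" "\<And>H e. zgroup K H \<Longrightarrow> range e \<subseteq> nonneg H \<Longrightarrow> P H e = R H e"
  obtain L Q where Q: "qfree Q"
    "\<And>H e. zgroup L H \<Longrightarrow> range e \<subseteq> H \<Longrightarrow> Q H e = (\<exists>x\<in>nonneg H. R H (e(v := x)))"
    using qfree_eliminate[OF R(1), of v] by metis
  show ?thesis
  proof (rule definableI[OF Q(1), of "max K L"])
    fix H and e :: "'b \<Rightarrow> 'a" assume H: "zgroup (max K L) H" and e: "range e \<subseteq> nonneg H"
    have "P H (e(v := x)) = R H (e(v := x))" if "x \<in> nonneg H" for x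
      using e that by (intro R(2) zgroup_mono[OF H]) auto
    moreover have "range e \<subseteq> H" using e by (auto simp: nonneg_def)
    ultimately show "(\<exists>x\<in>nonneg H. P H (e(v := x))) = Q H e"
      using Q(2)[OF zgroup_mono[OF H]] by simp
  qed
qed

text \<open>Definable predicates are controlled only on nonnegative environments, so terms to be
  substituted must not leave \<open>nonneg H\<close>.\<close>

definition linterm :: "(('i \<Rightarrow> 'r::linordered_idom) \<Rightarrow> 'r) \<Rightarrow> bool" where
  "linterm s \<longleftrightarrow> linform s \<and> (\<forall>H e. zgroup 0 H \<longrightarrow> range e \<subseteq> nonneg H \<longrightarrow> s e \<in> nonneg H)"

lemma linterm_var: "linterm (\<lambda>e. e i)"
  unfolding linterm_def by (auto intro: linform_var)

lemma linterm_zero: "linterm (\<lambda>e. 0)"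
  unfolding linterm_def by (auto intro: linform_zero nonneg_zero)

lemma linterm_one: "linterm (\<lambda>e. 1)"
  unfolding linterm_def by (auto intro: linform_one nonneg_one)

lemma linterm_add: "linterm s \<Longrightarrow> linterm t \<Longrightarrow> linterm (\<lambda>e. s e + t e)"
  unfolding linterm_def by (blast intro: linform_add nonneg_add)

lemma linterm_of_nat_mult: "linterm s \<Longrightarrow> linterm (\<lambda>e. of_nat n * s e)"
  by (induction n) (auto simp: algebra_simps linterm_zero intro: linterm_add)

lemma linterm_of_nat: "linterm (\<lambda>e. of_nat n)"
  using linterm_of_nat_mult[OF linterm_one, of n] by simp

lemma definable_le:
  assumes "linterm s" "linterm t"
  shows "definable (\<lambda>H e. s e \<le> t e)"
  using qfree_neg[OF qfree_pos[OF linform_diff[of s t]]] assms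
  by (intro definableI[of "\<lambda>H e. \<not> 0 < s e - t e"]) (auto simp: linterm_def)

lemma definable_eq:
  assumes "linterm s" "linterm t"
  shows "definable (\<lambda>H e. s e = t e)"
  using definable_conj[OF definable_le[OF assms] definable_le[OF assms(2,1)]]
  by (simp add: eq_iff)

lemma definable_subst:
  assumes "definable P" "\<And>j. linterm (t j)"
  shows "definable (\<lambda>H e. P H (\<lambda>j. t j e))"
  using assms(1)
proof (rule definableE)
  fix K Q assume Q: "qfree Q" "\<And>H e. zgroup K H \<Longrightarrow> range e \<subseteq> nonneg H \<Longrightarrow> P H e = Q H e"
  have "range (\<lambda>j. t j e) \<subseteq> nonneg H" if "zgroup K H" "range e \<subseteq> nonneg H" for H e
    using assms(2) that zgroup_mono[OF that(1), of 0] by (auto simp: linterm_def)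
  then have "P H (\<lambda>j. t j e) = Q H (\<lambda>j. t j e)" if "zgroup K H" "range e \<subseteq> nonneg H" for H e
    using that Q(2) by simp
  moreover have "qfree (\<lambda>H e. Q H (\<lambda>j. t j e))"
    using assms(2) by (intro qfree_subst[OF Q(1)]) (simp add: linterm_def)
  ultimately show ?thesis
    by (rule definableI[rotated])
qed

definition Vec :: "nat \<Rightarrow> 'r::linordered_idom set \<Rightarrow> 'r list set" where
  "Vec m H = {x. length x = m \<and> set x \<subseteq> nonneg H}"

text \<open>A quantifier enlarges the index type: \<open>None\<close> is the bound variable and
  \<open>Some\<close> embeds the old ones, so bodies of formulas can be written as functions without
  choosing fresh variables.\<close>

lemma definable_ex:
  fixes P :: "'r::linordered_idom set \<Rightarrow> ('i \<Rightarrow> 'r) \<Rightarrow> 'r \<Rightarrow> bool"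
  assumes "definable (\<lambda>H e. P H (\<lambda>i. e (Some i)) (e None))"
  shows "definable (\<lambda>H e. \<exists>x\<in>nonneg H. P H e x)"
proof -
  define t :: "'i option \<Rightarrow> ('i \<Rightarrow> 'r) \<Rightarrow> 'r"
    where "t = (\<lambda>j e. case j of None \<Rightarrow> 0 | Some i \<Rightarrow> e i)"
  have "linterm (t j)" for j
    by (cases j) (auto simp: t_def linterm_zero linterm_var)
  from definable_subst[where t = t, OF definable_ex_upd[OF assms, of None] this]
  show ?thesis by (simp add: t_def)
qed

lemma definable_ex_Vec:
  fixes P :: "'r::linordered_idom set \<Rightarrow> ('i \<Rightarrow> 'r) \<Rightarrow> 'r list \<Rightarrow> bool"
  assumes "definable (\<lambda>H e. P H (\<lambda>i. e (Inl i)) (map (\<lambda>i. e (Inr i)) [0..<m]))"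
  shows "definable (\<lambda>H e. \<exists>v\<in>Vec m H. P H e v)"
proof -
  \<comment> \<open>\<open>upd k e v\<close> overwrites the first \<open>k\<close> bound
    coordinates; the induction on \<open>k\<close> adds one scalar quantifier at a time, for the
    last coordinate.\<close>
  define upd :: "nat \<Rightarrow> ('i + nat \<Rightarrow> 'r) \<Rightarrow> 'r list \<Rightarrow> 'i + nat \<Rightarrow> 'r"
    where "upd = (\<lambda>k e v j. case j of Inl i \<Rightarrow> e j | Inr n \<Rightarrow> if n < k then v ! n else e j)"
  define t :: "'i + nat \<Rightarrow> ('i \<Rightarrow> 'r) \<Rightarrow> 'r"
    where "t = (\<lambda>j e. case j of Inr n \<Rightarrow> 0 | Inl i \<Rightarrow> e i)"
  have upd_Suc: "upd (Suc k) e (v @ [x]) = upd k (e(Inr k := x)) v" if "length v = k" for k e v x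
    using that by (auto simp: upd_def fun_eq_iff nth_append less_Suc_eq split: sum.split)
  have Vec_Suc: "(\<exists>v\<in>Vec (Suc k) H. R v) \<longleftrightarrow> (\<exists>x\<in>nonneg H. \<exists>v\<in>Vec k H. R (v @ [x]))" for k H R
  proof safe
    fix v assume "v \<in> Vec (Suc k) H" "R v"
    then show "\<exists>x\<in>nonneg H. \<exists>v\<in>Vec k H. R (v @ [x])"
      by (cases v rule: rev_cases) (auto simp: Vec_def)
  next
    fix x v assume "x \<in> nonneg H" "v \<in> Vec k H" "R (v @ [x])"
    then show "\<exists>v\<in>Vec (Suc k) H. R v"
      by (intro bexI[of _ "v @ [x]"]) (auto simp: Vec_def)
  qed
  have *: "definable (\<lambda>H e. \<exists>v\<in>Vec k H. Q H (upd k e v))" if "definable Q" for k Q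
    using that
  proof (induction k)
    case 0
    then show ?case
      by (rule definable_cong[where K = 0]) (auto simp: Vec_def upd_def split: sum.split intro!: arg_cong2[of _ _ _ _ Q])
  next
    case (Suc k)
    show ?case
      by (rule definable_cong[OF definable_ex_upd[OF Suc.IH[OF Suc.prems], of "Inr k"], of 0])
        (subst Vec_Suc, auto simp: upd_Suc Vec_def simp del: fun_upd_apply)
  qed
  have "linterm (t j)" for j
    by (cases j) (auto simp: t_def linterm_zero linterm_var)
  from definable_subst[where t = t, OF *[OF assms, of m] this]
  have D: "definable (\<lambda>H e. \<exists>v\<in>Vec m H. P H e (map (\<lambda>i. upd m (\<lambda>j. t j e) v (Inr i)) [0..<m]))"
    by (simp add: upd_def t_def)
  have "map (\<lambda>i. upd m (\<lambda>j. t j e) v (Inr i)) [0..<m] = v" if "v \<in> Vec m H" for e v H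
    using that by (auto simp: Vec_def upd_def intro: nth_equalityI)
  then show ?thesis
    by (intro definable_cong[OF D, of 0]) auto
qed

lemma definable_all:
  "definable (\<lambda>H e. P H (\<lambda>i. e (Some i)) (e None)) \<Longrightarrow> definable (\<lambda>H e. \<forall>x\<in>nonneg H. P H e x)"
  using definable_neg[OF definable_ex[OF definable_neg]] by fastforce

lemma definable_all_Vec:
  "definable (\<lambda>H e. P H (\<lambda>i. e (Inl i)) (map (\<lambda>i. e (Inr i)) [0..<m])) \<Longrightarrow>
   definable (\<lambda>H e. \<forall>v\<in>Vec m H. P H e v)"
  using definable_neg[OF definable_ex_Vec[OF definable_neg]] by fastforce

lemma definable_const: "definable (\<lambda>H e. c)"
  using definable_le[OF linterm_zero linterm_zero] definable_neg[OF definable_le[OF linterm_zero linterm_zero]]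
  by (cases c) auto

lemma definable_all_less:
  fixes P :: "nat \<Rightarrow> 'r::linordered_idom set \<Rightarrow> ('i \<Rightarrow> 'r) \<Rightarrow> bool"
  assumes "\<And>i. i < n \<Longrightarrow> definable (P i)"
  shows "definable (\<lambda>H e. \<forall>i<n. P i H e)"
  using assms
  by (induction n) (auto simp: definable_const less_Suc_eq all_conj_distrib
        intro!: definable_conj)

section \<open>Terms and relations with vector arguments\<close>

definition vecterm :: "nat \<Rightarrow> (('i \<Rightarrow> 'r::linordered_idom) \<Rightarrow> 'r list) \<Rightarrow> bool" where
  "vecterm m v \<longleftrightarrow> (\<forall>e. length (v e) = m) \<and> (\<forall>i<m. linterm (\<lambda>e. v e ! i))"

lemma vecterm_var: "vecterm m (\<lambda>e. map (\<lambda>i. e (f i)) [0..<m])"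
  unfolding vecterm_def by (auto intro: linterm_var)

lemma vecterm_const: "length v = m \<Longrightarrow> set v \<subseteq> range of_nat \<Longrightarrow> vecterm m (\<lambda>e. v)"
  unfolding vecterm_def by (auto, metis linterm_of_nat nth_mem rangeE subset_iff)

abbreviation var_vec :: "nat \<Rightarrow> nat \<Rightarrow> (nat \<times> nat \<Rightarrow> 'r) \<Rightarrow> 'r list" where
  "var_vec m j \<equiv> (\<lambda>e. map (\<lambda>i. e (j, i)) [0..<m])"

lemma definable_subst_vec:
  fixes vs :: "nat \<Rightarrow> ('i \<Rightarrow> 'r::linordered_idom) \<Rightarrow> 'r list"
  assumes "definable P" and "\<And>j. vecterm m (vs j)"
  shows "definable (\<lambda>H e. P H (\<lambda>(j, i). if i < m then vs j e ! i else 0))"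
proof -
  have "linterm (\<lambda>e. case ji of (j, i) \<Rightarrow> if i < m then vs j e ! i else 0)" for ji
    using assms(2) by (cases ji; cases "snd ji < m") (auto simp: vecterm_def linterm_zero)
  from definable_subst[where t = "\<lambda>ji e. case ji of (j, i) \<Rightarrow> if i < m then vs j e ! i else 0", OF assms(1) this]
  show ?thesis .
qed

text \<open>A normal form in which the arguments are the rows 0, 1, 2 of a doubly indexed
  environment. Definability is proved once in this layout and then moved by \<open>vecrel1D\<close>,
  \<open>vecrel2D\<close>, \<open>vecrel3D\<close> to arbitrary vector terms over any index type, in
  particular below quantifiers.\<close>

definition vecrel1 where
  "vecrel1 m P \<longleftrightarrow> definable (\<lambda>H (e :: nat \<times> nat \<Rightarrow> 'r::linordered_idom). P H (var_vec m 0 e))"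
definition vecrel2 where
  "vecrel2 m P \<longleftrightarrow> definable (\<lambda>H (e :: nat \<times> nat \<Rightarrow> 'r::linordered_idom).
     P H (var_vec m 0 e) (var_vec m 1 e))"
definition vecrel3 where
  "vecrel3 m P \<longleftrightarrow> definable (\<lambda>H (e :: nat \<times> nat \<Rightarrow> 'r::linordered_idom).
     P H (var_vec m 0 e) (var_vec m 1 e) (var_vec m 2 e))"

lemma map_nth_upt: "length v = m \<Longrightarrow> map (\<lambda>i. if i < m then v ! i else 0) [0..<m] = v"
  by (auto intro: nth_equalityI)

lemma vecrel3D:
  assumes "vecrel3 m P" "vecterm m x" "vecterm m y" "vecterm m z"
  shows "definable (\<lambda>H e. P H (x e) (y e) (z e))"
proof -
  let ?vs = "\<lambda>j::nat. if j = 0 then x else if j = 1 then y else z"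
  have "vecterm m (?vs j)" for j using assms by simp
  from definable_subst_vec[where vs = ?vs, OF assms(1)[unfolded vecrel3_def] this] assms show ?thesis
    by (simp add: map_nth_upt vecterm_def)
qed

lemma vecrel2D:
  assumes "vecrel2 m P" "vecterm m x" "vecterm m y"
  shows "definable (\<lambda>H e. P H (x e) (y e))"
proof -
  let ?vs = "\<lambda>j::nat. if j = 0 then x else y"
  have "vecterm m (?vs j)" for j using assms by simp
  from definable_subst_vec[where vs = ?vs, OF assms(1)[unfolded vecrel2_def] this] assms show ?thesis
    by (simp add: map_nth_upt vecterm_def)
qed

lemma vecrel1D:
  assumes "vecrel1 m P" "vecterm m x"
  shows "definable (\<lambda>H e. P H (x e))"
  using definable_subst_vec[where vs = "\<lambda>_. x", OF assms(1)[unfolded vecrel1_def]] assms(2)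
  by (simp add: map_nth_upt vecterm_def)

section \<open>Definable relations over the natural numbers\<close>

definition eventually_periodic :: "(nat \<Rightarrow> bool) \<Rightarrow> bool" where
  "eventually_periodic p \<longleftrightarrow> (\<exists>N>0. \<exists>k0. \<forall>k\<ge>k0. p k = p (k + N))"

lemma periodic_mult:
  fixes p :: "nat \<Rightarrow> bool"
  assumes "\<And>k. k0 \<le> k \<Longrightarrow> p k = p (k + N)" "k0 \<le> k"
  shows "p k = p (k + N * M)"
proof (induction M)
  case (Suc M)
  then show ?case using assms(1)[of "k + N * M"] assms(2) by (simp add: algebra_simps)
qed simp

lemma eventually_periodic_common:
  assumes "finite S" "\<And>d. d \<in> S \<Longrightarrow> eventually_periodic (p d)"
  shows "\<exists>N>0. \<exists>k0. \<forall>d\<in>S. \<forall>k\<ge>k0. p d k = p d (k + N)"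
  using assms
proof (induction rule: finite_induct)
  case empty
  show ?case by auto
next
  case (insert d S)
  obtain N k where N: "0 < N" "\<And>d' j. d' \<in> S \<Longrightarrow> k \<le> j \<Longrightarrow> p d' j = p d' (j + N)"
    using insert.IH[OF insert.prems] by blast
  obtain M l where M: "0 < M" "\<And>j. l \<le> j \<Longrightarrow> p d j = p d (j + M)"
    using insert.prems[of d] unfolding eventually_periodic_def by auto
  show ?case
  proof (rule exI[of _ "N * M"], rule conjI[OF _ exI[of _ "max k l"]], simp add: N M, intro ballI allI impI)
    fix d' j assume that: "d' \<in> insert d S" "max k l \<le> j"
    show "p d' j = p d' (j + N * M)"
    proof (cases "d' = d")
      case True
      have "p d j = p d (j + M * N)"
        using that(2) by (intro periodic_mult[of l "p d" M, OF M(2)]) auto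
      then show ?thesis by (simp only: True mult.commute)
    next
      case False
      with that have "d' \<in> S" "k \<le> j" by auto
      then show ?thesis using periodic_mult[of k "p d'" N, OF N(2)] by blast
    qed
  qed
qed

lemma eventually_periodic_conj:
  assumes "eventually_periodic p" "eventually_periodic q"
  shows "eventually_periodic (\<lambda>k. p k \<and> q k)"
proof -
  have "\<exists>N>0. \<exists>k0. \<forall>d\<in>UNIV. \<forall>k\<ge>k0. (if d then p else q) k = (if d then p else q) (k + N)"
    using assms by (intro eventually_periodic_common) auto
  then show ?thesis
    unfolding eventually_periodic_def by (simp add: UNIV_bool) metis
qed

section \<open>Predicates along rays of the natural numbers and on standard integers\<close>

lemma linform_ray:
  assumes "linform s"
  shows "\<exists>b c::int. \<forall>R. s (\<lambda>i. of_nat (a i) * of_nat R) = of_int b * of_nat R + of_int c"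
  using assms
proof (induction rule: linform.induct)
  case (linform_var i)
  show ?case by (intro exI[of _ "int (a i)"] exI[of _ 0]) simp
next
  case linform_one
  show ?case by (intro exI[of _ 0] exI[of _ 1]) simp
next
  case (linform_diff s t)
  then obtain b c b' c' where
    "\<forall>R. s (\<lambda>i. of_nat (a i) * of_nat R) = of_int b * of_nat R + of_int c"
    "\<forall>R. t (\<lambda>i. of_nat (a i) * of_nat R) = of_int b' * of_nat R + of_int c'" by blast
  then show ?case by (intro exI[of _ "b - b'"] exI[of _ "c - c'"]) (simp add: algebra_simps)
qed

text \<open>No group gains divisibilities between standard integers: dividing with remainder leaves
  \<open>n * (q - t) = r\<close> with \<open>0 \<le> r < n\<close>, and a positive
  \<open>q - t\<close> would be at least 1.\<close>

lemma of_int_dvd_in_zgroup: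
  assumes "zgroup 0 H" "0 < n"
  shows "(\<exists>q\<in>H. (of_int k :: 'r::linordered_idom) = of_nat n * q) \<longleftrightarrow> int n dvd k"
proof
  assume "\<exists>q\<in>H. (of_int k :: 'r) = of_nat n * q"
  then obtain q where q: "q \<in> H" "(of_int k :: 'r) = of_nat n * q" by blast
  define t where "t = k div int n"
  define r where "r = k mod int n"
  have k: "k = int n * t + r" and r: "0 \<le> r" "r < int n"
    using assms by (simp_all add: t_def r_def)
  have qt: "q - of_int t \<in> H" using assms(1) q(1) by (intro zgroup_diff zgroup_of_int)
  have eq: "of_nat n * (q - of_int t) = (of_int r :: 'r)"
    using q(2) unfolding k by (simp add: algebra_simps)
  have "\<not> 0 < q - of_int t"
  proof
    assume "0 < q - of_int t"
    then have "1 \<le> q - of_int t" using zgroup_discrete[OF assms(1) qt] by simp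
    then have "of_nat n * 1 \<le> of_nat n * (q - of_int t)" by (intro mult_left_mono) auto
    then have "(of_int (int n) :: 'r) \<le> of_int r" using eq by simp
    with r show False by (simp only: of_int_le_iff)
  qed
  then have "of_nat n * (q - of_int t) \<le> 0" using assms(2) by (simp add: mult_le_0_iff)
  then have "r \<le> 0" unfolding eq by simp
  then show "int n dvd k" using k r by simp
next
  assume "int n dvd k"
  then obtain t where "k = int n * t" by blast
  then show "\<exists>q\<in>H. (of_int k :: 'r) = of_nat n * q"
    using zgroup_of_int[OF assms(1), of t] by (intro bexI[of _ "of_int t"]) auto
qed

text \<open>Along a ray a sign atom is eventually constant and a divisibility atom is periodic with
  its modulus.\<close>

lemma qfree_eventually_periodic:
  fixes P :: "'r::linordered_idom set \<Rightarrow> ('i \<Rightarrow> 'r) \<Rightarrow> bool"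
  assumes "qfree P"
  shows "eventually_periodic (\<lambda>R. P \<int> (\<lambda>i. of_nat (a i) * of_nat R))"
  using assms
proof (induction rule: qfree.induct)
  case (qfree_pos s)
  then obtain b c :: int where s: "\<And>R. s (\<lambda>i. of_nat (a i) * of_nat R) = of_int b * of_nat R + of_int c"
    using linform_ray by metis
  have eq: "0 < s (\<lambda>i. of_nat (a i) * of_nat R) \<longleftrightarrow> 0 < b * int R + c" for R
  proof -
    have "of_int b * of_nat R + of_int c = (of_int (b * int R + c) :: 'r)" by simp
    then show ?thesis unfolding s by (simp only: of_int_0_less_iff)
  qed
  \<comment> \<open>Beyond \<open>\<bar>c\<bar>\<close> the sign of \<open>b * R + c\<close> is that
    of \<open>b\<close>, unless \<open>b\<close> is 0 and nothing depends on
    \<open>R\<close>.\<close>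
  have "(0 < b * int R + c) = (0 < b * int (R + 1) + c)" if R: "nat \<bar>c\<bar> + 1 \<le> R" for R
  proof -
    consider "b = 0" | "1 \<le> b" | "b \<le> -1" by linarith
    then show ?thesis
    proof cases
      case 2
      then have "1 * int R \<le> b * int R" by (intro mult_right_mono) auto
      then show ?thesis using R 2 unfolding of_nat_add of_nat_1 distrib_left by linarith
    next
      case 3
      then have "b * int R \<le> (-1) * int R" by (intro mult_right_mono) auto
      then show ?thesis using R 3 unfolding of_nat_add of_nat_1 distrib_left by linarith
    qed simp
  qed
  then show ?case unfolding eventually_periodic_def eq by (intro exI[of _ 1]) auto
next
  case (qfree_dvd s n)
  then obtain b c :: int where s: "\<And>R. s (\<lambda>i. of_nat (a i) * of_nat R) = of_int b * of_nat R + of_int c"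
    using linform_ray by metis
  have eq: "(\<exists>q\<in>\<int>. s (\<lambda>i. of_nat (a i) * of_nat R) = of_nat n * q) \<longleftrightarrow> int n dvd b * int R + c" for R
  proof -
    have c: "of_int b * of_nat R + of_int c = (of_int (b * int R + c) :: 'r)" by simp
    show ?thesis
      unfolding s c by (rule of_int_dvd_in_zgroup[OF zgroup_Ints \<open>0 < n\<close>])
  qed
  have "b * int (R + n) + c = b * int R + c + int n * b" for R
    by (simp add: algebra_simps)
  then have "int n dvd b * int (R + n) + c \<longleftrightarrow> int n dvd b * int R + c" for R
    by (simp only: dvd_add_left_iff dvd_triv_left)
  then show ?case
    unfolding eventually_periodic_def eq using qfree_dvd(2) by (intro exI[of _ n]) auto
next
  case (qfree_neg P)
  then show ?case by (simp add: eventually_periodic_def)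
next
  case (qfree_conj P Q)
  then show ?case by (intro eventually_periodic_conj)
qed

lemma range_of_nat_subset_nonneg_Ints: "(\<And>i. e i \<in> range of_nat) \<Longrightarrow> range e \<subseteq> nonneg \<int>"
  by (auto simp: nonneg_Ints)

lemma definable_eventually_periodic:
  assumes "definable P"
  shows "eventually_periodic (\<lambda>R. P \<int> (\<lambda>i. of_nat (a i) * of_nat R))"
  using assms
proof (rule definableE)
  fix K Q assume Q: "qfree Q" "\<And>H e. zgroup K H \<Longrightarrow> range e \<subseteq> nonneg H \<Longrightarrow> P H e = Q H e"
  have "P \<int> (\<lambda>i. of_nat (a i) * of_nat R) = Q \<int> (\<lambda>i. of_nat (a i) * of_nat R)" for R
    by (intro Q(2) zgroup_Ints range_of_nat_subset_nonneg_Ints) (simp flip: of_nat_mult)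
  then show ?thesis using qfree_eventually_periodic[OF Q(1), of a] by simp
qed

text \<open>At the zero environment all affine forms take standard integer values, and atoms about
  standard integers have the same truth value in every group. Sentences are compared with the
  integers in this way.\<close>

lemma definable_transfer:
  fixes P :: "'r::linordered_idom set \<Rightarrow> ('i \<Rightarrow> 'r) \<Rightarrow> bool"
  assumes "definable P"
  shows "\<exists>K. \<forall>H. zgroup K H \<longrightarrow> P H (\<lambda>_. 0) = P \<int> (\<lambda>_. 0)"
  using assms
proof (rule definableE)
  fix K Q assume Q: "qfree Q"
    "\<And>H (e :: 'i \<Rightarrow> 'r). zgroup K H \<Longrightarrow> range e \<subseteq> nonneg H \<Longrightarrow> P H e = Q H e"
  have c: "\<exists>c::int. s (\<lambda>_. 0) = of_int c" if "linform s" for s :: "('i \<Rightarrow> 'r) \<Rightarrow> 'r"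
    using linform_ray[OF that, of "\<lambda>_. 0"] by (metis add_0 mult_zero_left mult_zero_right of_nat_0)
  have "Q H (\<lambda>_. 0) = Q \<int> (\<lambda>_. 0)" if "zgroup 0 H" for H
    using Q(1)
  proof (induction rule: qfree.induct)
    case (qfree_dvd s n)
    then show ?case
      using c[of s] of_int_dvd_in_zgroup[OF that] of_int_dvd_in_zgroup[OF zgroup_Ints] by metis
  qed auto
  moreover have "range (\<lambda>_ :: 'i. 0 :: 'r) \<subseteq> nonneg H" if "zgroup K H" for H
    using nonneg_zero[OF that] by auto
  ultimately have "P H (\<lambda>_. 0) = P \<int> (\<lambda>_. 0)" if "zgroup K H" for H
    using that Q(2)[of H "\<lambda>_. 0"] Q(2)[of \<int> "\<lambda>_. 0"] zgroup_mono[OF that, of 0] zgroup_Ints[where 'r = 'r, of K]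
    by simp
  then show ?thesis by blast
qed

section \<open>Relations between a parameter R (index \<open>False\<close>) and a value r (index
  \<open>True\<close>) over the natural numbers\<close>

definition pair_env :: "nat \<Rightarrow> nat \<Rightarrow> bool \<Rightarrow> 'r::linordered_idom" where
  "pair_env R r = (\<lambda>b. of_nat (if b then r else R))"

text \<open>Cooper's candidates, read over the natural numbers, are finitely many rational lines in
  \<open>R\<close>. For the graph of a function this says that each point lies on one of these
  lines.\<close>

lemma definable_pair_witness:
  fixes P :: "'r::linordered_idom set \<Rightarrow> (bool \<Rightarrow> 'r) \<Rightarrow> bool"
  assumes "definable P"
  shows "\<exists>d>0. \<exists>S :: (int \<times> int) set. finite S \<and> (\<forall>R r. P \<int> (pair_env R r) \<longrightarrow>
    (\<exists>(b, c)\<in>S. \<exists>r'. int d * int r' = b * int R + c \<and> P \<int> (pair_env R r')))"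
  using assms
proof (rule definableE)
  fix K Q assume Q: "qfree Q"
    "\<And>H (e :: bool \<Rightarrow> 'r). zgroup K H \<Longrightarrow> range e \<subseteq> nonneg H \<Longrightarrow> P H e = Q H e"
  have PQ: "P \<int> (pair_env R r) = Q \<int> (pair_env R r)" for R r
    by (intro Q(2) zgroup_Ints range_of_nat_subset_nonneg_Ints) (simp add: pair_env_def)
  obtain d L C where d: "0 < d" and C: "finite C" "\<And>b. b \<in> C \<Longrightarrow> linform b"
    and wit: "\<And>H e. zgroup L H \<Longrightarrow> range e \<subseteq> H \<Longrightarrow> (\<exists>x\<in>nonneg H. Q H (e(True := x))) \<Longrightarrow>
       (\<exists>b\<in>C. \<exists>x\<in>nonneg H. of_nat d * x = b e \<and> Q H (e(True := x)))"
    using qfree_witness[OF Q(1), of True] by metis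
  \<comment> \<open>The eliminated coordinate is set to 0, so the candidates become affine functions
    of \<open>R\<close> alone.\<close>
  have upd: "(pair_env R 0)(True := of_nat r) = (pair_env R r :: bool \<Rightarrow> 'r)" for R r
    by (auto simp: pair_env_def)
  have env: "pair_env R 0 = (\<lambda>i. of_nat (if i then 0 else 1) * of_nat R :: 'r)" for R
    by (auto simp: pair_env_def)
  have "\<forall>s\<in>C. \<exists>bc :: int \<times> int. \<forall>R. s (pair_env R 0) = of_int (fst bc) * of_nat R + of_int (snd bc)"
    unfolding env using linform_ray[OF C(2), of _ "\<lambda>i. if i then 0 else 1"] by simp
  then obtain g :: "_ \<Rightarrow> int \<times> int" where
    g: "\<And>s R. s \<in> C \<Longrightarrow> s (pair_env R 0) = of_int (fst (g s)) * of_nat R + of_int (snd (g s))"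
    by metis
  have "\<exists>(b, c)\<in>g ` C. \<exists>r'. int d * int r' = b * int R + c \<and> P \<int> (pair_env R r')"
    if "P \<int> (pair_env R r)" for R r
  proof -
    have "\<exists>x\<in>nonneg \<int>. Q \<int> ((pair_env R 0)(True := x))"
      using that unfolding PQ nonneg_Ints by (intro bexI[of _ "of_nat r"]) (auto simp: upd)
    moreover have "range (pair_env R 0 :: bool \<Rightarrow> 'r) \<subseteq> \<int>" by (auto simp: pair_env_def)
    ultimately obtain s x where s: "s \<in> C" "x \<in> nonneg \<int>" "of_nat d * x = s (pair_env R 0)"
      "Q \<int> ((pair_env R 0)(True := x))"
      using wit[OF zgroup_Ints] by blast
    then obtain r' where r': "x = of_nat r'" unfolding nonneg_Ints by blast
    have "of_int (int d * int r') = (of_int (fst (g s) * int R + snd (g s)) :: 'r)"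
      using s(3) unfolding r' g[OF s(1)] by simp
    then have "int d * int r' = fst (g s) * int R + snd (g s)" by (simp only: of_int_eq_iff)
    moreover have "P \<int> (pair_env R r')" using s(4) unfolding PQ r' upd .
    ultimately show ?thesis using s(1) by (intro bexI[of _ "g s"]) (auto simp: case_prod_unfold)
  qed
  moreover have "finite (g ` C)" using C(1) by simp
  ultimately show ?thesis
    by (intro exI[of _ d] exI[of _ "g ` C"] conjI allI impI d) simp_all
qed

text \<open>The finitely many lines have a common linear bound. The relation need not be functional;
  only some value is bounded.\<close>

lemma definable_linear_bound:
  assumes "definable P" "\<And>R. \<exists>r. P \<int> (pair_env R r)"
  obtains C where "\<And>R. \<exists>r\<le>C * R + C. P \<int> (pair_env R r)"
proof -
  from definable_pair_witness[OF assms(1)] obtain d and S :: "(int \<times> int) set"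
    where d: "0 < d" and S: "finite S"
      and wit: "\<forall>R r. P \<int> (pair_env R r) \<longrightarrow>
        (\<exists>(b, c)\<in>S. \<exists>r'. int d * int r' = b * int R + c \<and> P \<int> (pair_env R r'))"
    by (elim exE conjE)
  define C where "C = (\<Sum>(b, c)\<in>S. nat \<bar>b\<bar> + nat \<bar>c\<bar>)"
  have "\<exists>r\<le>C * R + C. P \<int> (pair_env R r)" for R
  proof -
    obtain b c r where r: "(b, c) \<in> S" "int d * int r = b * int R + c" "P \<int> (pair_env R r)"
      using assms(2)[of R] wit by fast
    have bc: "nat \<bar>b\<bar> + nat \<bar>c\<bar> \<le> C"
      unfolding C_def using member_le_sum[OF r(1), of "\<lambda>(b, c). nat \<bar>b\<bar> + nat \<bar>c\<bar>"] S by auto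
    have "1 * int r \<le> int d * int r" using d by (intro mult_right_mono) auto
    also have "\<dots> \<le> \<bar>b\<bar> * int R + \<bar>c\<bar>"
      unfolding r(2) by (intro add_mono mult_right_mono) auto
    also have "\<dots> \<le> int C * int R + int C"
      using bc by (intro add_mono mult_right_mono) auto
    finally have "int r \<le> int (C * R + C)" by simp
    then show ?thesis using r(3) by (intro exI[of _ r]) (simp only: of_nat_le_iff)
  qed
  then show ?thesis using that by blast
qed

text \<open>The arguments at which \<open>f\<close> lies on a given line form an eventually periodic
  set. A line of positive slope met infinitely often is therefore met along a whole progression; if
  there is none, all but finitely many values lie on lines of slope at most 0.\<close>

lemma definable_bounded_or_linear:
  fixes P :: "'r::linordered_idom set \<Rightarrow> (bool \<Rightarrow> 'r) \<Rightarrow> bool" and f :: "nat \<Rightarrow> nat"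
  assumes P: "definable P" "\<And>R r. P \<int> (pair_env R r) \<longleftrightarrow> r = f R"
  shows "(\<exists>B. \<forall>R. f R \<le> B) \<or> (\<exists>N>0. \<exists>k0. \<exists>c>0. \<forall>k. k \<le> c * f (k0 + N * k))"
proof -
  from definable_pair_witness[OF P(1), unfolded P(2)] obtain d and S :: "(int \<times> int) set"
    where d: "0 < d" and S: "finite S"
      and "\<forall>R r. r = f R \<longrightarrow> (\<exists>(b, c)\<in>S. \<exists>r'. int d * int r' = b * int R + c \<and> r' = f R)"
    by (elim exE conjE)
  then have wit: "\<exists>(b, c)\<in>S. int d * int (f R) = b * int R + c" for R by simp
  have per: "eventually_periodic (\<lambda>R. int d * int (f R) = b * int R + c)" for b c
  proof -
    have lin: "linterm (\<lambda>e :: unit option \<Rightarrow> 'r. if i then e None else e (Some ()))" for i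
      by (cases i) (simp_all add: linterm_var)
    \<comment> \<open>Negative coefficients are moved to the other side of the equation, because
      terms must stay nonnegative.\<close>
    have "definable (\<lambda>H (e :: unit \<Rightarrow> 'r). \<exists>r\<in>nonneg H.
        of_nat d * r + (of_nat (nat (- b)) * e () + of_nat (nat (- c))) =
          of_nat (nat b) * e () + of_nat (nat c) \<and>
        P H (\<lambda>i. if i then r else e ()))" (is "definable ?Q")
      apply (intro definable_ex definable_conj definable_eq linterm_add linterm_of_nat_mult
          linterm_of_nat linterm_var)
      subgoal using definable_subst[where t = "\<lambda>i e. if i then e None else e (Some ())", OF P(1)]
        using lin by simp
      done
    from definable_eventually_periodic[OF this, of "\<lambda>_. 1"]
    have "eventually_periodic (\<lambda>R. ?Q \<int> (\<lambda>_. of_nat R))" unfolding of_nat_1 mult_1 .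
    moreover have "?Q \<int> (\<lambda>_. of_nat R) \<longleftrightarrow> int d * int (f R) = b * int R + c" for R
    proof -
      have eq: "of_nat d * of_nat r + (of_nat (nat (- b)) * of_nat R + of_nat (nat (- c))) =
          (of_nat (nat b) * of_nat R + of_nat (nat c) :: 'r) \<longleftrightarrow> int d * int r = b * int R + c" for r
      proof -
        have "(of_nat d * of_nat r + (of_nat (nat (- b)) * of_nat R + of_nat (nat (- c))) =
          (of_nat (nat b) * of_nat R + of_nat (nat c) :: 'r)) \<longleftrightarrow>
          int d * int r + (int (nat (- b)) * int R + int (nat (- c))) = int (nat b) * int R + int (nat c)"
          by (simp only: of_nat_eq_iff flip: of_nat_mult of_nat_add)
        also have "\<dots> \<longleftrightarrow> int d * int r = b * int R + c"
          by (cases "0 \<le> b"; cases "0 \<le> c") (auto simp: algebra_simps)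
        finally show ?thesis .
      qed
      have env: "(\<lambda>i. if i then of_nat r else of_nat R) = (pair_env R r :: bool \<Rightarrow> 'r)" for r
        by (auto simp: pair_env_def)
      show ?thesis unfolding nonneg_Ints bex_simps eq env P(2) by auto
    qed
    ultimately show ?thesis by simp
  qed
  show ?thesis
  proof (cases "\<exists>(b, c)\<in>S. 0 < b \<and> infinite {R. int d * int (f R) = b * int R + c}")
    case True
    then obtain b c where b: "0 < b" and inf: "infinite {R. int d * int (f R) = b * int R + c}" by auto
    obtain N k1 where N: "0 < N"
      "\<And>k. k1 \<le> k \<Longrightarrow> (int d * int (f k) = b * int k + c) = (int d * int (f (k + N)) = b * int (k + N) + c)"
      using per[of b c] unfolding eventually_periodic_def by blast
    \<comment> \<open>Starting the progression beyond \<open>\<bar>c\<bar>\<close> lets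
      \<open>k0\<close> absorb a negative intercept.\<close>
    obtain k0 where k0: "max k1 (nat \<bar>c\<bar>) \<le> k0" "int d * int (f k0) = b * int k0 + c"
      using inf[unfolded infinite_nat_iff_unbounded_le] by blast
    have "k \<le> d * f (k0 + N * k)" for k
    proof -
      define X where "X = int (k0 + N * k)"
      have "int d * int (f (k0 + N * k)) = b * X + c"
        using periodic_mult[of k1 "\<lambda>k. int d * int (f k) = b * int k + c" N k0 k] N(2) k0
        by (auto simp: X_def)
      moreover have "1 * X \<le> b * X"
        using b by (intro mult_right_mono) (auto simp: X_def)
      moreover have "int k + int k0 \<le> X"
        unfolding X_def using N(1) by (simp only: of_nat_le_iff flip: of_nat_add) simp
      moreover have "\<bar>c\<bar> \<le> int k0" using k0(1) by (simp add: nat_le_iff)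
      ultimately have "int k \<le> int d * int (f (k0 + N * k))" by linarith
      then show ?thesis by (simp only: of_nat_le_iff flip: of_nat_mult)
    qed
    then show ?thesis using N(1) d by blast
  next
    case False
    \<comment> \<open>The finite set of exceptions: arguments lying on a line of positive
      slope.\<close>
    define E where "E = (\<Union>(b, c)\<in>{(b, c)\<in>S. 0 < b}. {R. int d * int (f R) = b * int R + c})"
    have "finite E" 
    unfolding E_def using False by (intro finite_UN_I finite_subset[OF _ S]) auto
    define B where "B = Max (insert 0 (f ` E)) + (\<Sum>(b, c)\<in>S. nat \<bar>c\<bar>)"
    have "f R \<le> B" for R
    proof (cases "R \<in> E")
      case True
      then have "f R \<le> Max (insert 0 (f ` E))" using \<open>finite E\<close> by (intro Max_ge) auto
      then show ?thesis by (simp add: B_def)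
    next
      case False
      obtain b c where bc: "(b, c) \<in> S" "int d * int (f R) = b * int R + c" using wit[of R] by blast
      with False have "b \<le> 0" by (force simp: E_def)
      have "1 * int (f R) \<le> int d * int (f R)" using d by (intro mult_right_mono) auto
      then have "int (f R) \<le> \<bar>c\<bar>" using bc(2) \<open>b \<le> 0\<close> mult_nonpos_nonneg[of b "int R"] by simp
      moreover have "nat \<bar>c\<bar> \<le> (\<Sum>(b, c)\<in>S. nat \<bar>c\<bar>)"
        using member_le_sum[OF bc(1), of "\<lambda>(b, c). nat \<bar>c\<bar>"] S by auto
      ultimately show ?thesis by (simp add: B_def)
    qed
    then show ?thesis by blast
  qed
qed

text \<open>Think of \<open>n\<close> as a norm on numbers. A late difference of \<open>G\<close>
  has a large norm, hence exceeds \<open>G r\<close>; summing \<open>r + 1\<close> such differences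
  multiplies \<open>G\<close> by about \<open>r\<close> while the argument grows only by a constant
  factor. Iteration beats every polynomial.\<close>

lemma superpolynomial_growth:
  fixes G n :: "nat \<Rightarrow> nat"
  assumes mono: "\<And>R. G R \<le> G (Suc R)"
    and small: "\<And>R n'. n' \<le> G R \<Longrightarrow> n n' \<le> C * R + C"
    and large: "\<And>k. k \<le> c * n (G (Suc (k0 + N * k)) - G (k0 + N * k))"
    and N: "0 < N"
    and poly: "\<And>R. G R + 1 \<le> (C * R + C + 1) ^ m"
  shows False
proof -
  have le: "G R \<le> G R'" if "R \<le> R'" for R R'
    using lift_Suc_mono_le[of G, OF mono that] .
  \<comment> \<open>From index \<open>t r\<close> on, the norm of a difference on the progression
    exceeds \<open>C * r + C\<close>, which by \<open>small\<close> excludes every number up to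
    \<open>G r\<close>.\<close>
  define t where "t = (\<lambda>r. c * (C * r + C) + 1)"
  have step: "G (k0 + N * (t r + j)) \<ge> j * (G r + 1)" for r j
  proof (induction j)
    case (Suc j)
    let ?k = "t r + j"
    have "G r < G (Suc (k0 + N * ?k)) - G (k0 + N * ?k)"
    proof (rule ccontr)
      assume "\<not> ?thesis"
      then have "n (G (Suc (k0 + N * ?k)) - G (k0 + N * ?k)) \<le> C * r + C"
        by (intro small) simp
      then have "?k \<le> c * (C * r + C)" using large[of ?k] by (meson le_trans mult_le_mono2)
      then show False by (simp add: t_def)
    qed
    moreover have "G (Suc (k0 + N * ?k)) \<le> G (k0 + N * (t r + Suc j))"
      using N by (intro le) simp
    ultimately show ?case using Suc.IH by simp
  qed simp
  \<comment> \<open>Chosen so that \<open>r + 1\<close> steps after index \<open>t r\<close> stay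
    within argument \<open>B * (r + 1)\<close>.\<close>
  define B where "B = k0 + N * (c * C + c * C + 2) + 1"
  have grow: "(r + 1) * (G r + 1) \<le> G (B * (r + 1))" for r
  proof -
    have "t r + (r + 1) \<le> (c * C + c * C + 2) * (r + 1)" by (simp add: t_def algebra_simps)
    then have "k0 + N * (t r + (r + 1)) \<le> k0 * (r + 1) + N * ((c * C + c * C + 2) * (r + 1))"
      by (intro add_mono mult_le_mono2) auto
    also have "\<dots> \<le> B * (r + 1)" by (simp add: B_def algebra_simps)
    finally show ?thesis using step[of "r + 1" r] le le_trans by blast
  qed
  \<comment> \<open>Each use of \<open>grow\<close> raises the exponent by one at the cost of
    replacing \<open>D\<close> by \<open>2 * B * D\<close>.\<close>
  have "\<exists>D>0. \<forall>r. (r + 1) ^ s \<le> G (D * (r + 1)) + 1" for s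
  proof (induction s)
    case 0
    show ?case by auto
  next
    case (Suc s)
    then obtain D where D: "0 < D" "\<And>r. (r + 1) ^ s \<le> G (D * (r + 1)) + 1" by blast
    have "(r + 1) ^ Suc s \<le> G ((2 * B * D) * (r + 1)) + 1" for r
    proof -
      have "(r + 1) * (r + 1) ^ s \<le> (D * (r + 1) + 1) * (G (D * (r + 1)) + 1)"
        using D mult_le_mono1[of 1 D "r + 1"] by (intro mult_le_mono) auto
      also have "\<dots> \<le> G (B * (D * (r + 1) + 1))" by (rule grow)
      also have "\<dots> \<le> G ((2 * B * D) * (r + 1))"
        using D(1) by (intro le) (simp add: algebra_simps, cases D, auto)
      finally show ?thesis by simp
    qed
    moreover have "0 < 2 * B * D" using D(1) by (simp add: B_def)
    ultimately show ?case by blast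
  qed
  then obtain D where D: "\<And>r. (r + 1) ^ Suc m \<le> G (D * (r + 1)) + 1" by blast
  \<comment> \<open>\<open>A\<close> bounds the coefficient in the polynomial upper bound at
    \<open>D * (r + 1)\<close>; at \<open>r = A\<close> degree \<open>m + 1\<close> already beats
    it.\<close>
  define A where "A = (C * D + C + 1) ^ m"
  have "(A + 1) ^ Suc m \<le> A * (A + 1) ^ m"
  proof -
    have "(A + 1) ^ Suc m \<le> (C * (D * (A + 1)) + C + 1) ^ m"
      using D[of A] poly[of "D * (A + 1)"] by linarith
    also have "\<dots> \<le> ((C * D + C + 1) * (A + 1)) ^ m"
      by (intro power_mono) (auto simp: algebra_simps)
    finally show ?thesis by (simp only: power_mult_distrib A_def[symmetric])
  qed
  moreover have "A * (A + 1) ^ m < (A + 1) ^ Suc m" by simp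
  ultimately show False by linarith
qed

section \<open>Definability of the internal numbering\<close>

definition scalar_vecrel where
  "scalar_vecrel m P \<longleftrightarrow> definable (\<lambda>H (e :: nat \<times> nat \<Rightarrow> 'r::linordered_idom).
     P H (e (1, 0)) (var_vec m 0 e))"

lemma scalar_vecrelD:
  assumes "scalar_vecrel m P" "linterm s" "vecterm m x"
  shows "definable (\<lambda>H e. P H (s e) (x e))"
proof -
  define t where "t = (\<lambda>ji :: nat \<times> nat. \<lambda>e. if fst ji = 0 then
    (if snd ji < m then x e ! snd ji else 0) else s e)"
  have "linterm (t ji)" for ji
    using assms(2,3) by (cases "fst ji = 0"; cases "snd ji < m")
      (auto simp: t_def vecterm_def linterm_zero)
  from definable_subst[where t = t, OF assms(1)[unfolded scalar_vecrel_def] this]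
  have "definable (\<lambda>H e. P H (s e) (map (\<lambda>i. if i < m then x e ! i else 0) [0..<m]))"
    by (simp add: t_def cong: if_cong)
  then show ?thesis using assms(3) by (simp add: map_nth_upt vecterm_def)
qed

text \<open>On nonnegative vectors these are the balls of the maximum norm: definable in every
  group, and finite over the integers.\<close>

definition small :: "'r::linordered_idom \<Rightarrow> 'r list \<Rightarrow> bool" where
  "small s x \<longleftrightarrow> (\<forall>i<length x. x ! i \<le> s)"

lemma definable_small:
  fixes s :: "('i \<Rightarrow> 'r::linordered_idom) \<Rightarrow> 'r"
  assumes "linterm s" "vecterm m x"
  shows "definable (\<lambda>H e. small (s e) (x e))"
proof -
  have "length (x e) = m" for e using assms(2) by (simp add: vecterm_def)
  then have "definable (\<lambda>H e. \<forall>i<length (x e). x e ! i \<le> s e)"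
    using assms by (simp, intro definable_all_less definable_le) (auto simp: vecterm_def)
  then show ?thesis by (simp add: small_def)
qed

lemma small_mono: "small s x \<Longrightarrow> s \<le> t \<Longrightarrow> small t x"
  unfolding small_def by force

lemma ball_subset:
  "{x \<in> Vec m \<int>. small (of_nat s :: 'r::linordered_idom) x} \<subseteq>
     {x. set x \<subseteq> of_nat ` {..s} \<and> length x = m}"
proof clarify
  fix x :: "'r list" assume x: "x \<in> Vec m \<int>" "small (of_nat s) x"
  have "y \<in> of_nat ` {..s}" if y: "y \<in> set x" for y
  proof -
    obtain n where "y = of_nat n" using y x(1) by (auto simp: Vec_def nonneg_Ints)
    moreover have "y \<le> of_nat s" using x(2) y by (auto simp: small_def in_set_conv_nth)
    ultimately show ?thesis by auto
  qed
  then show "set x \<subseteq> of_nat ` {..s} \<and> length x = m" using x(1) by (auto simp: Vec_def)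
qed

lemma finite_ball: "finite {x \<in> Vec m \<int>. small (of_nat s :: 'r::linordered_idom) x}"
  by (rule finite_subset[OF ball_subset]) (simp add: finite_lists_length_eq)

lemma card_ball: "card {x \<in> Vec m \<int>. small (of_nat s :: 'r::linordered_idom) x} \<le> (s + 1) ^ m"
proof -
  have "card {x \<in> Vec m \<int>. small (of_nat s :: 'r) x} \<le>
      card {x. set x \<subseteq> (of_nat :: nat \<Rightarrow> 'r) ` {..s} \<and> length x = m}"
    by (intro card_mono ball_subset) (simp add: finite_lists_length_eq)
  also have "\<dots> = card ((of_nat :: nat \<Rightarrow> 'r) ` {..s}) ^ m"
    by (simp add: card_lists_length_eq)
  also have "card ((of_nat :: nat \<Rightarrow> 'r) ` {..s}) = s + 1"
    by (subst card_image) (auto simp: inj_on_def)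
  finally show ?thesis .
qed

lemma Vec_Ints_small:
  assumes "x \<in> Vec m (\<int> :: 'r::linordered_idom set)"
  shows "\<exists>s. small (of_nat s) x"
proof -
  have "\<forall>y\<in>set x. \<exists>n. y = of_nat n" using assms by (auto simp: Vec_def nonneg_Ints)
  then obtain f where f: "\<And>y. y \<in> set x \<Longrightarrow> y = of_nat (f y)" by metis
  have "x ! i \<le> of_nat (\<Sum>y\<in>set x. f y)" if "i < length x" for i
  proof -
    have "f (x ! i) \<le> (\<Sum>y\<in>set x. f y)" using that by (intro member_le_sum) auto
    then show ?thesis using f[of "x ! i"] that by (metis nth_mem of_nat_le_iff)
  qed
  then show ?thesis unfolding small_def by blast
qed

text \<open>\<open>cl H x\<close> is the element of the internal structure \<open>(P H, pl H)\<close> represented by the vector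
  \<open>x\<close>, and \<open>num\<close> enumerates the standard part of the internal structure over \<open>\<int>\<close>.\<close>

locale internal_addition =
  fixes m :: nat and D :: "'r::linordered_idom set \<Rightarrow> 'r list \<Rightarrow> bool"
    and cl :: "'r set \<Rightarrow> 'r list \<Rightarrow> 'c" and P :: "'r set \<Rightarrow> 'c set"
    and pl :: "'r set \<Rightarrow> 'c \<Rightarrow> 'c \<Rightarrow> 'c" and num :: "nat \<Rightarrow> 'c"
  assumes definable_D: "vecrel1 m D"
    and definable_E: "vecrel2 m (\<lambda>H x y. D H x \<and> D H y \<and> cl H x = cl H y)"
    and definable_A: "vecrel3 m (\<lambda>H x y z. D H x \<and> D H y \<and> D H z \<and> pl H (cl H x) (cl H y) = cl H z)"
    and surj: "cl \<int> ` {x \<in> Vec m \<int>. D \<int> x} = P \<int>"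
    and num_P: "num n \<in> P \<int>"
    and num_eq_iff: "num a = num b \<longleftrightarrow> a = b"
    and num_add: "pl \<int> (num a) (num b) = num (a + b)"
    and num_initial: "X \<in> P \<int> \<Longrightarrow> Y \<in> P \<int> \<Longrightarrow> pl \<int> X Y = num n \<Longrightarrow> \<exists>a b. X = num a \<and> Y = num b"
    and num_finite: "X \<in> P \<int> \<Longrightarrow> finite {Y \<in> P \<int>. \<exists>Z\<in>P \<int>. pl \<int> Y Z = X} \<Longrightarrow> \<exists>n. X = num n"
begin

definition E :: "'r set \<Rightarrow> 'r list \<Rightarrow> 'r list \<Rightarrow> bool" where
  "E H x y \<longleftrightarrow> D H x \<and> D H y \<and> cl H x = cl H y"

definition A :: "'r set \<Rightarrow> 'r list \<Rightarrow> 'r list \<Rightarrow> 'r list \<Rightarrow> bool" where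
  "A H x y z \<longleftrightarrow> D H x \<and> D H y \<and> D H z \<and> pl H (cl H x) (cl H y) = cl H z"

definition le :: "'r set \<Rightarrow> 'r list \<Rightarrow> 'r list \<Rightarrow> bool" where
  "le H x y \<longleftrightarrow> (\<exists>z\<in>Vec m H. A H x z y)"

text \<open>Unlike \<open>small s x\<close>, this depends only on the element represented by
  \<open>x\<close>, not on the chosen vector.\<close>

definition rep :: "'r set \<Rightarrow> 'r \<Rightarrow> 'r list \<Rightarrow> bool" where
  "rep H s x \<longleftrightarrow> (\<exists>y\<in>Vec m H. E H x y \<and> small s y)"

text \<open>A first-order substitute for having finitely many predecessors: all of them have
  representatives in one common ball. \<open>fin_val\<close> shows that over the integers the two
  agree.\<close>

definition fin :: "'r set \<Rightarrow> 'r list \<Rightarrow> bool" where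
  "fin H x \<longleftrightarrow> D H x \<and> (\<exists>s\<in>nonneg H. \<forall>y\<in>Vec m H. le H y x \<longrightarrow> rep H s y)"

text \<open>Over the integers this describes the graph of \<open>G\<close>, with the radius shifted
  by \<open>offset\<close>; see \<open>top_imp_val\<close> and \<open>top_ex\<close>.\<close>

definition top :: "'r set \<Rightarrow> 'r \<Rightarrow> 'r list \<Rightarrow> bool" where
  "top H s x \<longleftrightarrow> fin H x \<and> small s x \<and> (\<forall>y\<in>Vec m H. fin H y \<and> small s y \<longrightarrow> le H y x)"

text \<open>Expresses b = a + n x for a fixed numeral \<open>n\<close>; intermediate sums are
  quantified because internal addition is available only as a relation.\<close>

primrec madd :: "nat \<Rightarrow> 'r set \<Rightarrow> 'r list \<Rightarrow> 'r list \<Rightarrow> 'r list \<Rightarrow> bool" where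
  "madd 0 H x a b \<longleftrightarrow> E H a b"
| "madd (Suc n) H x a b \<longleftrightarrow> (\<exists>c\<in>Vec m H. A H x a c \<and> madd n H x c b)"

text \<open>If \<open>top\<close> at radius \<open>k0 + N * k\<close> represents \<open>c + g * k\<close> for all \<open>k\<close>, then \<open>index\<close> says that
  \<open>g * x + c = c + g * k\<close>, that is, \<open>x\<close> represents \<open>k\<close>.\<close>

definition index :: "nat \<Rightarrow> nat \<Rightarrow> nat \<Rightarrow> 'r set \<Rightarrow> 'r \<Rightarrow> 'r list \<Rightarrow> bool" where
  "index g N k0 H k x \<longleftrightarrow> fin H x \<and> (\<exists>a\<in>Vec m H. \<exists>b\<in>Vec m H.
     top H (of_nat k0) a \<and> top H (of_nat N * k + of_nat k0) b \<and> madd g H x a b)"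

text \<open>The clauses say that \<open>R\<close> is total, additive, closed under passing to
  internally smaller elements, and injective. They form one definable sentence, and they are exactly
  what pulling a division back from the internal model requires.\<close>

definition embeds :: "('r set \<Rightarrow> 'r \<Rightarrow> 'r list \<Rightarrow> bool) \<Rightarrow> 'r set \<Rightarrow> bool" where
  "embeds R H \<longleftrightarrow>
     (\<forall>k\<in>nonneg H. \<exists>x\<in>Vec m H. D H x \<and> R H k x) \<and>
     (\<forall>k\<in>nonneg H. \<forall>l\<in>nonneg H. \<forall>x\<in>Vec m H. \<forall>y\<in>Vec m H. \<forall>z\<in>Vec m H.
        R H k x \<longrightarrow> R H l y \<longrightarrow> A H x y z \<longrightarrow> R H (k + l) z) \<and>
     (\<forall>k\<in>nonneg H. \<forall>x\<in>Vec m H. \<forall>y\<in>Vec m H. R H k x \<longrightarrow> le H y x \<longrightarrow> (\<exists>l\<in>nonneg H. R H l y)) \<and>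
     (\<forall>k\<in>nonneg H. \<forall>l\<in>nonneg H. \<forall>x\<in>Vec m H. \<forall>y\<in>Vec m H.
        R H k x \<longrightarrow> R H l y \<longrightarrow> E H x y \<longrightarrow> k = l)"

lemmas D_definable = vecrel1D[OF definable_D]
lemmas E_definable = vecrel2D[OF definable_E, folded E_def]
lemmas A_definable = vecrel3D[OF definable_A, folded A_def]

lemmas definable_intros = definable_conj definable_imp definable_ex_Vec definable_all_Vec definable_ex
  definable_all D_definable E_definable A_definable definable_small[where m = m] vecterm_var linterm_var linterm_add
  linterm_of_nat_mult linterm_of_nat definable_le definable_eq

lemma le_definable: "vecterm m x \<Longrightarrow> vecterm m y \<Longrightarrow> definable (\<lambda>H e. le H (x e) (y e))"
  by (rule vecrel2D[where m = m]) (unfold vecrel2_def le_def, intro definable_intros)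

lemma rep_definable: "linterm s \<Longrightarrow> vecterm m x \<Longrightarrow> definable (\<lambda>H e. rep H (s e) (x e))"
  by (rule scalar_vecrelD[where m = m]) (unfold scalar_vecrel_def rep_def, intro definable_intros)

lemma fin_definable: "vecterm m x \<Longrightarrow> definable (\<lambda>H e. fin H (x e))"
  by (rule vecrel1D[where m = m]) (unfold vecrel1_def fin_def, intro definable_intros le_definable rep_definable)

lemma top_definable: "linterm s \<Longrightarrow> vecterm m x \<Longrightarrow> definable (\<lambda>H e. top H (s e) (x e))"
  by (rule scalar_vecrelD[where m = m]) (unfold scalar_vecrel_def top_def, intro definable_intros le_definable fin_definable)

lemma madd_definable:
  "vecterm m x \<Longrightarrow> vecterm m y \<Longrightarrow> vecterm m z \<Longrightarrow> definable (\<lambda>H e. madd n H (x e) (y e) (z e))"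
proof (rule vecrel3D[where m = m])
  show "vecrel3 m (madd n)"
  proof (induction n)
    case 0
    show ?case unfolding vecrel3_def madd.simps by (intro definable_intros)
  next
    case (Suc n)
    show ?case unfolding vecrel3_def madd.simps by (intro definable_intros vecrel3D[OF Suc.IH])
  qed
qed

lemma index_definable:
  "linterm k \<Longrightarrow> vecterm m x \<Longrightarrow> definable (\<lambda>H e. index g N k0 H (k e) (x e))"
  by (rule scalar_vecrelD[where m = m])
    (unfold scalar_vecrel_def index_def, intro definable_intros fin_definable top_definable madd_definable)

lemma embeds_definable: "definable (\<lambda>H e. embeds (index g N k0) H)"
  unfolding embeds_def by (intro definable_intros index_definable le_definable)


section \<open>Represented numbers, norms and balls over the integers\<close>

definition val :: "'r list \<Rightarrow> nat \<Rightarrow> bool" where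
  "val x n \<longleftrightarrow> x \<in> Vec m \<int> \<and> D \<int> x \<and> cl \<int> x = num n"

lemma val_ex: "\<exists>x. val x n"
proof -
  have "num n \<in> cl \<int> ` {x \<in> Vec m \<int>. D \<int> x}" using num_P surj by simp
  then show ?thesis by (auto simp: val_def)
qed

lemma val_unique: "val x a \<Longrightarrow> val x b \<Longrightarrow> a = b"
  by (simp add: val_def num_eq_iff)

lemma val_Vec: "val x n \<Longrightarrow> x \<in> Vec m \<int>"
  by (simp add: val_def)

lemma cl_P: "x \<in> Vec m \<int> \<Longrightarrow> D \<int> x \<Longrightarrow> cl \<int> x \<in> P \<int>"
  using surj by blast

lemma E_val: "val x a \<Longrightarrow> y \<in> Vec m \<int> \<Longrightarrow> E \<int> x y \<longleftrightarrow> val y a"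
  by (auto simp: E_def val_def)

lemma A_val: "val x a \<Longrightarrow> val y b \<Longrightarrow> z \<in> Vec m \<int> \<Longrightarrow> A \<int> x y z \<longleftrightarrow> val z (a + b)"
  by (auto simp: A_def val_def num_add)

text \<open>By \<open>num_initial\<close>, both summands of a standard element are standard, so
  nothing nonstandard lies below a number.\<close>

lemma le_val:
  assumes "val y b" "x \<in> Vec m \<int>"
  shows "le \<int> x y \<longleftrightarrow> (\<exists>a\<le>b. val x a)"
proof
  assume "le \<int> x y"
  then obtain z where z: "z \<in> Vec m \<int>" "A \<int> x z y" unfolding le_def by blast
  then have D: "D \<int> x" "D \<int> z" and eq: "pl \<int> (cl \<int> x) (cl \<int> z) = num b"
    using assms(1) by (auto simp: A_def val_def)
  from num_initial[OF cl_P cl_P eq] D z(1) assms(2)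
  obtain a c where ac: "cl \<int> x = num a" "cl \<int> z = num c" by blast
  then have "a + c = b" using eq by (simp add: num_add num_eq_iff)
  then show "\<exists>a\<le>b. val x a"
    using ac D assms(2) by (intro exI[of _ a]) (auto simp: val_def)
next
  assume "\<exists>a\<le>b. val x a"
  then obtain a where a: "a \<le> b" "val x a" by blast
  obtain z where z: "val z (b - a)" using val_ex by blast
  then have "A \<int> x z y" using A_val[OF a(2) z] a(1) assms(1) by (simp add: val_def)
  then show "le \<int> x y" unfolding le_def using val_Vec[OF z] by blast
qed

lemma le_val_val: "val x a \<Longrightarrow> val y b \<Longrightarrow> le \<int> x y \<longleftrightarrow> a \<le> b"
  using le_val[of y b x] val_unique val_Vec by blast

text \<open>The norm of a number. It enters formulas only through \<open>rep\<close>, by means of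
  \<open>rep_val\<close>.\<close>

definition nm :: "nat \<Rightarrow> nat" where
  "nm n = (LEAST s. \<exists>x. val x n \<and> small (of_nat s) x)"

lemma nm_attained: "\<exists>x. val x n \<and> small (of_nat (nm n)) x"
proof -
  obtain x where x: "val x n" using val_ex by blast
  then obtain s where "small (of_nat s) x" using Vec_Ints_small[of x m] by (auto simp: val_def)
  with x have "\<exists>s x. val x n \<and> small (of_nat s) x" by blast
  then show ?thesis unfolding nm_def by (rule LeastI_ex)
qed

lemma nm_le: "val x n \<Longrightarrow> small (of_nat s) x \<Longrightarrow> nm n \<le> s"
  unfolding nm_def by (intro Least_le) blast

lemma rep_val:
  assumes "val x n"
  shows "rep \<int> (of_nat s) x \<longleftrightarrow> nm n \<le> s"
proof
  assume "rep \<int> (of_nat s) x"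
  then obtain y where "y \<in> Vec m \<int>" "E \<int> x y" "small (of_nat s) y" unfolding rep_def by blast
  then show "nm n \<le> s" using E_val[OF assms] nm_le by blast
next
  assume le: "nm n \<le> s"
  obtain y where "val y n" "small (of_nat (nm n)) y" using nm_attained by blast
  then show "rep \<int> (of_nat s) x"
    unfolding rep_def using E_val[OF assms val_Vec] val_Vec small_mono[of "of_nat (nm n)" y "of_nat s"] le
    by (metis of_nat_le_iff)
qed

text \<open>If all predecessors have representatives in one ball, they are finite in number and
  \<open>num_finite\<close> applies. Conversely, the finitely many norms of the numbers up to
  \<open>n\<close> have a maximum.\<close>

lemma fin_val:
  assumes "x \<in> Vec m \<int>"
  shows "fin \<int> x \<longleftrightarrow> (\<exists>n. val x n)"
proof
  assume "fin \<int> x"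
  then obtain s where D: "D \<int> x"
    and s: "\<And>y. y \<in> Vec m \<int> \<Longrightarrow> le \<int> y x \<Longrightarrow> rep \<int> (of_nat s) y"
    unfolding fin_def nonneg_Ints by blast
  have "{Y \<in> P \<int>. \<exists>Z\<in>P \<int>. pl \<int> Y Z = cl \<int> x} \<subseteq> cl \<int> ` {x \<in> Vec m \<int>. small (of_nat s) x}"
  proof clarify
    fix Y Z assume Y: "Y \<in> P \<int>" and Z: "Z \<in> P \<int>" and eq: "pl \<int> Y Z = cl \<int> x"
    obtain y where y: "y \<in> Vec m \<int>" "D \<int> y" "Y = cl \<int> y" using Y surj by blast
    obtain z where z: "z \<in> Vec m \<int>" "D \<int> z" "Z = cl \<int> z" using Z surj by blast
    have "le \<int> y x" unfolding le_def A_def using y z D eq by blast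
    then obtain y' where "y' \<in> Vec m \<int>" "E \<int> y y'" "small (of_nat s) y'"
      using s y(1) unfolding rep_def by blast
    then show "Y \<in> cl \<int> ` {x \<in> Vec m \<int>. small (of_nat s) x}"
      using y(3) by (auto simp: E_def)
  qed
  then have "finite {Y \<in> P \<int>. \<exists>Z\<in>P \<int>. pl \<int> Y Z = cl \<int> x}"
    by (rule finite_subset) (intro finite_imageI finite_ball)
  from num_finite[OF cl_P[OF assms D] this] show "\<exists>n. val x n"
    using assms D by (auto simp: val_def)
next
  assume "\<exists>n. val x n"
  then obtain n where n: "val x n" by blast
  define s where "s = Max (nm ` {..n})"
  have "rep \<int> (of_nat s) y" if y: "y \<in> Vec m \<int>" "le \<int> y x" for y
  proof -
    obtain a where a: "a \<le> n" "val y a" using le_val[OF n y(1)] y(2) by blast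
    then have "nm a \<le> s" unfolding s_def by (intro Max_ge) auto
    then show ?thesis using rep_val[OF a(2)] by blast
  qed
  then show "fin \<int> x"
    unfolding fin_def nonneg_Ints using n by (auto simp: val_def)
qed

lemma madd_val:
  assumes "val x n" "b \<in> Vec m \<int>"
  shows "val a p \<Longrightarrow> madd g \<int> x a b \<longleftrightarrow> val b (g * n + p)"
proof (induction g arbitrary: a p)
  case 0
  then show ?case using E_val[OF _ assms(2)] by simp
next
  case (Suc g)
  have "madd (Suc g) \<int> x a b \<longleftrightarrow> (\<exists>c. val c (n + p) \<and> madd g \<int> x c b)"
    using A_val[OF assms(1) Suc.prems] val_Vec by auto
  also have "\<dots> \<longleftrightarrow> val b (g * n + (n + p))"
    using Suc.IH val_ex by blast
  finally show ?case by (simp add: algebra_simps)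
qed

text \<open>The offset keeps every ball nonempty, so that the maximum below is never junk.\<close>

definition offset :: nat where "offset = nm 0"

definition ball :: "nat \<Rightarrow> nat set" where
  "ball R = {n. nm n \<le> R + offset}"

definition G :: "nat \<Rightarrow> nat" where "G R = Max (ball R)"

text \<open>Distinct numbers have distinct representatives, so choosing one of least norm for each
  injects \<open>S\<close> into a ball of vectors.\<close>

lemma card_le_ball:
  assumes "\<And>n. n \<in> S \<Longrightarrow> nm n \<le> s"
  shows "finite S \<and> card S \<le> (s + 1) ^ m"
proof -
  let ?V = "{x \<in> Vec m \<int>. small (of_nat s :: 'r) x}"
  obtain f where f: "\<And>n. val (f n) n \<and> small (of_nat (nm n)) (f n)"
    using nm_attained by metis
  have sub: "f ` S \<subseteq> ?V"
  proof clarify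
    fix n assume "n \<in> S"
    then have "(of_nat (nm n) :: 'r) \<le> of_nat s" using assms by simp
    then show "f n \<in> Vec m \<int> \<and> small (of_nat s) (f n)"
      using f[of n] small_mono val_Vec by blast
  qed
  have inj: "inj_on f S" using f val_unique by (metis inj_onI)
  have "card S \<le> card ?V" by (rule card_inj_on_le[OF inj sub finite_ball])
  then show ?thesis
    using card_ball[of m s, where 'r = 'r] inj_on_finite[OF inj sub finite_ball] by linarith
qed

lemma finite_nat_ball: "finite (ball R)"
  using card_le_ball[of "ball R" "R + offset"] by (simp add: ball_def)

lemma ball_nonempty: "0 \<in> ball R"
  by (simp add: ball_def offset_def)

lemma G_in_ball: "G R \<in> ball R"
  unfolding G_def using ball_nonempty by (intro Max_in finite_nat_ball) auto

lemma G_max: "n \<in> ball R \<Longrightarrow> n \<le> G R"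
  unfolding G_def by (intro Max_ge finite_nat_ball)

lemma G_mono: "G R \<le> G (Suc R)"
  by (rule G_max) (use G_in_ball[of R] in \<open>simp add: ball_def\<close>)

lemma top_imp_val:
  assumes x: "x \<in> Vec m \<int>" and t: "top \<int> (of_nat (R + offset)) x"
  shows "val x (G R)"
proof -
  obtain n where n: "val x n" using t fin_val[OF x] unfolding top_def by blast
  have "n \<in> ball R" using t nm_le[OF n] by (simp add: top_def ball_def)
  then have "n \<le> G R" by (rule G_max)
  obtain y where y: "val y (G R)" "small (of_nat (nm (G R))) y" using nm_attained by blast
  have "(of_nat (nm (G R)) :: 'r) \<le> of_nat (R + offset)"
    using G_in_ball[of R] by (simp only: ball_def mem_Collect_eq of_nat_le_iff)
  then have "small (of_nat (R + offset)) y" using y(2) small_mono by blast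
  moreover have "fin \<int> y" using fin_val[OF val_Vec[OF y(1)]] y(1) by blast
  ultimately have "le \<int> y x" using t val_Vec[OF y(1)] unfolding top_def by blast
  then have "G R \<le> n" using le_val_val[OF y(1) n] by simp
  with \<open>n \<le> G R\<close> n show ?thesis by simp
qed

lemma top_ex: "\<exists>x\<in>Vec m \<int>. top \<int> (of_nat (R + offset)) x"
proof -
  obtain x where x: "val x (G R)" "small (of_nat (nm (G R))) x" using nm_attained by blast
  have "(of_nat (nm (G R)) :: 'r) \<le> of_nat (R + offset)"
    using G_in_ball[of R] by (simp only: ball_def mem_Collect_eq of_nat_le_iff)
  then have s: "small (of_nat (R + offset)) x" using x(2) small_mono by blast
  have "le \<int> y x" if y: "y \<in> Vec m \<int>" "fin \<int> y" "small (of_nat (R + offset)) y" for y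
  proof -
    obtain n where n: "val y n" using y(2) fin_val[OF y(1)] by blast
    then have "n \<in> ball R" using nm_le[OF n y(3)] by (simp add: ball_def)
    then show ?thesis using le_val_val[OF n x(1)] G_max by simp
  qed
  then have "top \<int> (of_nat (R + offset)) x"
    unfolding top_def using s fin_val[OF val_Vec[OF x(1)]] x(1) by blast
  then show ?thesis using val_Vec[OF x(1)] by blast
qed

text \<open>A number below \<open>G R\<close> may itself lie outside \<open>ball R\<close>. That
  radius \<open>r\<close> suffices for all of them is a definable relation of \<open>R\<close> and
  \<open>r\<close>, and it is total because they are finitely many, so a linear choice of
  \<open>r\<close> exists.\<close>

lemma nm_linear_bound: "\<exists>C. \<forall>R. \<forall>n\<le>G R. nm n \<le> C * R + C"
proof -
  let ?P = "\<lambda>H (e :: bool \<Rightarrow> 'r). \<exists>x\<in>Vec m H. top H (e False + of_nat offset) x \<and>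
    (\<forall>y\<in>Vec m H. le H y x \<longrightarrow> rep H (e True) y)"
  have def: "definable ?P" by (intro definable_intros top_definable le_definable rep_definable)
  have P: "?P \<int> (pair_env R r) \<longleftrightarrow> (\<forall>n\<le>G R. nm n \<le> r)" for R r
  proof
    assume "?P \<int> (pair_env R r)"
    then obtain x where x: "x \<in> Vec m \<int>" "top \<int> (of_nat (R + offset)) x"
      "\<And>y. y \<in> Vec m \<int> \<Longrightarrow> le \<int> y x \<Longrightarrow> rep \<int> (of_nat r) y"
      by (auto simp: pair_env_def)
    show "\<forall>n\<le>G R. nm n \<le> r"
    proof (intro allI impI)
      fix n assume "n \<le> G R"
      obtain y where y: "val y n" using val_ex by blast
      then have "le \<int> y x" using le_val_val[OF y top_imp_val[OF x(1,2)]] \<open>n \<le> G R\<close> by simp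
      then show "nm n \<le> r" using x(3)[OF val_Vec[OF y]] rep_val[OF y] by simp
    qed
  next
    assume r: "\<forall>n\<le>G R. nm n \<le> r"
    obtain x where x: "x \<in> Vec m \<int>" "top \<int> (of_nat (R + offset)) x" using top_ex by blast
    have "rep \<int> (of_nat r) y" if "y \<in> Vec m \<int>" "le \<int> y x" for y
      using le_val[OF top_imp_val[OF x] that(1)] that(2) r rep_val by blast
    then show "?P \<int> (pair_env R r)" using x by (auto simp: pair_env_def)
  qed
  have "\<exists>r. ?P \<int> (pair_env R r)" for R
    unfolding P by (intro exI[of _ "Max (nm ` {..G R})"]) auto
  from definable_linear_bound[OF def this]
  obtain C where "\<And>R. \<exists>r\<le>C * R + C. \<forall>n\<le>G R. nm n \<le> r" unfolding P by blast
  then have "\<forall>R. \<forall>n\<le>G R. nm n \<le> C * R + C" by (meson order_trans)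
  then show ?thesis by blast
qed

text \<open>The norm of the difference is a definable function of \<open>R\<close>. If it were
  unbounded it would grow linearly along a progression, and \<open>superpolynomial_growth\<close>
  would contradict the count of vectors in a ball.\<close>

lemma nm_differences_bounded: "\<exists>B. \<forall>R. nm (G (Suc R) - G R) \<le> B"
proof (rule ccontr)
  assume unbounded: "\<not> ?thesis"
  let ?f = "\<lambda>R. nm (G (Suc R) - G R)"
  \<comment> \<open>The last conjunct makes \<open>r\<close> the least radius, so that the relation
    is the graph of a function.\<close>
  let ?P = "\<lambda>H (e :: bool \<Rightarrow> 'r). \<exists>x\<in>Vec m H. \<exists>y\<in>Vec m H. \<exists>d\<in>Vec m H.
    top H (e False + of_nat offset) x \<and> top H (e False + of_nat (Suc offset)) y \<and> A H x d y \<and>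
    rep H (e True) d \<and> (\<forall>s\<in>nonneg H. rep H s d \<longrightarrow> e True \<le> s)"
  have def: "definable ?P"
    by (intro definable_intros top_definable rep_definable)
  have P: "?P \<int> (pair_env R r) \<longleftrightarrow> r = ?f R" for R r
  proof
    assume "?P \<int> (pair_env R r)"
    then obtain x y d where xyd: "x \<in> Vec m \<int>" "y \<in> Vec m \<int>" "d \<in> Vec m \<int>"
      and t: "top \<int> (of_nat (R + offset)) x" "top \<int> (of_nat (Suc R + offset)) y" "A \<int> x d y"
      and r: "rep \<int> (of_nat r) d" "\<And>s. rep \<int> (of_nat s) d \<Longrightarrow> r \<le> s"
      by (auto simp: pair_env_def nonneg_Ints add_ac)
    have x: "val x (G R)" and y: "val y (G (Suc R))" using top_imp_val xyd t by blast+
    obtain z where z: "val z (G (Suc R) - G R)" using val_ex by blast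
    have "D \<int> d" "pl \<int> (cl \<int> x) (cl \<int> d) = num (G (Suc R))"
      using t(3) y by (auto simp: A_def val_def)
    moreover from this x obtain j where "cl \<int> d = num j"
      using num_initial[OF cl_P[OF xyd(1)] cl_P[OF xyd(3)]] by (auto simp: val_def)
    ultimately have "val d j" "G R + j = G (Suc R)"
      using x xyd(3) by (auto simp: val_def num_add num_eq_iff)
    then have "val d (G (Suc R) - G R)" by (metis diff_add_inverse)
    from rep_val[OF this] r show "r = ?f R" by (metis le_antisym order_refl)
  next
    assume r: "r = ?f R"
    obtain x where x: "x \<in> Vec m \<int>" "top \<int> (of_nat (R + offset)) x" using top_ex by blast
    obtain y where y: "y \<in> Vec m \<int>" "top \<int> (of_nat (Suc R + offset)) y" using top_ex by blast
    obtain d where d: "val d (G (Suc R) - G R)" using val_ex by blast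
    have "A \<int> x d y"
      using A_val[OF top_imp_val[OF x] d y(1)] top_imp_val[OF y] G_mono[of R] by simp
    moreover have "rep \<int> (of_nat s) d \<longleftrightarrow> r \<le> s" for s
      using rep_val[OF d] r by simp
    ultimately show "?P \<int> (pair_env R r)"
      using x y val_Vec[OF d] by (auto simp: pair_env_def nonneg_Ints add_ac)
  qed
  obtain N k0 c where N: "0 < N" and large: "\<And>k. k \<le> c * ?f (k0 + N * k)"
    using definable_bounded_or_linear[where P = ?P and f = ?f, OF def P] unbounded by blast
  obtain C where C: "\<forall>R. \<forall>n\<le>G R. nm n \<le> C * R + C" using nm_linear_bound by blast
  \<comment> \<open>The \<open>G R + 1\<close> numbers 0, ..., \<open>G R\<close> all have norm at
    most \<open>C * R + C\<close>.\<close>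
  have poly: "G R + 1 \<le> (C * R + C + 1) ^ m" for R
    using card_le_ball[of "{..G R}" "C * R + C"] C by simp
  show False
    using superpolynomial_growth[where G = G and n = nm and C = C, OF G_mono _ large N poly] C by blast
qed

text \<open>Differences of bounded norm take finitely many values, each on an eventually periodic
  set. With a common period \<open>N\<close> the sequence of differences is periodic from
  \<open>k0\<close> on, so the increment of \<open>G\<close> over one period is constant.\<close>

lemma G_arithmetic_progression: "\<exists>N k0 g. 0 < g \<and> (\<forall>k. G (k0 + N * k) = G k0 + g * k)"
proof -
  obtain B where B: "\<And>R. nm (G (Suc R) - G R) \<le> B" using nm_differences_bounded by blast
  define S where "S = {d. nm d \<le> B}"
  have "finite S" using card_le_ball[of S B] by (simp add: S_def)
  have "eventually_periodic (\<lambda>R. G (Suc R) - G R = d)" for d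
  proof -
    \<comment> \<open>A representative over the integers is a tuple of numerals, so it may appear in
      a formula as a constant.\<close>
    obtain v where v: "val v d" using val_ex by blast
    have vt: "vecterm m (\<lambda>e. v)"
      using v by (intro vecterm_const) (auto simp: val_def Vec_def nonneg_Ints)
    let ?P = "\<lambda>H (e :: unit \<Rightarrow> 'r). \<exists>x\<in>Vec m H. \<exists>y\<in>Vec m H.
      top H (e () + of_nat offset) x \<and> top H (e () + of_nat (Suc offset)) y \<and> A H x v y"
    have "definable ?P" by (intro definable_intros top_definable vt)
    from definable_eventually_periodic[OF this, of "\<lambda>_. 1"]
    have "eventually_periodic (\<lambda>R. ?P \<int> (\<lambda>_. of_nat R))" unfolding of_nat_1 mult_1 .
    moreover have "?P \<int> (\<lambda>_. of_nat R) \<longleftrightarrow> G (Suc R) - G R = d" for R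
    proof
      assume "?P \<int> (\<lambda>_. of_nat R)"
      then obtain x y where xy: "x \<in> Vec m \<int>" "y \<in> Vec m \<int>"
        and t: "top \<int> (of_nat (R + offset)) x" "top \<int> (of_nat (Suc R + offset)) y" "A \<int> x v y"
        by (auto simp: add_ac)
      have x: "val x (G R)" and y: "val y (G (Suc R))" using top_imp_val xy t by blast+
      have "val y (G R + d)" using A_val[OF x v xy(2)] t(3) by simp
      then show "G (Suc R) - G R = d" using val_unique[OF y] by simp
    next
      assume d: "G (Suc R) - G R = d"
      obtain x where x: "x \<in> Vec m \<int>" "top \<int> (of_nat (R + offset)) x" using top_ex by blast
      obtain y where y: "y \<in> Vec m \<int>" "top \<int> (of_nat (Suc R + offset)) y" using top_ex by blast
      have "G R + d = G (Suc R)" using d G_mono[of R] by simp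
      then have "A \<int> x v y" using A_val[OF top_imp_val[OF x] v y(1)] top_imp_val[OF y] by simp
      then show "?P \<int> (\<lambda>_. of_nat R)" using x y by (auto simp: add_ac)
    qed
    ultimately show ?thesis by simp
  qed
  from eventually_periodic_common[OF \<open>finite S\<close>, of "\<lambda>d R. G (Suc R) - G R = d", OF this]
  obtain N k0 where N: "0 < N"
    and per: "\<And>d k. d \<in> S \<Longrightarrow> k0 \<le> k \<Longrightarrow> G (Suc k) - G k = d \<longleftrightarrow> G (Suc (k + N)) - G (k + N) = d"
    by auto
  \<comment> \<open>The difference at \<open>k\<close> lies in \<open>S\<close>, and the periodicity
    of its own level set carries it to \<open>k + N\<close>.\<close>
  have per': "G (Suc (k + N)) - G (k + N) = G (Suc k) - G k" if "k0 \<le> k" for k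
    using per[OF _ that, of "G (Suc k) - G k"] B by (simp add: S_def)
  define g where "g = G (k0 + N) - G k0"
  have le: "G R \<le> G R'" if "R \<le> R'" for R R'
    using lift_Suc_mono_le[of G, OF G_mono that] .
  have step: "G (k0 + j + N) = G (k0 + j) + g" for j
  proof (induction j)
    case 0
    show ?case using le[of k0 "k0 + N"] by (simp add: g_def)
  next
    case (Suc j)
    then show ?case
      using per'[of "k0 + j"] G_mono[of "k0 + j"] G_mono[of "k0 + j + N"] by simp
  qed
  have prog: "G (k0 + N * k) = G k0 + g * k" for k
  proof (induction k)
    case (Suc k)
    then show ?case using step[of "N * k"] by (simp add: algebra_simps)
  qed simp
  have "0 < g"
  proof (rule ccontr)
    assume "\<not> 0 < g"
    \<comment> \<open>If \<open>g\<close> were 0, \<open>G\<close> would be bounded by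
      \<open>G k0\<close>; but every number, in particular this one, occurs in some ball.\<close>
    define n where "n = Suc (G k0)"
    have "n \<in> ball (nm n)" by (simp add: ball_def)
    then have "n \<le> G (nm n)" by (rule G_max)
    also have "nm n \<le> k0 + N * nm n" using N by (simp add: trans_le_add2)
    then have "G (nm n) \<le> G (k0 + N * nm n)" by (rule le)
    also have "\<dots> = G k0" using prog \<open>\<not> 0 < g\<close> by simp
    finally show False by (simp add: n_def)
  qed
  then show ?thesis using prog by blast
qed

text \<open>The relation reads \<open>g * n + G k0 = G k0 + g * k\<close> for the number
  \<open>n\<close> of \<open>x\<close>; it determines \<open>n\<close> because \<open>g\<close> is
  positive.\<close>

lemma index_val:
  assumes "0 < g" "\<And>k. G (k0 + N * k) = G k0 + g * k" "x \<in> Vec m \<int>"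
  shows "index g N (k0 + offset) \<int> (of_nat k) x \<longleftrightarrow> val x k"
proof -
  have eq: "of_nat N * of_nat k + of_nat (k0 + offset) = (of_nat ((k0 + N * k) + offset) :: 'r)"
    by (simp add: algebra_simps)
  show ?thesis
  proof
    assume "index g N (k0 + offset) \<int> (of_nat k) x"
    then obtain a b where ab: "a \<in> Vec m \<int>" "b \<in> Vec m \<int>" "fin \<int> x"
      "top \<int> (of_nat (k0 + offset)) a" "top \<int> (of_nat ((k0 + N * k) + offset)) b" "madd g \<int> x a b"
      unfolding index_def eq by blast
    then obtain n where n: "val x n" using fin_val[OF assms(3)] by blast
    have "val b (g * n + G k0)"
      using madd_val[OF n ab(2) top_imp_val[OF ab(1,4)]] ab(6) by blast
    then have "g * n + G k0 = G k0 + g * k"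
      using top_imp_val[OF ab(2,5)] val_unique assms(2) by metis
    then show "val x k" using n assms(1) by simp
  next
    assume x: "val x k"
    obtain a where a: "a \<in> Vec m \<int>" "top \<int> (of_nat (k0 + offset)) a" using top_ex by blast
    obtain b where b: "b \<in> Vec m \<int>" "top \<int> (of_nat ((k0 + N * k) + offset)) b" using top_ex by blast
    have "madd g \<int> x a b"
      using madd_val[OF x b(1) top_imp_val[OF a], of g] top_imp_val[OF b]
      by (simp add: assms(2) add.commute)
    moreover have "fin \<int> x" using fin_val[OF assms(3)] x by blast
    ultimately show "index g N (k0 + offset) \<int> (of_nat k) x"
      unfolding index_def eq using a b by blast
  qed
qed

text \<open>Over the integers \<open>index\<close> coincides with \<open>val\<close>, for which the
  clauses of \<open>embeds\<close> are properties of \<open>num\<close>. Being one definable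
  sentence, \<open>embeds\<close> then transfers to every group with enough division.\<close>

theorem embeds_in_large: "\<exists>R K. \<forall>H. zgroup K H \<longrightarrow> embeds R H"
proof -
  obtain N k0 g where g: "0 < g" "\<And>k. G (k0 + N * k) = G k0 + g * k"
    using G_arithmetic_progression by blast
  note index = index_val[OF g]
  let ?R = "index g N (k0 + offset)"
  have "embeds ?R \<int>"
    unfolding embeds_def nonneg_Ints ball_simps bex_simps
  proof (intro conjI allI ballI impI)
    show "\<exists>x\<in>Vec m \<int>. D \<int> x \<and> ?R \<int> (of_nat k) x" for k
      using val_ex[of k] index by (auto simp: val_def)
    show "?R \<int> (of_nat k + of_nat l) z"
      if "x \<in> Vec m \<int>" "y \<in> Vec m \<int>" "z \<in> Vec m \<int>" "?R \<int> (of_nat k) x" "?R \<int> (of_nat l) y" "A \<int> x y z"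
      for k l x y z
      using that index[of z "k + l"] by (simp add: index A_val)
    show "\<exists>l. ?R \<int> (of_nat l) y"
      if "x \<in> Vec m \<int>" "y \<in> Vec m \<int>" "?R \<int> (of_nat k) x" "le \<int> y x" for k x y
      using that by (auto simp: index le_val)
    show "(of_nat k :: 'r) = of_nat l"
      if "x \<in> Vec m \<int>" "y \<in> Vec m \<int>" "?R \<int> (of_nat k) x" "?R \<int> (of_nat l) y" "E \<int> x y"
      for k l x y
      using that by (simp add: index E_val) (metis val_unique)
  qed
  moreover have "definable (\<lambda>H (e :: unit \<Rightarrow> 'r). embeds ?R H)" by (rule embeds_definable)
  from definable_transfer[OF this]
  obtain K where "\<forall>H. zgroup K H \<longrightarrow> embeds ?R H = embeds ?R \<int>" by blast
  ultimately show ?thesis by blast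
qed

end

section \<open>Structures and interpretations\<close>

lemma tm_val_cong: "(\<And>x. x \<in> tm_vars t \<Longrightarrow> e x = e' x) \<Longrightarrow> tm_val M e t = tm_val M e' t"
proof (induction t)
  case (Fun f ts)
  then have "map (tm_val M e) ts = map (tm_val M e') ts" by auto
  then show ?case by (simp only: tm_val.simps)
qed simp

lemma sat_cong: "(\<And>x. x \<in> fm_vars \<phi> \<Longrightarrow> e x = e' x) \<Longrightarrow> sat M e \<phi> = sat M e' \<phi>"
proof (induction \<phi> arbitrary: e e')
  case (Eq s t)
  then show ?case using tm_val_cong[of s e e' M] tm_val_cong[of t e e' M] by simp
next
  case (Pred p ts)
  have "tm_val M e t = tm_val M e' t" if "t \<in> set ts" for t
    by (rule tm_val_cong, rule Pred.prems) (use that in auto)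
  then have "map (tm_val M e) ts = map (tm_val M e') ts" by simp
  then show ?case by (simp only: sat.simps)
next
  case (Neg \<phi>)
  have "sat M e \<phi> = sat M e' \<phi>" by (rule Neg.IH; use Neg.prems in simp)
  then show ?case by simp
next
  case (Conj \<phi> \<psi>)
  have "sat M e \<phi> = sat M e' \<phi>" "sat M e \<psi> = sat M e' \<psi>"
    by (rule Conj.IH; use Conj.prems in simp)+
  then show ?case by simp
next
  case (Exi v \<phi>)
  have "sat M (e(v := a)) \<phi> = sat M (e'(v := a)) \<phi>" for a
    by (rule Exi.IH) (use Exi.prems in auto)
  then show ?case by simp
qed

lemma true_in_sentence:
  assumes "fm_vars \<phi> = {}" "range e \<subseteq> carr M"
  shows "true_in M \<phi> \<longleftrightarrow> sat M e \<phi>"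
  unfolding true_in_def using assms sat_cong[of \<phi> _ e M] by blast

lemma wf_tm_presb_cases [consumes 1, case_names Var Plus]:
  assumes "wf_tm presb_lang t"
  obtains x where "t = Var x" | a b where "t = Fun Plus [a, b]" "wf_tm presb_lang a" "wf_tm presb_lang b"
proof (cases t)
  case (Fun f ts)
  have "length ts = 2" using assms Fun by (simp add: presb_lang_def)
  then obtain a b where "ts = [a, b]" by (auto simp: length_Suc_conv numeral_2_eq_2)
  then show ?thesis using that(2) Fun assms by (cases f) auto
qed (use that in blast)

lemma wf_tm_presb_induct [consumes 1, case_names Var Plus]:
  assumes "wf_tm presb_lang t" "\<And>x. Q (Var x)"
    "\<And>a b. wf_tm presb_lang a \<Longrightarrow> wf_tm presb_lang b \<Longrightarrow> Q a \<Longrightarrow> Q b \<Longrightarrow> Q (Fun Plus [a, b])"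
  shows "Q t"
  using assms(1)
proof (induction t)
  case (Fun f ts)
  from Fun.prems show ?case
  proof (cases rule: wf_tm_presb_cases)
    case (Plus a b)
    then show ?thesis using Fun.IH assms(3) by auto
  qed simp
qed (rule assms(2))

definition presb_iso where
  "presb_iso h M M' \<longleftrightarrow> inj_on h (carr M) \<and> h ` carr M = carr M' \<and>
     (\<forall>x\<in>carr M. \<forall>y\<in>carr M. fun_in M Plus [x, y] \<in> carr M \<and>
        h (fun_in M Plus [x, y]) = fun_in M' Plus [h x, h y])"

lemma tm_val_iso:
  assumes "presb_iso h M M'" "wf_tm presb_lang t" "range e \<subseteq> carr M"
  shows "tm_val M e t \<in> carr M \<and> h (tm_val M e t) = tm_val M' (h \<circ> e) t"
  using assms(2)
proof (induction t rule: wf_tm_presb_induct)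
  case (Plus a b)
  then show ?case using assms(1) by (simp add: presb_iso_def)
qed (use assms(3) in auto)

lemma sat_iso:
  assumes "presb_iso h M M'" "wf_fm presb_lang \<phi>" "range e \<subseteq> carr M"
  shows "sat M e \<phi> \<longleftrightarrow> sat M' (h \<circ> e) \<phi>"
  using assms(2,3)
proof (induction \<phi> arbitrary: e)
  case (Eq s t)
  have s: "tm_val M e s \<in> carr M \<and> h (tm_val M e s) = tm_val M' (h \<circ> e) s"
    and t: "tm_val M e t \<in> carr M \<and> h (tm_val M e t) = tm_val M' (h \<circ> e) t"
    using Eq by (auto intro!: tm_val_iso[OF assms(1)])
  have "inj_on h (carr M)" using assms(1) by (simp add: presb_iso_def)
  then have "h (tm_val M e s) = h (tm_val M e t) \<longleftrightarrow> tm_val M e s = tm_val M e t"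
    using s t by (intro inj_on_eq_iff) auto
  then show ?case
    unfolding sat.simps s[THEN conjunct2] t[THEN conjunct2] by (rule sym)
next
  case (Pred p ts)
  then show ?case by (simp add: presb_lang_def)
next
  case (Exi v \<phi>)
  have "sat M (e(v := a)) \<phi> \<longleftrightarrow> sat M' ((h \<circ> e)(v := h a)) \<phi>" if "a \<in> carr M" for a
  proof -
    have "h \<circ> e(v := a) = (h \<circ> e)(v := h a)" by auto
    moreover have "range (e(v := a)) \<subseteq> carr M" using Exi.prems that by auto
    ultimately show ?thesis using Exi.IH[of "e(v := a)"] Exi.prems(1) by (simp only: wf_fm.simps)
  qed
  moreover have "carr M' = h ` carr M" using assms(1) by (simp add: presb_iso_def)
  ultimately show ?case by (simp add: comp_def)
qed auto

definition nonneg_struct :: "'r::linordered_idom set \<Rightarrow> (presb_fun, unit, 'r) fo_struct" where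
  "nonneg_struct H = \<lparr>carr = nonneg H, fun_in = (\<lambda>_ xs. xs ! 0 + xs ! 1), pred_in = (\<lambda>_ _. False)\<rparr>"

text \<open>Interpretability speaks about models on the universe type \<open>'a\<close>, so the
  nonnegative part of a group is moved there along an injection.\<close>

definition copy_struct :: "('r::linordered_idom \<Rightarrow> 'a) \<Rightarrow> 'r set \<Rightarrow> (presb_fun, unit, 'a) fo_struct" where
  "copy_struct f H = \<lparr>carr = f ` nonneg H,
     fun_in = (\<lambda>_ xs. f (inv f (xs ! 0) + inv f (xs ! 1))),
     pred_in = (\<lambda>_ _. False)\<rparr>"

lemma presb_iso_of_nat: "presb_iso (of_nat :: nat \<Rightarrow> 'r::linordered_idom) nat_struct (nonneg_struct \<int>)"
  by (auto simp: presb_iso_def nat_struct_def nonneg_struct_def nonneg_Ints inj_on_def)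

lemma presb_iso_copy:
  assumes "zgroup K H" "inj f"
  shows "presb_iso f (nonneg_struct H) (copy_struct f H)"
  using assms nonneg_add[OF assms(1)] inj_on_subset[OF assms(2) subset_UNIV]
  by (auto simp: presb_iso_def nonneg_struct_def copy_struct_def)

lemma tm_val_linterm:
  "wf_tm presb_lang t \<Longrightarrow> \<exists>s :: (nat \<Rightarrow> 'r::linordered_idom) \<Rightarrow> 'r. linterm s \<and> (\<forall>H e. tm_val (nonneg_struct H) e t = s e)"
proof (induction t rule: wf_tm_presb_induct)
  case (Var x)
  show ?case by (intro exI[of _ "\<lambda>e. e x"]) (simp add: linterm_var)
next
  case (Plus a b)
  then obtain s s' :: "(nat \<Rightarrow> 'r) \<Rightarrow> 'r" where "linterm s" "\<forall>H e. tm_val (nonneg_struct H) e a = s e"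
    "linterm s'" "\<forall>H e. tm_val (nonneg_struct H) e b = s' e" by blast
  then show ?case
    by (intro exI[of _ "\<lambda>e. s e + s' e"]) (simp add: linterm_add nonneg_struct_def)
qed

text \<open>Quantifiers in \<open>sat\<close> range over \<open>nonneg H\<close>, just as in
  \<open>definable_ex_upd\<close>; this links the syntax to the uniform elimination.\<close>

lemma sat_definable:
  "wf_fm presb_lang \<phi> \<Longrightarrow> definable (\<lambda>H (e :: nat \<Rightarrow> 'r::linordered_idom). sat (nonneg_struct H) e \<phi>)"
proof (induction \<phi>)
  case (Eq s t)
  then obtain s' t' :: "(nat \<Rightarrow> 'r) \<Rightarrow> 'r" where "linterm s'" "\<forall>H e. tm_val (nonneg_struct H) e s = s' e"
    "linterm t'" "\<forall>H e. tm_val (nonneg_struct H) e t = t' e"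
    using tm_val_linterm[of s] tm_val_linterm[of t] by auto
  then show ?case by (simp add: definable_eq)
next
  case (Pred p ts)
  then show ?case by (simp add: presb_lang_def)
next
  case (Exi v \<phi>)
  have "carr (nonneg_struct H) = nonneg H" for H :: "'r set" by (simp add: nonneg_struct_def)
  then show ?case using definable_ex_upd[OF Exi.IH, of v] Exi.prems by (simp del: fun_upd_apply)
qed (simp_all add: definable_neg definable_conj)

lemma concat_uniform_nth:
  "(\<And>v. v \<in> set vs \<Longrightarrow> length v = m) \<Longrightarrow> i < length vs * m \<Longrightarrow> concat vs ! i = vs ! (i div m) ! (i mod m)"
proof (induction vs arbitrary: i)
  case (Cons v vs)
  show ?case
  proof (cases "i < m")
    case True
    then show ?thesis using Cons.prems by (simp add: nth_append)
  next
    case False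
    moreover have "0 < m" using Cons.prems by (cases m) auto
    ultimately have "i div m = Suc ((i - m) div m)" "i mod m = (i - m) mod m"
      by (simp_all add: le_div_geq le_mod_geq)
    then show ?thesis
      using False Cons.IH[of "i - m"] Cons.prems by (simp add: nth_append)
  qed
qed simp

text \<open>The environment used by \<open>holds\<close> is unspecified beyond the given vectors.
  Putting 0 there instead keeps it inside \<open>nonneg H\<close>, as the isomorphism requires, and
  changes nothing on the free variables.\<close>

lemma holds_copy:
  assumes H: "zgroup K H" and f: "inj f" and \<phi>: "fm_in_vars presb_lang k \<phi>"
    and vs: "\<And>v. v \<in> set vs \<Longrightarrow> v \<in> Vec m H" "length vs * m = k"
  shows "holds (copy_struct f H) \<phi> (map (map f) vs) \<longleftrightarrow>
    sat (nonneg_struct H) (\<lambda>i. if i < k then vs ! (i div m) ! (i mod m) else 0) \<phi>"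
proof -
  let ?e = "\<lambda>i. if i < k then vs ! (i div m) ! (i mod m) else 0"
  have wf: "wf_fm presb_lang \<phi>" "fm_vars \<phi> \<subseteq> {..<k}" using \<phi> by (auto simp: fm_in_vars_def)
  have len: "length v = m" if "v \<in> set vs" for v using vs(1)[OF that] by (simp add: Vec_def)
  have div: "i div m < length vs" "i mod m < m" if "i < k" for i
  proof -
    have "0 < m" using that vs(2) by (cases m) auto
    then show "i div m < length vs" "i mod m < m" using that vs(2) by (auto simp: less_mult_imp_div_less)
  qed
  have "?e i \<in> nonneg H" for i
  proof (cases "i < k")
    case True
    then have "vs ! (i div m) \<in> Vec m H" using vs(1) div by simp
    then show ?thesis using div[OF True] True by (auto simp: Vec_def)
  qed (simp add: nonneg_zero[OF H])
  then have "range ?e \<subseteq> carr (nonneg_struct H)" unfolding nonneg_struct_def by fastforce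
  from sat_iso[OF presb_iso_copy[OF H f] wf(1) this]
  have "sat (nonneg_struct H) ?e \<phi> \<longleftrightarrow> sat (copy_struct f H) (f \<circ> ?e) \<phi>" .
  also have "\<dots> \<longleftrightarrow> sat (copy_struct f H) (\<lambda>i. concat (map (map f) vs) ! i) \<phi>"
  proof (rule sat_cong)
    fix i assume "i \<in> fm_vars \<phi>"
    then have i: "i < k" using wf(2) by auto
    have "concat (map (map f) vs) ! i = map (map f) vs ! (i div m) ! (i mod m)"
      using len i vs(2) by (intro concat_uniform_nth) auto
    also have "\<dots> = f (vs ! (i div m) ! (i mod m))"
      using div[OF i] len by simp
    finally show "(f \<circ> ?e) i = concat (map (map f) vs) ! i" using i by simp
  qed
  finally show ?thesis by (simp add: holds_def)
qed

lemma definable_holds: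
  assumes f: "inj f" and \<phi>: "fm_in_vars presb_lang (k * m) \<phi>"
  shows "definable (\<lambda>H (e :: nat \<times> nat \<Rightarrow> 'r::linordered_idom).
    holds (copy_struct f H) \<phi> (map (map f) (map (\<lambda>j. var_vec m j e) [0..<k])))"
proof -
  define t :: "nat \<Rightarrow> (nat \<times> nat \<Rightarrow> 'r) \<Rightarrow> 'r"
    where "t = (\<lambda>i e. if i < k * m then e (i div m, i mod m) else 0)"
  have lin: "linterm (t i)" for i
    by (cases "i < k * m") (auto simp: t_def linterm_var linterm_zero)
  have "definable (\<lambda>H e. sat (nonneg_struct H) e \<phi>)"
    using \<phi> by (intro sat_definable) (simp add: fm_in_vars_def)
  from definable_subst[where t = t, OF this lin]
  have D: "definable (\<lambda>H e. sat (nonneg_struct H) (\<lambda>i. t i e) \<phi>)" .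
  show ?thesis
  proof (rule definable_cong[OF D])
    fix H and e :: "nat \<times> nat \<Rightarrow> 'r" assume H: "zgroup 0 H" and e: "range e \<subseteq> nonneg H"
    let ?vs = "map (\<lambda>j. var_vec m j e) [0..<k]"
    have "(\<lambda>i. if i < k * m then ?vs ! (i div m) ! (i mod m) else 0) = (\<lambda>i. t i e)"
    proof
      fix i
      show "(if i < k * m then ?vs ! (i div m) ! (i mod m) else 0) = t i e"
      proof (cases "i < k * m")
        case True
        then have "0 < m" by (cases m) auto
        then show ?thesis using True by (simp add: t_def less_mult_imp_div_less)
      qed (simp add: t_def)
    qed
    moreover have "v \<in> Vec m H" if "v \<in> set ?vs" for v
      using that e by (auto simp: Vec_def image_subset_iff)
    then have "holds (copy_struct f H) \<phi> (map (map f) ?vs) =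
        sat (nonneg_struct H) (\<lambda>i. if i < k * m then ?vs ! (i div m) ! (i mod m) else 0) \<phi>"
      by (rule holds_copy[OF H f \<phi>]) simp_all
    ultimately show "holds (copy_struct f H) \<phi> (map (map f) ?vs) = sat (nonneg_struct H) (\<lambda>i. t i e) \<phi>"
      by (simp only:)
  qed
qed


section \<open>Sentences true in the natural numbers hold in groups with enough division\<close>

lemma nat_struct_sat_Ints:
  assumes "\<phi> \<in> sentences presb_lang"
  shows "true_in nat_struct \<phi> \<longleftrightarrow> sat (nonneg_struct (\<int> :: 'r::linordered_idom set)) (\<lambda>_. 0) \<phi>"
proof -
  have "true_in nat_struct \<phi> \<longleftrightarrow> sat nat_struct (\<lambda>_. 0) \<phi>"
    using assms by (intro true_in_sentence) (auto simp: sentences_def nat_struct_def)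
  also have "\<dots> \<longleftrightarrow> sat (nonneg_struct (\<int> :: 'r set)) (of_nat \<circ> (\<lambda>_. 0)) \<phi>"
    using assms by (intro sat_iso[OF presb_iso_of_nat]) (auto simp: sentences_def nat_struct_def)
  finally show ?thesis by (simp add: comp_def)
qed

lemma copy_struct_sat_sentence:
  assumes "\<phi> \<in> sentences presb_lang" "zgroup K H" "inj f"
  shows "true_in (copy_struct f H) \<phi> \<longleftrightarrow> sat (nonneg_struct H) (\<lambda>_. 0) \<phi>"
proof -
  have "range (\<lambda>_ :: nat. f 0) \<subseteq> carr (copy_struct f H)"
    using nonneg_zero[OF assms(2)] by (auto simp: copy_struct_def)
  then have "true_in (copy_struct f H) \<phi> \<longleftrightarrow> sat (copy_struct f H) (\<lambda>_. f 0) \<phi>"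
    using assms(1) by (intro true_in_sentence) (auto simp: sentences_def)
  also have "\<dots> \<longleftrightarrow> sat (nonneg_struct H) (\<lambda>_. 0) \<phi>"
    using sat_iso[OF presb_iso_copy[OF assms(2,3)], of \<phi> "\<lambda>_. 0"] assms(1) nonneg_zero[OF assms(2)]
    by (simp add: sentences_def comp_def nonneg_struct_def)
  finally show ?thesis .
qed

lemma is_struct_copy:
  assumes "zgroup K H" "inj f"
  shows "is_struct presb_lang (copy_struct f H)"
  unfolding is_struct_def
proof (intro conjI allI impI)
  show "carr (copy_struct f H) \<noteq> {}"
    using nonneg_zero[OF assms(1)] by (auto simp: copy_struct_def)
  fix g n and xs :: "'b list"
  assume "fun_ar presb_lang g = Some n" "length xs = n" and xs: "set xs \<subseteq> carr (copy_struct f H)"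
  then have "length xs = 2" by (simp add: presb_lang_def)
  then have "xs ! 0 \<in> f ` nonneg H" "xs ! 1 \<in> f ` nonneg H"
    using xs by (auto simp: copy_struct_def subset_iff)
  then show "fun_in (copy_struct f H) g xs \<in> carr (copy_struct f H)"
    using nonneg_add[OF assms(1)] assms(2) by (auto simp: copy_struct_def)
qed

lemma transfer_sentence:
  fixes \<phi> :: "(presb_fun, unit) fm"
  assumes "\<phi> \<in> sentences presb_lang" "true_in nat_struct \<phi>" "inj f"
  shows "\<exists>K. \<forall>H :: 'r::linordered_idom set. zgroup K H \<longrightarrow> true_in (copy_struct f H) \<phi>"
proof -
  have "definable (\<lambda>H (e :: nat \<Rightarrow> 'r). sat (nonneg_struct H) e \<phi>)"
    using assms(1) by (intro sat_definable) (simp add: sentences_def)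
  from definable_transfer[OF this] obtain K where
    K: "\<forall>H :: 'r set. zgroup K H \<longrightarrow> sat (nonneg_struct H) (\<lambda>_. 0) \<phi> = sat (nonneg_struct (\<int> :: 'r set)) (\<lambda>_. 0) \<phi>"
    by (elim exE)
  show ?thesis
    using K assms(2,3) unfolding nat_struct_sat_Ints[OF assms(1), where 'r = 'r]
    by (intro exI[of _ K]) (auto simp: copy_struct_sat_sentence[OF assms(1)])
qed

lemma transfer_finite:
  fixes F :: "(presb_fun, unit) fm set"
  assumes "finite F" "F \<subseteq> sentences presb_lang" "\<And>\<phi>. \<phi> \<in> F \<Longrightarrow> true_in nat_struct \<phi>" "inj f"
  shows "\<exists>K. \<forall>H :: 'r::linordered_idom set. zgroup K H \<longrightarrow> is_model presb_lang F (copy_struct f H)"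
proof -
  have "\<forall>\<phi>\<in>F. \<exists>K. \<forall>H :: 'r set. zgroup K H \<longrightarrow> true_in (copy_struct f H) \<phi>"
    using transfer_sentence assms(2-4) by blast
  from bchoice[OF this] obtain k where
    k: "\<forall>\<phi>\<in>F. \<forall>H :: 'r set. zgroup (k \<phi>) H \<longrightarrow> true_in (copy_struct f H) \<phi>" ..
  \<comment> \<open>The sum serves only as a common upper bound for the finitely many
    thresholds.\<close>
  have "is_model presb_lang F (copy_struct f H)" if H: "zgroup (\<Sum>\<phi>\<in>F. k \<phi>) H" for H :: "'r set"
    unfolding is_model_def
  proof (intro conjI ballI)
    show "is_struct presb_lang (copy_struct f H)" using is_struct_copy[OF H assms(4)] .
    fix \<phi> assume "\<phi> \<in> F"
    then have "k \<phi> \<le> (\<Sum>\<phi>\<in>F. k \<phi>)" using assms(1) by (intro member_le_sum) auto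
    from zgroup_mono[OF H this] show "true_in (copy_struct f H) \<phi>" using k \<open>\<phi> \<in> F\<close> by blast
  qed
  then show ?thesis by blast
qed

text \<open>\<open>K0\<close> stands for the threshold from which on the copies are models of the
  finite axioms, so that the interpretation works in them.\<close>

locale presb_interpretation =
  fixes \<iota> :: "(presb_fun, unit, presb_fun, unit) interp" and f :: "'r::linordered_idom \<Rightarrow> 'a"
    and K0 :: nat and m :: nat
  assumes wf: "wf_interp presb_lang presb_lang \<iota>"
    and inj: "inj f"
    and interp: "\<And>H. zgroup K0 H \<Longrightarrow> interprets_in_model presb_lang PrA \<iota> (copy_struct f H)"
    and m_def: "m = int_dim \<iota>"
begin

abbreviation M :: "'r set \<Rightarrow> (presb_fun, unit, 'a) fo_struct" where "M H \<equiv> copy_struct f H"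

abbreviation J :: "'r set \<Rightarrow> (presb_fun, unit, 'a list set) fo_struct" where
  "J H \<equiv> internal_model \<iota> (M H)"

definition D :: "'r set \<Rightarrow> 'r list \<Rightarrow> bool" where
  "D H x \<longleftrightarrow> map f x \<in> dom_set \<iota> (M H)"

definition cl :: "'r set \<Rightarrow> 'r list \<Rightarrow> 'a list set" where
  "cl H x = eq_rel \<iota> (M H) `` {map f x}"

definition pl :: "'r set \<Rightarrow> 'a list set \<Rightarrow> 'a list set \<Rightarrow> 'a list set" where
  "pl H X Y = fun_in (J H) Plus [X, Y]"

lemma interp_in_M: "zgroup K0 H \<Longrightarrow> interp_in presb_lang \<iota> (M H)"
  and model_J: "zgroup K0 H \<Longrightarrow> is_model presb_lang PrA (J H)"
  using interp by (auto simp: interprets_in_model_def)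

lemma equiv_M: "zgroup K0 H \<Longrightarrow> equiv (dom_set \<iota> (M H)) (eq_rel \<iota> (M H))"
  using interp_in_M by (simp add: interp_in_def)

lemma dom_set_M:
  assumes "d \<in> dom_set \<iota> (M H)"
  obtains x where "x \<in> Vec m H" "D H x" "d = map f x"
proof -
  have d: "length d = m" "set d \<subseteq> f ` nonneg H"
    using assms by (auto simp: dom_set_def copy_struct_def m_def)
  define x where "x = map (inv f) d"
  have x: "map f x = d"
    unfolding x_def map_map using d(2) by (intro map_idI) (auto simp: f_inv_into_f)
  have "x \<in> Vec m H" using d inj by (auto simp: x_def Vec_def subset_iff)
  moreover have "D H x" unfolding D_def x by (rule assms)
  ultimately show ?thesis using x[symmetric] by (rule that)
qed

lemma carr_J:
  assumes "zgroup K0 H"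
  shows "carr (J H) = cl H ` {x \<in> Vec m H. D H x}"
proof -
  have "carr (J H) = (\<lambda>d. eq_rel \<iota> (M H) `` {d}) ` dom_set \<iota> (M H)"
    by (auto simp: internal_model_def quotient_def)
  also have "\<dots> = cl H ` {x \<in> Vec m H. D H x}"
  proof
    show "cl H ` {x \<in> Vec m H. D H x} \<subseteq> (\<lambda>d. eq_rel \<iota> (M H) `` {d}) ` dom_set \<iota> (M H)"
      by (auto simp: cl_def D_def)
    show "(\<lambda>d. eq_rel \<iota> (M H) `` {d}) ` dom_set \<iota> (M H) \<subseteq> cl H ` {x \<in> Vec m H. D H x}"
    proof (rule image_subsetI)
      fix d assume "d \<in> dom_set \<iota> (M H)"
      then obtain x where "x \<in> Vec m H" "D H x" "d = map f x" by (rule dom_set_M)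
      then show "eq_rel \<iota> (M H) `` {d} \<in> cl H ` {x \<in> Vec m H. D H x}"
        by (intro image_eqI[of _ _ x]) (simp_all add: cl_def)
    qed
  qed
  finally show ?thesis .
qed

lemma cl_eq_iff:
  "zgroup K0 H \<Longrightarrow> D H x \<Longrightarrow> D H y \<Longrightarrow> cl H x = cl H y \<longleftrightarrow> (map f x, map f y) \<in> eq_rel \<iota> (M H)"
  unfolding cl_def D_def by (rule eq_equiv_class_iff[OF equiv_M])

text \<open>The formula for \<open>Plus\<close> need not be closed under equivalence in its value,
  so it holds of some vector \<open>w\<close> equivalent to \<open>z\<close> rather than of
  \<open>z\<close> itself. Functionality modulo equivalence makes the representatives
  \<open>x\<close> and \<open>y\<close> sufficient.\<close>

lemma pl_cl_iff:
  assumes H: "zgroup K0 H" and D: "D H x" "D H y" "D H z"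
  shows "pl H (cl H x) (cl H y) = cl H z \<longleftrightarrow>
    (\<exists>w\<in>Vec m H. D H w \<and> holds (M H) (int_fun \<iota> Plus) (map (map f) [x, y, w]) \<and>
      (map f w, map f z) \<in> eq_rel \<iota> (M H))"
proof -
  let ?r = "eq_rel \<iota> (M H)" and ?d = "dom_set \<iota> (M H)" and ?h = "holds (M H) (int_fun \<iota> Plus)"
  have eqv: "equiv ?d ?r" using equiv_M[OF H] .
  have sym: "(b, a) \<in> ?r" if "(a, b) \<in> ?r" for a b using eqv that by (meson equivE symD)
  have trans: "(a, c) \<in> ?r" if "(a, b) \<in> ?r" "(b, c) \<in> ?r" for a b c
    using eqv that by (meson equivE transD)
  have refl: "(a, a) \<in> ?r" if "a \<in> ?d" for a using eqv that by (meson equivE refl_onD)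
  have ar: "fun_ar presb_lang Plus = Some 2" by (simp add: presb_lang_def)
  have total: "\<exists>w\<in>?d. ?h [a, b, w]" if "a \<in> ?d" "b \<in> ?d" for a b
    using interp_in_M[OF H] ar that
    by (auto simp: interp_in_def dest!: spec[of _ Plus] spec[of _ "2 :: nat"] spec[of _ "[a, b]"])
  have functional: "(v, w) \<in> ?r"
    if "(a, a') \<in> ?r" "(b, b') \<in> ?r" "v \<in> ?d" "w \<in> ?d" "?h [a, b, v]" "?h [a', b', w]" for a a' b b' v w
  proof -
    have "\<forall>xss yss. length xss = 2 \<longrightarrow> eq_lists \<iota> (M H) xss yss \<longrightarrow>
        (\<forall>x\<in>?d. \<forall>y\<in>?d. ?h (xss @ [x]) \<longrightarrow> ?h (yss @ [y]) \<longrightarrow> (x, y) \<in> ?r)"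
      using interp_in_M[OF H] ar unfolding interp_in_def by blast
    from this[rule_format, of "[a, b]" "[a', b']" v w] show ?thesis using that by simp
  qed
  have pl: "u \<in> pl H (cl H x) (cl H y) \<longleftrightarrow>
      (\<exists>a b. (map f x, a) \<in> ?r \<and> (map f y, b) \<in> ?r \<and> (\<exists>v\<in>?d. ?h [a, b, v] \<and> (v, u) \<in> ?r))" for u
  proof -
    have pair: "list_all2 (\<in>) xss [A, B] \<longleftrightarrow> (\<exists>a b. a \<in> A \<and> b \<in> B \<and> xss = [a, b])"
      for xss and A B :: "'a list set"
      by (auto simp: list_all2_Cons2)
    have "u \<in> pl H (cl H x) (cl H y) \<longleftrightarrow> (\<exists>xss. list_all2 (\<in>) xss [cl H x, cl H y] \<and>
        (\<exists>v\<in>?d. ?h (xss @ [v]) \<and> (v, u) \<in> ?r))"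
      by (simp add: pl_def internal_model_def)
    also have "\<dots> \<longleftrightarrow> (\<exists>a b. (a \<in> cl H x \<and> b \<in> cl H y) \<and> (\<exists>v\<in>?d. ?h ([a, b] @ [v]) \<and> (v, u) \<in> ?r))"
      unfolding pair by blast
    finally show ?thesis by (simp add: cl_def)
  qed
  have dxy: "map f x \<in> ?d" "map f y \<in> ?d" "map f z \<in> ?d" using D by (simp_all add: D_def)
  show ?thesis
  proof
    assume eq: "pl H (cl H x) (cl H y) = cl H z"
    obtain w where w: "w \<in> ?d" "?h [map f x, map f y, w]" using total dxy by blast
    then have "w \<in> pl H (cl H x) (cl H y)" using pl refl dxy by blast
    then have "w \<in> cl H z" using eq by simp
    then have "(map f z, w) \<in> ?r" by (simp add: cl_def)
    then have "(w, map f z) \<in> ?r" by (rule sym)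
    moreover obtain w' where "w' \<in> Vec m H" "D H w'" "w = map f w'" using w(1) by (rule dom_set_M)
    ultimately show "\<exists>w\<in>Vec m H. D H w \<and> ?h (map (map f) [x, y, w]) \<and> (map f w, map f z) \<in> ?r"
      using w(2) by auto
  next
    assume "\<exists>w\<in>Vec m H. D H w \<and> ?h (map (map f) [x, y, w]) \<and> (map f w, map f z) \<in> ?r"
    then obtain w where w: "map f w \<in> ?d" "?h [map f x, map f y, map f w]" "(map f w, map f z) \<in> ?r"
      by (auto simp: D_def)
    have "u \<in> pl H (cl H x) (cl H y) \<longleftrightarrow> (map f z, u) \<in> ?r" for u
      unfolding pl using w functional refl sym trans dxy by meson
    then show "pl H (cl H x) (cl H y) = cl H z" by (auto simp: cl_def)
  qed
qed


lemma int_formulas: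
  "fm_in_vars presb_lang (1 * m) (int_dom \<iota>)" "fm_in_vars presb_lang (2 * m) (int_eq \<iota>)"
  "fm_in_vars presb_lang (3 * m) (int_fun \<iota> Plus)"
  using wf by (auto simp: wf_interp_def m_def presb_lang_def)

lemma vecrel_D: "vecrel1 m D"
  unfolding vecrel1_def
  by (rule definable_cong[OF definable_holds[OF inj int_formulas(1)], of 0])
    (auto simp: D_def dom_set_def m_def copy_struct_def image_subset_iff)

lemma vecrel_int_eq: "vecrel2 m (\<lambda>H x y. holds (M H) (int_eq \<iota>) (map (map f) [x, y]))"
  using definable_holds[OF inj int_formulas(2)]
  by (simp add: vecrel2_def numeral_2_eq_2)

lemma vecrel_int_fun: "vecrel3 m (\<lambda>H x y z. holds (M H) (int_fun \<iota> Plus) (map (map f) [x, y, z]))"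
  using definable_holds[OF inj int_formulas(3)]
  by (simp add: vecrel3_def numeral_3_eq_3 numeral_2_eq_2)

lemma E_iff:
  "zgroup K0 H \<Longrightarrow> D H x \<and> D H y \<and> cl H x = cl H y \<longleftrightarrow>
    D H x \<and> D H y \<and> holds (M H) (int_eq \<iota>) (map (map f) [x, y])"
  using cl_eq_iff[of H x y] by (auto simp: eq_rel_def D_def)

text \<open>Rewrites the addition graph with the domain guards repeated around the equivalence, so
  that each piece is covered by \<open>vecrel_D\<close>, \<open>vecrel_int_fun\<close> or
  \<open>vecrel_E\<close>.\<close>

lemma A_iff:
  assumes "zgroup K0 H"
  shows "D H x \<and> D H y \<and> D H z \<and> pl H (cl H x) (cl H y) = cl H z \<longleftrightarrow>
    D H x \<and> D H y \<and> D H z \<and>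
      (\<exists>w\<in>Vec m H. D H w \<and> holds (M H) (int_fun \<iota> Plus) (map (map f) [x, y, w]) \<and>
        (D H w \<and> D H z \<and> cl H w = cl H z))"
  using pl_cl_iff[OF assms, of x y z] cl_eq_iff[OF assms, of _ z] by blast

lemma vecrel_E: "vecrel2 m (\<lambda>H x y. D H x \<and> D H y \<and> cl H x = cl H y)"
  unfolding vecrel2_def
proof (rule definable_cong)
  show "definable (\<lambda>H e. D H (var_vec m 0 e) \<and> D H (var_vec m 1 e) \<and>
      holds (M H) (int_eq \<iota>) (map (map f) [var_vec m 0 e, var_vec m 1 e]))"
    by (intro definable_conj vecrel1D[OF vecrel_D] vecrel2D[OF vecrel_int_eq] vecterm_var)
qed (rule E_iff)

lemma vecrel_A: "vecrel3 m (\<lambda>H x y z. D H x \<and> D H y \<and> D H z \<and> pl H (cl H x) (cl H y) = cl H z)"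
  unfolding vecrel3_def
proof (rule definable_cong)
  show "definable (\<lambda>H e. D H (var_vec m 0 e) \<and> D H (var_vec m 1 e) \<and> D H (var_vec m 2 e) \<and>
      (\<exists>w\<in>Vec m H. D H w \<and>
        holds (M H) (int_fun \<iota> Plus) (map (map f) [var_vec m 0 e, var_vec m 1 e, w]) \<and>
        (D H w \<and> D H (var_vec m 2 e) \<and> cl H w = cl H (var_vec m 2 e))))"
    by (intro definable_conj vecrel1D[OF vecrel_D] definable_ex_Vec vecrel3D[OF vecrel_int_fun]
        vecrel2D[OF vecrel_E] vecterm_var)
qed (rule A_iff)

end

section \<open>Presburger sentences and the non-interpretability theorem\<close>

abbreviation Add :: "presb_fun tm \<Rightarrow> presb_fun tm \<Rightarrow> presb_fun tm" where
  "Add s t \<equiv> Fun Plus [s, t]"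
abbreviation All :: "nat \<Rightarrow> ('f, 'p) fm \<Rightarrow> ('f, 'p) fm" where
  "All x \<phi> \<equiv> Neg (Exi x (Neg \<phi>))"
abbreviation Imp :: "('f, 'p) fm \<Rightarrow> ('f, 'p) fm \<Rightarrow> ('f, 'p) fm" where
  "Imp \<phi> \<psi> \<equiv> Neg (Conj \<phi> (Neg \<psi>))"

text \<open>The language has no constants, so zero (variable 0) and one (variable 1) are quantified
  once around all the axioms. One sentence thus fixes a single pair for all of them.\<close>

definition monoid_sentence :: "(presb_fun, unit) fm" where
  "monoid_sentence = Exi 0 (Exi 1 (All 2 (All 3 (All 4
     (Conj (Eq (Add (Add (Var 2) (Var 3)) (Var 4)) (Add (Var 2) (Add (Var 3) (Var 4))))
     (Conj (Eq (Add (Var 2) (Var 3)) (Add (Var 3) (Var 2)))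
     (Conj (Eq (Add (Var 0) (Var 2)) (Var 2))
     (Conj (Imp (Eq (Add (Var 2) (Var 3)) (Add (Var 2) (Var 4))) (Eq (Var 3) (Var 4)))
     (Conj (Neg (Eq (Add (Var 1) (Var 2)) (Var 0)))
       (Imp (Neg (Eq (Var 2) (Var 0))) (Exi 5 (Eq (Var 2) (Add (Var 1) (Var 5))))))))))))))"

lemma sat_monoid_sentence:
  fixes M :: "(presb_fun, unit, 'c) fo_struct"
  defines "add \<equiv> \<lambda>a b. fun_in M Plus [a, b]"
  shows "sat M e monoid_sentence \<longleftrightarrow> (\<exists>z\<in>carr M. \<exists>u\<in>carr M. \<forall>x\<in>carr M. \<forall>y\<in>carr M. \<forall>w\<in>carr M.
      add (add x y) w = add x (add y w) \<and> add x y = add y x \<and> add z x = x \<and>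
      (add x y = add x w \<longrightarrow> y = w) \<and> add u x \<noteq> z \<and>
      (x \<noteq> z \<longrightarrow> (\<exists>v\<in>carr M. x = add u v)))"
proof -
  have All: "sat M e (All x \<phi>) \<longleftrightarrow> (\<forall>a\<in>carr M. sat M (e(x := a)) \<phi>)" for e x \<phi> by simp
  have Imp: "sat M e (Imp \<phi> \<psi>) \<longleftrightarrow> (sat M e \<phi> \<longrightarrow> sat M e \<psi>)" for e \<phi> \<psi> by simp
  show ?thesis
    unfolding monoid_sentence_def add_def
    by (simp only: All Imp sat.simps(4,5), simp only: sat.simps tm_val.simps list.map) simp
qed

lemma monoid_sentence_PrA: "monoid_sentence \<in> PrA"
proof -
  have "sat nat_struct e monoid_sentence" for e
    unfolding sat_monoid_sentence nat_struct_def
    by (rule bexI[of _ 0], rule bexI[of _ 1]) (auto simp: gr0_conv_Suc)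
  then show ?thesis
    by (auto simp: PrA_def elem_theory_def sentences_def true_in_def monoid_sentence_def presb_lang_def)
qed

text \<open>\<open>num\<close> iterates the addition of \<open>u\<close>. Below a numeral, copies of
  \<open>u\<close> can be stripped off one by one until zero is reached. An element that is no
  numeral exceeds every numeral, hence has infinitely many predecessors.\<close>

lemma standard_part:
  assumes zero: "z \<in> P" and one: "u \<in> P" and closed: "\<And>x y. x \<in> P \<Longrightarrow> y \<in> P \<Longrightarrow> add x y \<in> P"
    and assoc: "\<And>x y w. x \<in> P \<Longrightarrow> y \<in> P \<Longrightarrow> w \<in> P \<Longrightarrow> add (add x y) w = add x (add y w)"
    and comm: "\<And>x y. x \<in> P \<Longrightarrow> y \<in> P \<Longrightarrow> add x y = add y x"
    and zero_add: "\<And>x. x \<in> P \<Longrightarrow> add z x = x"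
    and cancel: "\<And>x y w. x \<in> P \<Longrightarrow> y \<in> P \<Longrightarrow> w \<in> P \<Longrightarrow> add x y = add x w \<Longrightarrow> y = w"
    and succ_nonzero: "\<And>x. x \<in> P \<Longrightarrow> add u x \<noteq> z"
    and pred: "\<And>x. x \<in> P \<Longrightarrow> x \<noteq> z \<Longrightarrow> \<exists>v\<in>P. x = add u v"
  shows "\<exists>num :: nat \<Rightarrow> 'c. (\<forall>n. num n \<in> P) \<and> (\<forall>a b. num a = num b \<longleftrightarrow> a = b) \<and>
    (\<forall>a b. add (num a) (num b) = num (a + b)) \<and>
    (\<forall>x\<in>P. \<forall>y\<in>P. \<forall>n. add x y = num n \<longrightarrow> (\<exists>a b. x = num a \<and> y = num b)) \<and>
    (\<forall>x\<in>P. finite {y\<in>P. \<exists>w\<in>P. add y w = x} \<longrightarrow> (\<exists>n. x = num n))"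
proof -
  define num where "num = rec_nat z (\<lambda>_. add u)"
  have num_0: "num 0 = z" and num_Suc: "num (Suc n) = add u (num n)" for n
    by (simp_all add: num_def)
  have P: "num n \<in> P" for n
    by (induction n) (auto simp: num_0 num_Suc zero one closed)
  have add: "add (num a) (num b) = num (a + b)" for a b
    by (induction a) (auto simp: num_0 num_Suc zero_add P assoc one)
  have eq: "num a = num b \<longleftrightarrow> a = b" for a b
  proof (induction a arbitrary: b)
    case 0
    show ?case using succ_nonzero[OF P] by (cases b) (auto simp: num_0 num_Suc dest: sym)
  next
    case (Suc a)
    show ?case
      using succ_nonzero[OF P] cancel[OF one P P] Suc.IH by (cases b) (auto simp: num_0 num_Suc)
  qed
  have initial: "\<exists>a b. x = num a \<and> y = num b" if "x \<in> P" "y \<in> P" "add x y = num n" for x y n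
    using that
  proof (induction n arbitrary: x)
    case 0
    have "x = z"
    proof (rule ccontr)
      assume "x \<noteq> z"
      then obtain v where "v \<in> P" "x = add u v" using pred 0 by blast
      then show False using 0 succ_nonzero[of "add v y"] by (simp add: assoc one closed num_0)
    qed
    then show ?case using 0 zero_add[of y] num_0 by (metis)
  next
    case (Suc n)
    show ?case
    proof (cases "x = z")
      case True
      then show ?thesis using Suc.prems zero_add[of y] num_0 by metis
    next
      case False
      then obtain v where v: "v \<in> P" "x = add u v" using pred Suc.prems by blast
      then have "add u (add v y) = add u (num n)"
        using Suc.prems by (simp add: assoc one num_Suc)
      then have "add v y = num n" using cancel[OF one closed[OF v(1) Suc.prems(2)] P] by simp
      then obtain a b where "v = num a" "y = num b" using Suc.IH v(1) Suc.prems(2) by blast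
      then show ?thesis using v(2) num_Suc by metis
    qed
  qed
  have fin: "\<exists>n. x = num n" if x: "x \<in> P" and fin: "finite {y\<in>P. \<exists>w\<in>P. add y w = x}" for x
  proof (rule ccontr)
    assume non: "\<nexists>n. x = num n"
    have "\<exists>v\<in>P. x = add (num k) v" for k
    proof (induction k)
      case 0
      show ?case using zero_add[OF x] x num_0 by metis
    next
      case (Suc k)
      then obtain v where v: "v \<in> P" "x = add (num k) v" by blast
      have "v \<noteq> z" using v non add[of k 0] num_0 by auto
      then obtain w where w: "w \<in> P" "v = add u w" using pred v(1) by blast
      have "x = add (add (num k) u) w" using v w by (simp add: assoc P one)
      also have "add (num k) u = num (Suc k)" by (simp add: num_Suc comm P one)
      finally show ?case using w(1) by blast
    qed
    then have "num k \<in> {y\<in>P. \<exists>w\<in>P. add y w = x}" for k using P[of k] by fastforce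
    then have "range num \<subseteq> {y\<in>P. \<exists>w\<in>P. add y w = x}" by (rule image_subsetI)
    then have "finite (range num)" using fin by (rule finite_subset)
    moreover have "inj num" using eq by (simp add: inj_def)
    ultimately show False using finite_imageD by blast
  qed
  show ?thesis
    by (rule exI[of _ num]) (use P eq add initial fin in blast)
qed

lemma (in presb_interpretation) standard_numerals:
  assumes H: "zgroup K0 H"
  shows "\<exists>num :: nat \<Rightarrow> 'a list set. (\<forall>n. num n \<in> carr (J H)) \<and> (\<forall>a b. num a = num b \<longleftrightarrow> a = b) \<and>
    (\<forall>a b. pl H (num a) (num b) = num (a + b)) \<and>
    (\<forall>x\<in>carr (J H). \<forall>y\<in>carr (J H). \<forall>n. pl H x y = num n \<longrightarrow> (\<exists>a b. x = num a \<and> y = num b)) \<and>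
    (\<forall>x\<in>carr (J H). finite {y\<in>carr (J H). \<exists>w\<in>carr (J H). pl H y w = x} \<longrightarrow> (\<exists>n. x = num n))"
proof -
  have model: "is_struct presb_lang (J H)" "true_in (J H) monoid_sentence"
    using model_J[OF H] monoid_sentence_PrA by (auto simp: is_model_def)
  then obtain c where c: "c \<in> carr (J H)" by (auto simp: is_struct_def)
  have closed: "pl H x y \<in> carr (J H)" if "x \<in> carr (J H)" "y \<in> carr (J H)" for x y
    using model(1) that by (auto simp: is_struct_def presb_lang_def pl_def)
  have "sat (J H) (\<lambda>_. c) monoid_sentence"
    using model(2) c by (auto simp: true_in_def)
  then obtain z u where zu: "z \<in> carr (J H)" "u \<in> carr (J H)"
    and ax: "\<forall>x\<in>carr (J H). \<forall>y\<in>carr (J H). \<forall>w\<in>carr (J H).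
      pl H (pl H x y) w = pl H x (pl H y w) \<and> pl H x y = pl H y x \<and> pl H z x = x \<and>
      (pl H x y = pl H x w \<longrightarrow> y = w) \<and> pl H u x \<noteq> z \<and>
      (x \<noteq> z \<longrightarrow> (\<exists>v\<in>carr (J H). x = pl H u v))"
    unfolding sat_monoid_sentence pl_def[symmetric] by (elim bexE)
  show ?thesis
  proof (rule standard_part[OF zu closed])
    fix x y w assume x: "x \<in> carr (J H)"
    note ax1 = ax[THEN bspec, OF x, THEN bspec, OF x, THEN bspec, OF x]
    show "pl H z x = x" using ax1 by (elim conjE)
    show "pl H u x \<noteq> z" using ax1 by (elim conjE)
    show "\<exists>v\<in>carr (J H). x = pl H u v" if "x \<noteq> z" using ax1 that by (elim conjE) (erule mp)
    assume y: "y \<in> carr (J H)"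
    show "pl H x y = pl H y x" using ax[THEN bspec, OF x, THEN bspec, OF y, THEN bspec, OF y] by (elim conjE)
    assume w: "w \<in> carr (J H)"
    note ax3 = ax[THEN bspec, OF x, THEN bspec, OF y, THEN bspec, OF w]
    show "pl H (pl H x y) w = pl H x (pl H y w)" using ax3 by (elim conjE)
    show "y = w" if "pl H x y = pl H x w" using ax3 that by (elim conjE) (erule mp)
  qed
qed

text \<open>\<open>multiple add n y\<close> is the (n+1)-fold sum: without a constant for zero the
  recursion has to start at one summand.\<close>

primrec multiple :: "('c \<Rightarrow> 'c \<Rightarrow> 'c) \<Rightarrow> nat \<Rightarrow> 'c \<Rightarrow> 'c" where
  "multiple add 0 y = y"
| "multiple add (Suc n) y = add y (multiple add n y)"

primrec shift :: "('c \<Rightarrow> 'c \<Rightarrow> 'c) \<Rightarrow> nat \<Rightarrow> 'c \<Rightarrow> 'c \<Rightarrow> 'c" where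
  "shift add 0 x u = x"
| "shift add (Suc i) x u = add u (shift add i x u)"

text \<open>With x and u in variables 0 and 1, excludes n + 1 as a divisor of u and of x + i u for
  all i below the second argument. A finite disjunction is thus available as a negated
  conjunction.\<close>

primrec no_quotient :: "nat \<Rightarrow> nat \<Rightarrow> (presb_fun, unit) fm" where
  "no_quotient n 0 = Neg (Exi 2 (Eq (Var 1) (multiple Add n (Var 2))))"
| "no_quotient n (Suc i) =
     Conj (no_quotient n i) (Neg (Exi 2 (Eq (shift Add i (Var 0) (Var 1)) (multiple Add n (Var 2)))))"

definition quotient_sentence :: "nat \<Rightarrow> (presb_fun, unit) fm" where
  "quotient_sentence n = All 0 (All 1 (Neg (no_quotient n (Suc n))))"

lemma tm_val_multiple:
  "tm_val M e (multiple Add n t) = multiple (\<lambda>a b. fun_in M Plus [a, b]) n (tm_val M e t)"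
  by (induction n) simp_all

lemma tm_val_shift:
  "tm_val M e (shift Add i s t) = shift (\<lambda>a b. fun_in M Plus [a, b]) i (tm_val M e s) (tm_val M e t)"
  by (induction i) simp_all

lemma sat_no_quotient:
  "sat M e (no_quotient n k) \<longleftrightarrow>
     \<not> (\<exists>y\<in>carr M. e 1 = multiple (\<lambda>a b. fun_in M Plus [a, b]) n y) \<and>
     (\<forall>i<k. \<not> (\<exists>y\<in>carr M. shift (\<lambda>a b. fun_in M Plus [a, b]) i (e 0) (e 1) =
        multiple (\<lambda>a b. fun_in M Plus [a, b]) n y))"
  by (induction k) (auto simp: tm_val_multiple tm_val_shift less_Suc_eq)

lemma sat_quotient_sentence:
  "sat M e (quotient_sentence n) \<longleftrightarrow> (\<forall>x\<in>carr M. \<forall>u\<in>carr M.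
     (\<exists>y\<in>carr M. u = multiple (\<lambda>a b. fun_in M Plus [a, b]) n y) \<or>
     (\<exists>i<Suc n. \<exists>y\<in>carr M. shift (\<lambda>a b. fun_in M Plus [a, b]) i x u =
        multiple (\<lambda>a b. fun_in M Plus [a, b]) n y))"
  unfolding quotient_sentence_def by (simp add: sat_no_quotient del: no_quotient.simps)

lemma wf_quotient_sentence: "quotient_sentence n \<in> sentences presb_lang"
proof -
  have m: "wf_tm presb_lang (multiple Add n t) \<longleftrightarrow> wf_tm presb_lang t"
    "tm_vars (multiple Add n t) = tm_vars t" for n t
    by (induction n) (auto simp: presb_lang_def)
  have s: "wf_tm presb_lang s \<Longrightarrow> wf_tm presb_lang t \<Longrightarrow> wf_tm presb_lang (shift Add i s t)"
    "tm_vars (shift Add i s t) \<subseteq> tm_vars s \<union> tm_vars t" for i s t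
    by (induction i) (auto simp: presb_lang_def)
  have "wf_fm presb_lang (no_quotient n k) \<and> fm_vars (no_quotient n k) \<subseteq> {0, 1}" for k
  proof (induction k)
    case (Suc k)
    then show ?case using s(2)[of k "Var 0" "Var 1"] by (auto simp: m s(1))
  qed (auto simp: m)
  from this[of "Suc n"] show ?thesis
    by (auto simp: quotient_sentence_def sentences_def simp del: no_quotient.simps)
qed

lemma prime_dvd_shift:
  assumes "prime p" "\<not> p dvd u"
  shows "\<exists>i<p. p dvd x + i * (u :: nat)"
proof -
  have "coprime u p" using assms prime_imp_coprime coprime_commute by blast
  then obtain t where t: "[u * t = 1] (mod p)" using cong_solve_coprime_nat by auto
  \<comment> \<open>This is -x/u modulo \<open>p\<close>, with \<open>(p - 1) * x\<close> in place
    of -x because the numbers are natural.\<close>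
  define i where "i = (t * ((p - 1) * x)) mod p"
  have "0 < p" using assms(1) by (simp add: prime_gt_0_nat)
  have "[i * u = t * ((p - 1) * x) * u] (mod p)"
    unfolding i_def by (intro cong_scalar_right) (simp add: cong_def)
  also have "t * ((p - 1) * x) * u = u * t * ((p - 1) * x)" by simp
  also have "[u * t * ((p - 1) * x) = 1 * ((p - 1) * x)] (mod p)"
    using t by (rule cong_scalar_right)
  finally have "[x + i * u = x + 1 * ((p - 1) * x)] (mod p)" by (intro cong_add) simp_all
  also have "x + 1 * ((p - 1) * x) = p * x"
    using \<open>0 < p\<close> by (cases p) simp_all
  finally have "p dvd x + i * u" by (simp add: cong_dvd_iff)
  then show ?thesis using \<open>0 < p\<close> unfolding i_def by (meson mod_less_divisor)
qed

lemma quotient_sentence_PrA: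
  assumes "prime (Suc n)"
  shows "quotient_sentence n \<in> PrA"
proof -
  have m: "multiple (+) n y = Suc n * y" for n y :: nat by (induction n) auto
  have s: "shift (+) i x u = x + i * u" for i x u :: nat by (induction i) auto
  have "sat nat_struct e (quotient_sentence n)" for e
    using prime_dvd_shift[OF assms] unfolding sat_quotient_sentence
    by (simp add: nat_struct_def m s del: mult_Suc) (metis dvd_def)
  then show ?thesis
    using wf_quotient_sentence by (simp add: PrA_def elem_theory_def true_in_def)
qed

text \<open>\<open>x\<close> and \<open>u\<close> are numbered by internal elements, whose division
  holds because the internal model satisfies \<open>PrA\<close>. The internal quotient is a summand
  of a numbered element, hence numbered itself, and its number is the required quotient.\<close>

lemma (in presb_interpretation) prime_division:
  "\<exists>K. \<forall>H :: 'r set. zgroup K H \<longrightarrow> (\<forall>p. prime p \<longrightarrow> (\<forall>x\<in>nonneg H. \<forall>u\<in>nonneg H.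
     (\<exists>l\<in>nonneg H. u = of_nat p * l) \<or> (\<exists>i<p. \<exists>l\<in>nonneg H. x + of_nat i * u = of_nat p * l)))"
proof -
  from standard_numerals[OF zgroup_Ints] obtain num :: "nat \<Rightarrow> 'a list set" where num:
    "\<forall>n. num n \<in> carr (J \<int>)" "\<forall>a b. num a = num b \<longleftrightarrow> a = b"
    "\<forall>a b. pl \<int> (num a) (num b) = num (a + b)"
    "\<forall>x\<in>carr (J \<int>). \<forall>y\<in>carr (J \<int>). \<forall>n. pl \<int> x y = num n \<longrightarrow> (\<exists>a b. x = num a \<and> y = num b)"
    "\<forall>x\<in>carr (J \<int>). finite {y\<in>carr (J \<int>). \<exists>w\<in>carr (J \<int>). pl \<int> y w = x} \<longrightarrow> (\<exists>n. x = num n)"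
    by (elim exE conjE)
  interpret internal_addition m D cl "\<lambda>H. carr (J H)" pl num
  proof
    show "cl \<int> ` {x \<in> Vec m \<int>. D \<int> x} = carr (J \<int>)"
      using carr_J[OF zgroup_Ints] by simp
    show "\<exists>a b. X = num a \<and> Y = num b"
      if "X \<in> carr (J \<int>)" "Y \<in> carr (J \<int>)" "pl \<int> X Y = num n" for X Y n
      using num(4)[rule_format, OF that] .
    show "\<exists>n. X = num n"
      if "X \<in> carr (J \<int>)" "finite {Y \<in> carr (J \<int>). \<exists>Z\<in>carr (J \<int>). pl \<int> Y Z = X}" for X
      using num(5)[rule_format, OF that] .
  qed (simp_all add: num(1-3) vecrel_D vecrel_E vecrel_A)
  obtain R K where R: "\<And>H. zgroup K H \<Longrightarrow> embeds R H" using embeds_in_large by blast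
  have "(\<exists>l\<in>nonneg H. u = of_nat p * l) \<or> (\<exists>i<p. \<exists>l\<in>nonneg H. x + of_nat i * u = of_nat p * l)"
    if H: "zgroup (max K K0) H" and p: "prime p" and x: "x \<in> nonneg H" and u: "u \<in> nonneg H"
    for H :: "'r set" and p x u
  proof -
    have H0: "zgroup K0 H" and HK: "zgroup K H" using zgroup_mono[OF H] by auto
    note embed = R[OF HK, unfolded embeds_def A_def le_def E_def]
    have image: "\<exists>x\<in>Vec m H. D H x \<and> R H k x" if "k \<in> nonneg H" for k
      using embed that by blast
    have sum: "R H (k + l) z"
      if "k \<in> nonneg H" "l \<in> nonneg H" "x \<in> Vec m H" "y \<in> Vec m H" "z \<in> Vec m H" "R H k x" "R H l y"
        "D H x" "D H y" "D H z" "pl H (cl H x) (cl H y) = cl H z" for k l x y z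
      using embed[THEN conjunct2, THEN conjunct1] that by blast
    have summand: "\<exists>l\<in>nonneg H. R H l y"
      if "k \<in> nonneg H" "x \<in> Vec m H" "y \<in> Vec m H" "z \<in> Vec m H" "R H k x"
        "D H x" "D H y" "D H z" "pl H (cl H y) (cl H z) = cl H x" for k x y z
      using embed[THEN conjunct2, THEN conjunct2, THEN conjunct1] that by blast
    have unique: "k = l"
      if "k \<in> nonneg H" "l \<in> nonneg H" "x \<in> Vec m H" "y \<in> Vec m H" "R H k x" "R H l y"
        "D H x" "D H y" "cl H x = cl H y" for k l x y
      using embed[THEN conjunct2, THEN conjunct2, THEN conjunct2] that by blast
    have closed: "pl H X Y \<in> carr (J H)" if "X \<in> carr (J H)" "Y \<in> carr (J H)" for X Y
      using model_J[OF H0] that by (auto simp: is_model_def is_struct_def presb_lang_def pl_def)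
    have vec: "\<exists>c\<in>Vec m H. D H c \<and> cl H c = X" if "X \<in> carr (J H)" for X
      using that carr_J[OF H0] by auto
    have cl: "cl H c \<in> carr (J H)" if "c \<in> Vec m H" "D H c" for c
      using that carr_J[OF H0] by auto
    have of_nat_mult_nonneg: "of_nat i * l \<in> nonneg H" if "l \<in> nonneg H" for i l
      using that zgroup_of_nat_mult[OF H0] by (simp add: nonneg_def)
    have multiple: "\<exists>w\<in>Vec m H. D H w \<and> cl H w = multiple (pl H) n (cl H c) \<and> R H (of_nat (Suc n) * l) w"
      if c: "c \<in> Vec m H" "D H c" "l \<in> nonneg H" "R H l c" for c l n
    proof (induction n)
      case 0
      show ?case using c by auto
    next
      case (Suc n)
      then obtain w where w: "w \<in> Vec m H" "D H w" "cl H w = multiple (pl H) n (cl H c)"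
        "R H (of_nat (Suc n) * l) w" by blast
      obtain v where v: "v \<in> Vec m H" "D H v" "cl H v = pl H (cl H c) (cl H w)"
        using vec[OF closed[OF cl[OF c(1,2)] cl[OF w(1,2)]]] by blast
      have "R H (l + of_nat (Suc n) * l) v"
        using sum[of l "of_nat (Suc n) * l" c w v] c w v of_nat_mult_nonneg[OF c(3), of "Suc n"] by simp
      moreover have "l + of_nat (Suc n) * l = of_nat (Suc (Suc n)) * l" by (simp add: algebra_simps)
      ultimately show ?case using v w(3) by (intro bexI[of _ v]) (simp_all only: multiple.simps simp_thms)
    qed
    have shift: "\<exists>w\<in>Vec m H. D H w \<and> cl H w = shift (pl H) i (cl H a) (cl H b) \<and> R H (x + of_nat i * u) w"
      if a: "a \<in> Vec m H" "D H a" "R H x a" and b: "b \<in> Vec m H" "D H b" "R H u b" for a b i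
    proof (induction i)
      case 0
      show ?case using a by auto
    next
      case (Suc i)
      then obtain w where w: "w \<in> Vec m H" "D H w" "cl H w = shift (pl H) i (cl H a) (cl H b)"
        "R H (x + of_nat i * u) w" by blast
      obtain v where v: "v \<in> Vec m H" "D H v" "cl H v = pl H (cl H b) (cl H w)"
        using vec[OF closed[OF cl[OF b(1,2)] cl[OF w(1,2)]]] by blast
      have "R H (u + (x + of_nat i * u)) v"
        using sum[of u "x + of_nat i * u" b w v] b w v u x of_nat_mult_nonneg[OF u, of i]
          nonneg_add[OF H0] by simp
      moreover have "u + (x + of_nat i * u) = x + of_nat (Suc i) * u" by (simp add: algebra_simps)
      ultimately show ?case using v w(3) by (intro bexI[of _ v]) (simp_all only: shift.simps simp_thms)
    qed
    \<comment> \<open>The p-fold sum is \<open>multiple\<close> with index \<open>p - 1\<close>;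
      writing that index as \<open>Suc n\<close> splits off one copy of the quotient as a
      summand.\<close>
    obtain n where n: "p = Suc (Suc n)"
      using prime_ge_2_nat[OF p] that[of "p - 2"] by simp
    have multiple_carr: "multiple (pl H) k Y \<in> carr (J H)" if "Y \<in> carr (J H)" for k Y
      using that closed by (induction k) auto
    \<comment> \<open>\<open>summand\<close> gives the internal quotient a number \<open>l\<close>.
      Then \<open>v\<close> and \<open>p * l\<close> number the same internal element, and
      \<open>unique\<close> identifies them.\<close>
    have divide: "\<exists>l\<in>nonneg H. v = of_nat p * l"
      if Y: "Y \<in> carr (J H)" and w: "w \<in> Vec m H" "D H w" "cl H w = multiple (pl H) (Suc n) Y"
        and v: "v \<in> nonneg H" "R H v w" for Y w v
    proof -
      obtain c where c: "c \<in> Vec m H" "D H c" "cl H c = Y" using vec[OF Y] by blast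
      obtain d where d: "d \<in> Vec m H" "D H d" "cl H d = multiple (pl H) n Y"
        using vec[OF multiple_carr[OF Y]] by blast
      obtain l where l: "l \<in> nonneg H" "R H l c"
        using summand[OF v(1) w(1) c(1) d(1) v(2) w(2) c(2) d(2)] c(3) d(3) w(3) by auto
      obtain w' where w': "w' \<in> Vec m H" "D H w'" "cl H w' = multiple (pl H) (Suc n) (cl H c)"
        "R H (of_nat p * l) w'" using multiple[OF c(1,2) l, of "Suc n"] unfolding n by blast
      have "v = of_nat p * l"
        using unique[OF v(1) of_nat_mult_nonneg[OF l(1)] w(1) w'(1) v(2) w'(4) w(2) w'(2)]
          w(3) w'(3) c(3) by simp
      then show ?thesis using l(1) by blast
    qed
    have pl_eq: "pl H = (\<lambda>X Y. fun_in (J H) Plus [X, Y])" by (simp add: pl_def fun_eq_iff)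
    obtain a where a: "a \<in> Vec m H" "D H a" "R H x a" using image[OF x] by blast
    obtain b where b: "b \<in> Vec m H" "D H b" "R H u b" using image[OF u] by blast
    have sat: "sat (J H) (\<lambda>_. cl H a) (quotient_sentence (Suc n))"
      using model_J[OF H0] quotient_sentence_PrA[of "Suc n"] p cl[OF a(1,2)]
      by (auto simp: is_model_def true_in_def n)
    have "(\<exists>Y\<in>carr (J H). cl H b = multiple (pl H) (Suc n) Y) \<or>
        (\<exists>i<p. \<exists>Y\<in>carr (J H). shift (pl H) i (cl H a) (cl H b) = multiple (pl H) (Suc n) Y)"
      using sat[unfolded sat_quotient_sentence pl_eq[symmetric],
          THEN bspec, OF cl[OF a(1,2)], THEN bspec, OF cl[OF b(1,2)]]
      unfolding n .
    then show ?thesis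
    proof (elim disjE bexE exE conjE)
      fix Y assume "Y \<in> carr (J H)" "cl H b = multiple (pl H) (Suc n) Y"
      then show ?thesis using divide[OF _ b(1,2) _ u b(3)] by blast
    next
      fix i Y assume i: "i < p" and Y: "Y \<in> carr (J H)"
        "shift (pl H) i (cl H a) (cl H b) = multiple (pl H) (Suc n) Y"
      obtain w where w: "w \<in> Vec m H" "D H w" "cl H w = shift (pl H) i (cl H a) (cl H b)"
        "R H (x + of_nat i * u) w" using shift[OF a b] by blast
      have "\<exists>l\<in>nonneg H. x + of_nat i * u = of_nat p * l"
        using divide[OF Y(1) w(1,2) _ nonneg_add[OF H0 x of_nat_mult_nonneg[OF u]] w(4)] w(3) Y(2)
        by simp
      then show ?thesis using i by blast
    qed
  qed
  then show ?thesis by (intro exI[of _ "max K K0"]) blast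
qed

text \<open>Polynomials are ordered by their leading coefficient, so X is infinitely large.
  Denominators prime to \<open>p\<close> admit division by all smaller numbers but not by
  \<open>p\<close> itself, and integral constant terms keep the order discrete.\<close>

definition localized_group :: "nat \<Rightarrow> rat poly set" where
  "localized_group p = {[:of_int k, a:] | (k :: int) a. \<exists>(c :: int) d. \<not> int p dvd d \<and> a * of_int d = of_int c}"

lemma localized_groupI:
  "\<not> int p dvd d \<Longrightarrow> a * of_int d = of_int c \<Longrightarrow> [:of_int k, a:] \<in> localized_group p"
  unfolding localized_group_def by blast

text \<open>For \<open>n < p\<close> the coefficient of X can be divided by \<open>n\<close> within
  the group, and the whole integer part becomes the remainder. A positive element has a positive
  coefficient of X or is a positive standard integer, which gives discreteness.\<close>

lemma zgroup_localized:
  assumes "prime p"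
  shows "zgroup (p - 1) (localized_group p)"
  unfolding zgroup_def
proof (intro conjI ballI allI impI)
  have "\<not> p dvd 1" using prime_gt_1_nat[OF assms] by simp
  then have p1: "\<not> int p dvd 1" by (metis int_dvd_int_iff of_nat_1)
  show "1 \<in> localized_group p"
    using localized_groupI[OF p1, of 0 0 1] by (simp add: one_pCons)
next
  fix x y assume "x \<in> localized_group p" "y \<in> localized_group p"
  then obtain k a c d l b c' d' where x: "x = [:of_int k, a:]" "\<not> int p dvd d" "a * of_int d = of_int c"
    and y: "y = [:of_int l, b:]" "\<not> int p dvd d'" "b * of_int d' = of_int c'"
    unfolding localized_group_def by blast
  have "\<not> int p dvd d * d'" using assms x(2) y(2) by (simp add: prime_dvd_mult_iff)
  moreover have "(a - b) * of_int (d * d') = of_int (c * d' - c' * d)"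
    using x(3) y(3) by (simp add: algebra_simps)
  ultimately have "[:of_int (k - l), a - b:] \<in> localized_group p" by (rule localized_groupI)
  then show "x - y \<in> localized_group p" by (simp add: x(1) y(1))
next
  fix x assume "x \<in> localized_group p" "0 < x"
  then obtain k a where x: "x = [:of_int k, a:]" unfolding localized_group_def by blast
  have "0 < a \<or> a = 0 \<and> 0 < k"
    using \<open>0 < x\<close> unfolding x less_poly_def by (auto simp: pos_poly_pCons split: if_splits)
  then show "1 \<le> x"
    unfolding x less_eq_poly_def by (auto simp: pos_poly_pCons one_pCons)
next
  fix n x assume n: "0 < n" "n \<le> p - 1" and "x \<in> localized_group p"
  then obtain k a c d where x: "x = [:of_int k, a:]" "\<not> int p dvd d" "a * of_int d = of_int c"
    unfolding localized_group_def by blast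
  have "\<not> p dvd n" using n by (meson dvd_imp_le le_less_trans not_le prime_gt_0_nat assms diff_less zero_less_one)
  then have "\<not> int p dvd d * int n" using assms x(2) by (simp add: prime_dvd_mult_iff)
  moreover have "a / of_nat n * of_int (d * int n) = of_int c" using n x(3) by simp
  ultimately have "[:of_int 0, a / of_nat n:] \<in> localized_group p" by (rule localized_groupI)
  then have "[:0, a / of_nat n:] \<in> localized_group p" by simp
  moreover have "x = of_nat n * [:0, a / of_nat n:] + of_int k"
    using n unfolding x by (simp add: of_nat_poly of_int_poly)
  ultimately show "\<exists>q\<in>localized_group p. \<exists>r. x = of_nat n * q + of_int r" by blast
qed


lemma ex_inj_rat_poly:
  assumes "infinite (UNIV :: 'a set)"
  shows "\<exists>f :: rat poly \<Rightarrow> 'a. inj f"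
proof -
  have "inj (\<lambda>q :: rat poly. to_nat (coeffs q))"
    by (auto simp: inj_def coeffs_eq_iff)
  moreover obtain g :: "nat \<Rightarrow> 'a" where "inj g"
    using infinite_countable_subset[OF assms] by blast
  ultimately have "inj (g \<circ> (\<lambda>q :: rat poly. to_nat (coeffs q)))"
    by (intro inj_compose)
  then show ?thesis by blast
qed

text \<open>Comparing coefficients: the constant term would make \<open>p\<close> divide 1 in the
  first case; in the second, 1 = p a would make \<open>p\<close> divide the denominator
  \<open>d\<close>.\<close>

lemma localized_group_not_divisible:
  assumes p: "prime p" and l: "l \<in> nonneg (localized_group p)"
  shows "1 \<noteq> of_nat p * l" "[:0, 1:] + of_nat i * 1 \<noteq> of_nat p * l"
proof -
  obtain k a c d where l: "l = [:of_int k, a:]" "\<not> int p dvd d" "a * of_int d = of_int c"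
    using l unfolding nonneg_def localized_group_def by blast
  have pl: "of_nat p * l = [:of_int (int p * k), of_nat p * a:]"
    by (simp add: l(1) of_nat_poly)
  show "1 \<noteq> of_nat p * l"
  proof
    assume "1 = of_nat p * l"
    then have "(of_int (int p * k) :: rat) = of_int 1"
      unfolding pl by (simp add: one_pCons)
    then have "int p * k = 1" by (simp only: of_int_eq_iff)
    then have "int p dvd 1" by (metis dvd_triv_left)
    then show False using prime_gt_1_nat[OF p] by simp
  qed
  show "[:0, 1:] + of_nat i * 1 \<noteq> of_nat p * l"
  proof
    assume "[:0, 1:] + of_nat i * 1 = of_nat p * l"
    then have "1 = of_nat p * a" unfolding pl by (simp add: of_nat_poly)
    then have "of_int d = (of_int (int p * c) :: rat)"
      using l(3) by (simp add: algebra_simps flip: l(3))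
    then have "d = int p * c" by (simp only: of_int_eq_iff)
    then show False using l(2) by simp
  qed
qed

theorem theorem5p3:
  fixes U :: "(presb_fun, unit) fm set"
  assumes "infinite (UNIV :: 'a set)"
    and "U \<subseteq> PrA"
    and "finitely_axiomatizable TYPE('a) presb_lang U"
  shows "\<not> interpretable_in TYPE('a) presb_lang PrA presb_lang U"
proof
  assume "interpretable_in TYPE('a) presb_lang PrA presb_lang U"
  then obtain \<iota> :: "(presb_fun, unit, presb_fun, unit) interp"
    where wf: "wf_interp presb_lang presb_lang \<iota>"
      and \<iota>: "\<And>M :: (presb_fun, unit, 'a) fo_struct. is_model presb_lang U M \<Longrightarrow>
        interprets_in_model presb_lang PrA \<iota> M"
    unfolding interpretable_in_def by blast
  obtain F where F: "finite F" "F \<subseteq> sentences presb_lang"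
    and FU: "\<And>M :: (presb_fun, unit, 'a) fo_struct. is_model presb_lang F M \<longleftrightarrow> is_model presb_lang U M"
    using assms(3) unfolding finitely_axiomatizable_def by blast
  obtain f :: "rat poly \<Rightarrow> 'a" where f: "inj f" using ex_inj_rat_poly[OF assms(1)] by blast
  have truth: "true_in (copy_struct f \<int>) \<phi> \<longleftrightarrow> true_in nat_struct \<phi>" if "\<phi> \<in> sentences presb_lang" for \<phi>
    using copy_struct_sat_sentence[OF that zgroup_Ints f] nat_struct_sat_Ints[OF that, where 'r = "rat poly"]
    by simp
  \<comment> \<open>The axioms \<open>F\<close> are not assumed to lie in \<open>PrA\<close>. They
    are true in the natural numbers because a copy of these is a model of \<open>U\<close>, hence of
    \<open>F\<close>.\<close>
  have "true_in (copy_struct f \<int>) \<phi>" if "\<phi> \<in> U" for \<phi>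
    using that assms(2) truth by (auto simp: PrA_def elem_theory_def)
  then have "is_model presb_lang U (copy_struct f \<int>)"
    using is_struct_copy[OF zgroup_Ints f] by (simp add: is_model_def)
  then have "is_model presb_lang F (copy_struct f \<int>)" using FU by blast
  then have "true_in nat_struct \<phi>" if "\<phi> \<in> F" for \<phi>
    using that truth F(2) by (auto simp: is_model_def)
  from transfer_finite[OF F this f] obtain K0
    where K0: "\<And>H. zgroup K0 H \<Longrightarrow> is_model presb_lang F (copy_struct f H)" by blast
  \<comment> \<open>Beyond \<open>K0\<close> a copy satisfies \<open>F\<close>, hence
    \<open>U\<close>, so the interpretation applies to it.\<close>
  interpret presb_interpretation \<iota> f K0 "int_dim \<iota>"
    by unfold_locales (use wf f \<iota> K0 FU in auto)
  obtain K where K: "\<And>H p x u. zgroup K (H :: rat poly set) \<Longrightarrow> prime p \<Longrightarrow> x \<in> nonneg H \<Longrightarrow> u \<in> nonneg H \<Longrightarrow>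
     (\<exists>l\<in>nonneg H. u = of_nat p * l) \<or> (\<exists>i<p. \<exists>l\<in>nonneg H. x + of_nat i * u = of_nat p * l)"
    using prime_division by blast
  \<comment> \<open>\<open>localized_group p\<close> has division up to \<open>p - 1\<close>, which
    is at least \<open>K\<close>; this is all that the transferred sentence requires.\<close>
  obtain p where p: "prime p" "K < p" using bigger_prime by blast
  let ?H = "localized_group p"
  have H: "zgroup K ?H" using p by (intro zgroup_mono[OF zgroup_localized]) auto
  have "\<not> int p dvd 1" using prime_gt_1_nat[OF p(1)] by simp
  then have "[:0, 1:] \<in> ?H"
    using localized_groupI[of p 1 1 1 0] by simp
  then have "[:0, 1:] \<in> nonneg ?H"
    by (simp add: nonneg_def less_eq_poly_def pos_poly_pCons)
  from K[OF H p(1) this nonneg_one[OF H]] show False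
    using localized_group_not_divisible[OF p(1)] by blast
qed

end
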